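(* Let $U$ be an associative $\mathsf{k}$-algebra and $\Gamma\subset U$ a Noetherian Harish-Chandra subalgebra (not necessarily commutative). Given a finitely generated $U$-module $M$, it is a Harish-Chandra module for $(U,\Gamma)$ if and only if $\Gamma$ acts locally finitely on $M$, that is, for each $v\in M$, $\Gamma v$ is finite dimensional over $\mathsf{k}$.
   Context: $\mathsf{k}$ is an arbitrary field. All modules are left modules unless stated otherwise; Noetherian means left and right Noetherian. For a $\mathsf{k}$-algebra $\Gamma$, $\operatorname{cfs}\Gamma$ is the set of maximal two-sided ideals $\mathfrak{m}$ with $\Gamma/\mathfrak{m}$ finite dimensional over $\mathsf{k}$; for such $\mathfrak{m}$, $\mathsf{S}_{\mathfrak{m}}$ is the unique simple $\Gamma/\mathfrak{m}$-module, viewed as a $\Gamma$-module. $\Gamma$ is quasicommutative if $\operatorname{Ext}^1_\Gamma(\mathsf{S}_{\mathfrak{m}},\mathsf{S}_{\mathfrak{n}})=0$ for all distinct $\mathfrak{m},\mathfrak{n}\in\operatorname{cfs}\Gamma$. A subalgebra $\Gamma\subset U$ is quasicentral in $U$ if for every $u\in U$, $\Gamma u\Gamma$ is finitely generated as a left and as a right $\Gamma$-module. $\Gamma$ is a Harish-Chandra subalgebra of $U$ if it is quasicommutative and quasicentral in $U$. A finitely generated $U$-module $M$ is a Harish-Chandra module for $(U,\Gamma)$ if $M=\bigoplus_{\mathfrak{n}\in\operatorname{cfs}\Gamma}M(\mathfrak{n})$, where $M(\mathfrak{n})=\{x\in M:\mathfrak{n}^{N}x=0\text{ for some }N\in\mathbb{Z}_{>0}\}$.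 *)

theory Defs
  imports
    "HOL-Algebra.Module"
    "HOL-Algebra.Subrings"
    "HOL-Algebra.QuotRing"
    "HOL-Algebra.Ideal_Product"
    "HOL-Algebra.Elementary_Groups"
begin

text \<open>
  The library locales \<^locale>\<open>module\<close> and \<^locale>\<open>algebra\<close> are restricted to commutative rings.
  We therefore introduce (unital) modules over arbitrary rings and (unital, associative, possibly
  noncommutative) algebras over a field, on top of the same record types.  The record fields
  \<open>mult\<close> and \<open>one\<close> are irrelevant for modules.
\<close>

locale left_module = R?: ring R + M?: abelian_group M
  for R :: "('r, 'b) ring_scheme" (structure) and M :: "('r, 'm, 'c) module_scheme" (structure) +
  assumes smult_closed [simp, intro]:
      "\<lbrakk>r \<in> carrier R; x \<in> carrier M\<rbrakk> \<Longrightarrow> r \<odot>\<^bsub>M\<^esub> x \<in> carrier M"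
    and smult_l_distr:
      "\<lbrakk>r \<in> carrier R; s \<in> carrier R; x \<in> carrier M\<rbrakk> \<Longrightarrow>
        (r \<oplus>\<^bsub>R\<^esub> s) \<odot>\<^bsub>M\<^esub> x = r \<odot>\<^bsub>M\<^esub> x \<oplus>\<^bsub>M\<^esub> s \<odot>\<^bsub>M\<^esub> x"
    and smult_r_distr:
      "\<lbrakk>r \<in> carrier R; x \<in> carrier M; y \<in> carrier M\<rbrakk> \<Longrightarrow>
        r \<odot>\<^bsub>M\<^esub> (x \<oplus>\<^bsub>M\<^esub> y) = r \<odot>\<^bsub>M\<^esub> x \<oplus>\<^bsub>M\<^esub> r \<odot>\<^bsub>M\<^esub> y"
    and smult_assoc1:
      "\<lbrakk>r \<in> carrier R; s \<in> carrier R; x \<in> carrier M\<rbrakk> \<Longrightarrow>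
        (r \<otimes>\<^bsub>R\<^esub> s) \<odot>\<^bsub>M\<^esub> x = r \<odot>\<^bsub>M\<^esub> (s \<odot>\<^bsub>M\<^esub> x)"
    and smult_one [simp]:
      "x \<in> carrier M \<Longrightarrow> \<one>\<^bsub>R\<^esub> \<odot>\<^bsub>M\<^esub> x = x"

locale assoc_algebra = K?: field K + module K U + U?: ring U
  for K :: "('k, 'b) ring_scheme" (structure) and U :: "('k, 'u, 'c) module_scheme" (structure) +
  assumes smult_mult_left:
      "\<lbrakk>a \<in> carrier K; x \<in> carrier U; y \<in> carrier U\<rbrakk> \<Longrightarrow>
        (a \<odot>\<^bsub>U\<^esub> x) \<otimes>\<^bsub>U\<^esub> y = a \<odot>\<^bsub>U\<^esub> (x \<otimes>\<^bsub>U\<^esub> y)"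
    and smult_mult_right:
      "\<lbrakk>a \<in> carrier K; x \<in> carrier U; y \<in> carrier U\<rbrakk> \<Longrightarrow>
        x \<otimes>\<^bsub>U\<^esub> (a \<odot>\<^bsub>U\<^esub> y) = a \<odot>\<^bsub>U\<^esub> (x \<otimes>\<^bsub>U\<^esub> y)"

text \<open>
  Subsets \<open>\<Gamma>\<close> of \<open>U\<close> and submodules \<open>N\<close> of \<open>M\<close> are turned into structures by
  \<open>U\<lparr>carrier := \<Gamma>\<rparr>\<close> and \<open>M\<lparr>carrier := N\<rparr>\<close>.
\<close>

definition is_subalgebra :: "('k, 'c) ring_scheme \<Rightarrow> ('k, 'u, 'd) module_scheme \<Rightarrow> 'u set \<Rightarrow> bool"
  where "is_subalgebra K U \<Gamma> \<longleftrightarrow>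
    subring \<Gamma> U \<and> (\<forall>a\<in>carrier K. \<forall>x\<in>\<Gamma>. a \<odot>\<^bsub>U\<^esub> x \<in> \<Gamma>)"

definition fin_gen :: "('r, 'c) ring_scheme \<Rightarrow> ('r, 'm, 'd) module_scheme \<Rightarrow> bool"
  where "fin_gen R M \<longleftrightarrow>
    (\<exists>A. finite A \<and> A \<subseteq> carrier M \<and>
      (\<forall>x\<in>carrier M. \<exists>c\<in>A \<rightarrow> carrier R. x = (\<Oplus>\<^bsub>M\<^esub>a\<in>A. c a \<odot>\<^bsub>M\<^esub> a)))"

text \<open>Over a field, finitely generated modules are the finite dimensional vector spaces.\<close>

abbreviation (input) finite_dim :: "('k, 'c) ring_scheme \<Rightarrow> ('k, 'm, 'd) module_scheme \<Rightarrow> bool"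
  where "finite_dim K V \<equiv> fin_gen K V"

text \<open>Right modules over \<open>R\<close> are treated as left modules over the opposite ring.\<close>

definition opp_ring :: "('r, 'c) ring_scheme \<Rightarrow> 'r ring"
  where "opp_ring R =
    \<lparr>carrier = carrier R, monoid.mult = (\<lambda>x y. y \<otimes>\<^bsub>R\<^esub> x), one = \<one>\<^bsub>R\<^esub>, ring.zero = \<zero>\<^bsub>R\<^esub>, ring.add = ring.add R\<rparr>"

definition left_regular :: "('r, 'c) ring_scheme \<Rightarrow> ('r, 'r) module"
  where "left_regular R =
    \<lparr>carrier = carrier R, monoid.mult = monoid.mult R, one = \<one>\<^bsub>R\<^esub>, ring.zero = \<zero>\<^bsub>R\<^esub>, ring.add = ring.add R,
     smult = (\<lambda>r x. r \<otimes>\<^bsub>R\<^esub> x)\<rparr>"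

definition right_regular :: "('r, 'c) ring_scheme \<Rightarrow> ('r, 'r) module"
  where "right_regular R =
    \<lparr>carrier = carrier R, monoid.mult = monoid.mult R, one = \<one>\<^bsub>R\<^esub>, ring.zero = \<zero>\<^bsub>R\<^esub>, ring.add = ring.add R,
     smult = (\<lambda>r x. x \<otimes>\<^bsub>R\<^esub> r)\<rparr>"

definition noetherian_module :: "('r, 'c) ring_scheme \<Rightarrow> ('r, 'm, 'd) module_scheme \<Rightarrow> bool"
  where "noetherian_module R M \<longleftrightarrow>
    (\<forall>N. submodule N R M \<longrightarrow> fin_gen R (M\<lparr>carrier := N\<rparr>))"

text \<open>
  The library's \<open>noetherian_ring\<close> only speaks about two-sided ideals, hence is
  not the right notion for noncommutative rings.
\<close>

definition two_sided_noetherian :: "('r, 'c) ring_scheme \<Rightarrow> bool"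
  where "two_sided_noetherian R \<longleftrightarrow>
    noetherian_module R (left_regular R) \<and> noetherian_module (opp_ring R) (right_regular R)"

definition quot_module :: "('r, 'm, 'c) module_scheme \<Rightarrow> 'm set \<Rightarrow> ('r, 'm set) module"
  where "quot_module M N =
    \<lparr>carrier = a_rcosets\<^bsub>M\<^esub> N, monoid.mult = undefined, one = undefined, ring.zero = N, ring.add = set_add M,
     smult = (\<lambda>r X. \<Union>x\<in>X. N +>\<^bsub>M\<^esub> (r \<odot>\<^bsub>M\<^esub> x))\<rparr>"

definition cfs :: "('k, 'c) ring_scheme \<Rightarrow> ('k, 'u, 'd) module_scheme \<Rightarrow> 'u set set"
  where "cfs K \<Gamma> = {\<mm>. maximalideal \<mm> \<Gamma> \<and> finite_dim K (quot_module \<Gamma> \<mm>)}"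

definition simple_module :: "('r, 'c) ring_scheme \<Rightarrow> ('r, 'm, 'd) module_scheme \<Rightarrow> bool"
  where "simple_module R S \<longleftrightarrow>
    left_module R S \<and> carrier S \<noteq> {\<zero>\<^bsub>S\<^esub>} \<and>
    (\<forall>N. submodule N R S \<longrightarrow> N = {\<zero>\<^bsub>S\<^esub>} \<or> N = carrier S)"

text \<open>An \<open>R/I\<close>-module viewed as an \<open>R\<close>-module.\<close>

definition inflate :: "('r, 'c) ring_scheme \<Rightarrow> 'r set \<Rightarrow> ('r set, 'm, 'd) module_scheme \<Rightarrow> ('r, 'm) module"
  where "inflate R I S =
    \<lparr>carrier = carrier S, monoid.mult = monoid.mult S, one = \<one>\<^bsub>S\<^esub>, ring.zero = \<zero>\<^bsub>S\<^esub>, ring.add = ring.add S,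
     smult = (\<lambda>r x. (I +>\<^bsub>R\<^esub> r) \<odot>\<^bsub>S\<^esub> x)\<rparr>"

text \<open>
  The group \<open>Ext\<^sup>1\<close>, computed from the canonical free resolution
  \<open>F\<^sub>2 \<rightarrow> F\<^sub>1 \<rightarrow> F\<^sub>0 \<rightarrow> A \<rightarrow> 0\<close>: here \<open>F\<^sub>0\<close> is free on the set \<open>A\<close>, and each further term is free on the
  underlying set of the kernel of the preceding map.
\<close>

definition free_mod :: "('r, 'c) ring_scheme \<Rightarrow> 'x set \<Rightarrow> ('r, 'x \<Rightarrow> 'r) module"
  where "free_mod R X =
    \<lparr>carrier = {f. (\<forall>x\<in>X. f x \<in> carrier R) \<and> (\<forall>x. x \<notin> X \<longrightarrow> f x = \<zero>\<^bsub>R\<^esub>) \<and> finite {x. f x \<noteq> \<zero>\<^bsub>R\<^esub>}},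
     monoid.mult = undefined, one = undefined,
     ring.zero = (\<lambda>x. \<zero>\<^bsub>R\<^esub>), ring.add = (\<lambda>f g x. f x \<oplus>\<^bsub>R\<^esub> g x),
     smult = (\<lambda>r f x. r \<otimes>\<^bsub>R\<^esub> f x)\<rparr>"

definition free_eval :: "('r, 'c) ring_scheme \<Rightarrow> ('r, 'm, 'd) module_scheme \<Rightarrow> ('m \<Rightarrow> 'r) \<Rightarrow> 'm"
  where "free_eval R M f = (\<Oplus>\<^bsub>M\<^esub>x\<in>{x. f x \<noteq> \<zero>\<^bsub>R\<^esub>}. f x \<odot>\<^bsub>M\<^esub> x)"

definition eval_kernel :: "('r, 'c) ring_scheme \<Rightarrow> ('r, 'm, 'd) module_scheme \<Rightarrow> 'm set \<Rightarrow> ('m \<Rightarrow> 'r) set"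
  where "eval_kernel R M X = {f \<in> carrier (free_mod R X). free_eval R M f = \<zero>\<^bsub>M\<^esub>}"

definition res0 :: "('r, 'c) ring_scheme \<Rightarrow> ('r, 'a, 'd) module_scheme \<Rightarrow> ('r, 'a \<Rightarrow> 'r) module"
  where "res0 R A = free_mod R (carrier A)"

definition res1 :: "('r, 'c) ring_scheme \<Rightarrow> ('r, 'a, 'd) module_scheme \<Rightarrow> ('r, ('a \<Rightarrow> 'r) \<Rightarrow> 'r) module"
  where "res1 R A = free_mod R (eval_kernel R A (carrier A))"

definition res2 :: "('r, 'c) ring_scheme \<Rightarrow> ('r, 'a, 'd) module_scheme \<Rightarrow>
    ('r, (('a \<Rightarrow> 'r) \<Rightarrow> 'r) \<Rightarrow> 'r) module"
  where "res2 R A = free_mod R (eval_kernel R (res0 R A) (eval_kernel R A (carrier A)))"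

text \<open>The differentials \<open>F\<^sub>1 \<rightarrow> F\<^sub>0\<close> and \<open>F\<^sub>2 \<rightarrow> F\<^sub>1\<close>.\<close>

definition res_d1 :: "('r, 'c) ring_scheme \<Rightarrow> ('r, 'a, 'd) module_scheme \<Rightarrow>
    (('a \<Rightarrow> 'r) \<Rightarrow> 'r) \<Rightarrow> ('a \<Rightarrow> 'r)"
  where "res_d1 R A = free_eval R (res0 R A)"

definition res_d2 :: "('r, 'c) ring_scheme \<Rightarrow> ('r, 'a, 'd) module_scheme \<Rightarrow>
    ((('a \<Rightarrow> 'r) \<Rightarrow> 'r) \<Rightarrow> 'r) \<Rightarrow> (('a \<Rightarrow> 'r) \<Rightarrow> 'r)"
  where "res_d2 R A = free_eval R (res1 R A)"

definition mod_hom :: "('r, 'c) ring_scheme \<Rightarrow> ('r, 'a, 'd) module_scheme \<Rightarrow>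
    ('r, 'b, 'e) module_scheme \<Rightarrow> ('a \<Rightarrow> 'b) set"
  where "mod_hom R A B =
    {f \<in> hom (add_monoid A) (add_monoid B) \<inter> extensional (carrier A).
       \<forall>r\<in>carrier R. \<forall>x\<in>carrier A. f (r \<odot>\<^bsub>A\<^esub> x) = r \<odot>\<^bsub>B\<^esub> f x}"

definition hom_group :: "('r, 'c) ring_scheme \<Rightarrow> ('r, 'a, 'd) module_scheme \<Rightarrow>
    ('r, 'b, 'e) module_scheme \<Rightarrow> ('a \<Rightarrow> 'b) monoid"
  where "hom_group R A B =
    \<lparr>carrier = mod_hom R A B, monoid.mult = (\<lambda>f g. \<lambda>x\<in>carrier A. f x \<oplus>\<^bsub>B\<^esub> g x), one = (\<lambda>x\<in>carrier A. \<zero>\<^bsub>B\<^esub>)\<rparr>"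

definition ext1_cocycles :: "('r, 'c) ring_scheme \<Rightarrow> ('r, 'a, 'd) module_scheme \<Rightarrow>
    ('r, 'b, 'e) module_scheme \<Rightarrow> ((('a \<Rightarrow> 'r) \<Rightarrow> 'r) \<Rightarrow> 'b) set"
  where "ext1_cocycles R A B =
    {f \<in> mod_hom R (res1 R A) B. \<forall>z\<in>carrier (res2 R A). f (res_d2 R A z) = \<zero>\<^bsub>B\<^esub>}"

definition ext1_coboundaries :: "('r, 'c) ring_scheme \<Rightarrow> ('r, 'a, 'd) module_scheme \<Rightarrow>
    ('r, 'b, 'e) module_scheme \<Rightarrow> ((('a \<Rightarrow> 'r) \<Rightarrow> 'r) \<Rightarrow> 'b) set"
  where "ext1_coboundaries R A B =
    (\<lambda>g. \<lambda>z\<in>carrier (res1 R A). g (res_d1 R A z)) ` mod_hom R (res0 R A) B"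

definition Ext1 :: "('r, 'c) ring_scheme \<Rightarrow> ('r, 'a, 'd) module_scheme \<Rightarrow>
    ('r, 'b, 'e) module_scheme \<Rightarrow> ((('a \<Rightarrow> 'r) \<Rightarrow> 'r) \<Rightarrow> 'b) set monoid"
  where "Ext1 R A B =
    (hom_group R (res1 R A) B)\<lparr>carrier := ext1_cocycles R A B\<rparr> Mod ext1_coboundaries R A B"

text \<open>
  The simple \<open>\<Gamma>/\<mm>\<close>-module \<open>S\<^sub>\<mm>\<close> is unique only up to isomorphism; \<open>S\<close> and \<open>T\<close> below run over all
  its representatives.  Their elements are taken from the type \<^typ>\<open>'u set\<close>, which loses
  nothing: every simple module is isomorphic to a quotient of \<open>\<Gamma>\<close> by a maximal left ideal, and the
  elements of such a quotient are cosets, of type \<^typ>\<open>'u set\<close>.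
\<close>

definition quasicommutative :: "('k, 'c) ring_scheme \<Rightarrow> ('k, 'u, 'd) module_scheme \<Rightarrow> bool"
  where "quasicommutative K \<Gamma> \<longleftrightarrow>
    (\<forall>\<mm>\<in>cfs K \<Gamma>. \<forall>\<nn>\<in>cfs K \<Gamma>. \<mm> \<noteq> \<nn> \<longrightarrow>
      (\<forall>(S :: ('u set, 'u set) module) (T :: ('u set, 'u set) module).
         simple_module (\<Gamma> Quot \<mm>) S \<longrightarrow> simple_module (\<Gamma> Quot \<nn>) T \<longrightarrow>
         trivial_group (Ext1 \<Gamma> (inflate \<Gamma> \<mm> S) (inflate \<Gamma> \<nn> T))))"

definition bimodule_gen :: "('u, 'c) ring_scheme \<Rightarrow> 'u set \<Rightarrow> 'u \<Rightarrow> 'u set"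
  where "bimodule_gen U \<Gamma> u =
    generate (add_monoid U) {x \<otimes>\<^bsub>U\<^esub> u \<otimes>\<^bsub>U\<^esub> y | x y. x \<in> \<Gamma> \<and> y \<in> \<Gamma>}"

definition quasicentral :: "('u, 'c) ring_scheme \<Rightarrow> 'u set \<Rightarrow> bool"
  where "quasicentral U \<Gamma> \<longleftrightarrow>
    (\<forall>u\<in>carrier U.
      fin_gen (U\<lparr>carrier := \<Gamma>\<rparr>) ((left_regular U)\<lparr>carrier := bimodule_gen U \<Gamma> u\<rparr>) \<and>
      fin_gen (opp_ring (U\<lparr>carrier := \<Gamma>\<rparr>)) ((right_regular U)\<lparr>carrier := bimodule_gen U \<Gamma> u\<rparr>))"

definition harish_chandra_subalgebra ::
    "('k, 'c) ring_scheme \<Rightarrow> ('k, 'u, 'd) module_scheme \<Rightarrow> 'u set \<Rightarrow> bool"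
  where "harish_chandra_subalgebra K U \<Gamma> \<longleftrightarrow>
    is_subalgebra K U \<Gamma> \<and> quasicommutative K (U\<lparr>carrier := \<Gamma>\<rparr>) \<and> quasicentral U \<Gamma>"

primrec ideal_pow :: "('r, 'c) ring_scheme \<Rightarrow> 'r set \<Rightarrow> nat \<Rightarrow> 'r set"
  where
    "ideal_pow R I 0 = carrier R"
  | "ideal_pow R I (Suc n) = ideal_prod R (ideal_pow R I n) I"

definition gen_weight_space ::
    "('u, 'c) ring_scheme \<Rightarrow> ('u, 'm, 'd) module_scheme \<Rightarrow> 'u set \<Rightarrow> 'm set"
  where "gen_weight_space \<Gamma> M \<nn> =
    {x \<in> carrier M. \<exists>N>0. \<forall>r\<in>ideal_pow \<Gamma> \<nn> N. r \<odot>\<^bsub>M\<^esub> x = \<zero>\<^bsub>M\<^esub>}"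

text \<open>
  \<open>M\<close> is the internal direct sum of the family \<open>N\<close>: the canonical map to \<open>M\<close> from the families
  of finite support is bijective.
\<close>

definition internal_direct_sum ::
    "('r, 'm, 'c) module_scheme \<Rightarrow> 'i set \<Rightarrow> ('i \<Rightarrow> 'm set) \<Rightarrow> bool"
  where "internal_direct_sum M I N \<longleftrightarrow>
    bij_betw (\<lambda>f. \<Oplus>\<^bsub>M\<^esub>i\<in>{i \<in> I. f i \<noteq> \<zero>\<^bsub>M\<^esub>}. f i)
      {f \<in> \<Pi>\<^sub>E i\<in>I. N i. finite {i \<in> I. f i \<noteq> \<zero>\<^bsub>M\<^esub>}} (carrier M)"

definition harish_chandra_module ::
    "('k, 'c) ring_scheme \<Rightarrow> ('k, 'u, 'd) module_scheme \<Rightarrow> 'u set \<Rightarrow> ('u, 'm, 'e) module_scheme \<Rightarrow> bool"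
  where "harish_chandra_module K U \<Gamma> M \<longleftrightarrow>
    left_module U M \<and> fin_gen U M \<and>
    internal_direct_sum M (cfs K (U\<lparr>carrier := \<Gamma>\<rparr>)) (gen_weight_space (U\<lparr>carrier := \<Gamma>\<rparr>) M)"

text \<open>A \<open>U\<close>-module as a vector space over the ground field, via \<open>a \<mapsto> a \<sqdot> 1\<close>.\<close>

definition underlying_space ::
    "('k, 'u, 'd) module_scheme \<Rightarrow> ('u, 'm, 'e) module_scheme \<Rightarrow> ('k, 'm) module"
  where "underlying_space U M =
    \<lparr>carrier = carrier M, monoid.mult = monoid.mult M, one = \<one>\<^bsub>M\<^esub>, ring.zero = \<zero>\<^bsub>M\<^esub>, ring.add = ring.add M,
     smult = (\<lambda>a x. (a \<odot>\<^bsub>U\<^esub> \<one>\<^bsub>U\<^esub>) \<odot>\<^bsub>M\<^esub> x)\<rparr>"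

definition locally_finite_action ::
    "('k, 'c) ring_scheme \<Rightarrow> ('k, 'u, 'd) module_scheme \<Rightarrow> 'u set \<Rightarrow> ('u, 'm, 'e) module_scheme \<Rightarrow> bool"
  where "locally_finite_action K U \<Gamma> M \<longleftrightarrow>
    (\<forall>v\<in>carrier M. finite_dim K ((underlying_space U M)\<lparr>carrier := {x \<odot>\<^bsub>M\<^esub> v | x. x \<in> \<Gamma>}\<rparr>))"

end

theory Submission
  imports Defs
begin

text \<open>
  Write \<open>M(\<nn>)\<close> for the generalised weight spaces. They are always independent, because powers of
  distinct maximal ideals are comaximal. If \<open>\<Gamma>\<close> is left Noetherian, then each \<open>\<Gamma>/\<nn>\<^sup>N\<close> is
  finite dimensional, so sums of weight vectors generate finite dimensional \<open>\<Gamma>\<close>-modules.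

  Conversely, a finite dimensional \<open>\<Gamma>\<close>-module \<open>V\<close> is spanned by its weight vectors, by induction on
  the dimension. Choose \<open>W\<close> maximal in \<open>V\<close> and let \<open>\<mm>\<close> be the annihilator of the simple module
  \<open>V/W\<close>; a density argument shows that \<open>\<mm>\<close> is a maximal ideal of finite codimension. If
  \<open>W \<subseteq> M(\<mm>)\<close>, then \<open>V \<subseteq> M(\<mm>)\<close>. Otherwise some simple quotient \<open>W/X\<close> belongs to
  \<open>\<nn> \<noteq> \<mm>\<close>, and since \<open>Ext\<^sup>1(V/W, W/X) = 0\<close> there is \<open>V' \<subset> V\<close> with \<open>V = V' + W\<close> and
  \<open>V' \<inter> W = X\<close>; the induction hypothesis applies to both summands.
\<close>

section \<open>Modules over noncommutative rings\<close>

text \<open>Vanishing of \<open>Ext1\<close> concerns two simple modules, while \<open>W\<close> may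
  be far from simple; hence the passage to a maximal \<open>X\<close> in \<open>W\<close>. Choosing
  \<open>X\<close> above the intersection of \<open>W\<close> with M(m) is what makes the two simple
  quotients differ: the induction hypothesis, stated for an arbitrary submodule containing all
  weight vectors, yields a weight vector of \<open>W\<close> outside \<open>X\<close>, and its ideal
  n annihilates \<open>W/X\<close>. The vanishing is used as an extension property. The map from
  \<open>W\<close> to \<open>W/X\<close> is extended to all of \<open>V\<close> through the free
  module on the elements of \<open>V/W\<close>, and V' is the kernel of the extension. The density
  argument avoids endomorphism rings. An ideal that does not annihilate \<open>V/W\<close> contains,
  for each finite list of vectors, an element acting on the list as the identity modulo
  \<open>W\<close>. For a list spanning \<open>V\<close> over the field this forces every ideal
  strictly above the annihilator to contain 1.\<close>

lemma (in abelian_group) a_inv_zero: "\<ominus> \<zero> = \<zero>"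
  by (rule minus_equality) auto

lemma (in abelian_group) minus_eq_zeroD:
  assumes "x \<ominus> y = \<zero>" "x \<in> carrier G" "y \<in> carrier G"
  shows "x = y"
proof -
  have "x = (x \<ominus> y) \<oplus> y" using assms(2,3) by (simp add: minus_eq a_assoc l_neg)
  then show ?thesis using assms(1,3) by simp
qed

context left_module begin

lemma smult_l_null [simp]: "x \<in> carrier M \<Longrightarrow> \<zero>\<^bsub>R\<^esub> \<odot>\<^bsub>M\<^esub> x = \<zero>\<^bsub>M\<^esub>"
  by (metis M.add.r_cancel_one' R.r_zero R.zero_closed smult_closed smult_l_distr)

lemma smult_r_null [simp]: "r \<in> carrier R \<Longrightarrow> r \<odot>\<^bsub>M\<^esub> \<zero>\<^bsub>M\<^esub> = \<zero>\<^bsub>M\<^esub>"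
  by (metis M.add.r_cancel_one' M.zero_closed M.r_zero smult_closed smult_r_distr)

lemma smult_l_minus:
  "\<lbrakk>r \<in> carrier R; x \<in> carrier M\<rbrakk> \<Longrightarrow> (\<ominus>\<^bsub>R\<^esub> r) \<odot>\<^bsub>M\<^esub> x = \<ominus>\<^bsub>M\<^esub> (r \<odot>\<^bsub>M\<^esub> x)"
  by (metis M.minus_equality R.a_inv_closed R.l_neg smult_closed smult_l_distr smult_l_null)

lemma smult_r_minus:
  "\<lbrakk>r \<in> carrier R; x \<in> carrier M\<rbrakk> \<Longrightarrow> r \<odot>\<^bsub>M\<^esub> (\<ominus>\<^bsub>M\<^esub> x) = \<ominus>\<^bsub>M\<^esub> (r \<odot>\<^bsub>M\<^esub> x)"
  by (metis M.minus_equality M.a_inv_closed M.l_neg smult_closed smult_r_distr smult_r_null)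

lemma smult_l_diff:
  "\<lbrakk>r \<in> carrier R; s \<in> carrier R; x \<in> carrier M\<rbrakk> \<Longrightarrow>
    (r \<ominus>\<^bsub>R\<^esub> s) \<odot>\<^bsub>M\<^esub> x = r \<odot>\<^bsub>M\<^esub> x \<ominus>\<^bsub>M\<^esub> s \<odot>\<^bsub>M\<^esub> x"
  by (simp add: R.minus_eq M.minus_eq smult_l_distr smult_l_minus)

lemma smult_r_diff:
  "\<lbrakk>r \<in> carrier R; x \<in> carrier M; y \<in> carrier M\<rbrakk> \<Longrightarrow>
    r \<odot>\<^bsub>M\<^esub> (x \<ominus>\<^bsub>M\<^esub> y) = r \<odot>\<^bsub>M\<^esub> x \<ominus>\<^bsub>M\<^esub> r \<odot>\<^bsub>M\<^esub> y"
  by (simp add: M.minus_eq smult_r_distr smult_r_minus)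

text \<open>Closure under negation comes from the unital action: the negative of x is (-1)
  x.\<close>

lemma submodI:
  assumes "N \<subseteq> carrier M" "\<zero>\<^bsub>M\<^esub> \<in> N"
    and "\<And>x y. \<lbrakk>x \<in> N; y \<in> N\<rbrakk> \<Longrightarrow> x \<oplus>\<^bsub>M\<^esub> y \<in> N"
    and smult: "\<And>r x. \<lbrakk>r \<in> carrier R; x \<in> N\<rbrakk> \<Longrightarrow> r \<odot>\<^bsub>M\<^esub> x \<in> N"
  shows "submodule N R M"
proof -
  have "\<ominus>\<^bsub>M\<^esub> x \<in> N" if "x \<in> N" for x
  proof -
    have "x \<in> carrier M" using that assms(1) by auto
    then have "\<ominus>\<^bsub>M\<^esub> x = (\<ominus>\<^bsub>R\<^esub> \<one>\<^bsub>R\<^esub>) \<odot>\<^bsub>M\<^esub> x" by (simp add: smult_l_minus)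
    then show ?thesis using smult[of "\<ominus>\<^bsub>R\<^esub> \<one>\<^bsub>R\<^esub>" x] that by simp
  qed
  then show ?thesis
    using assms by (intro submodule.intro subgroup.intro) (auto simp: submodule_axioms_def a_inv_def)
qed

lemma submodD:
  assumes "submodule N R M"
  shows "N \<subseteq> carrier M" and "\<zero>\<^bsub>M\<^esub> \<in> N"
    and "\<And>x y. \<lbrakk>x \<in> N; y \<in> N\<rbrakk> \<Longrightarrow> x \<oplus>\<^bsub>M\<^esub> y \<in> N"
    and "\<And>r x. \<lbrakk>r \<in> carrier R; x \<in> N\<rbrakk> \<Longrightarrow> r \<odot>\<^bsub>M\<^esub> x \<in> N"
    and "\<And>x. x \<in> N \<Longrightarrow> \<ominus>\<^bsub>M\<^esub> x \<in> N"
    and "\<And>x y. \<lbrakk>x \<in> N; y \<in> N\<rbrakk> \<Longrightarrow> x \<ominus>\<^bsub>M\<^esub> y \<in> N"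
proof -
  interpret N: subgroup N "add_monoid M" using assms by (rule submodule.axioms(1))
  show 1: "N \<subseteq> carrier M" "\<zero>\<^bsub>M\<^esub> \<in> N"
    and 2: "\<And>x y. \<lbrakk>x \<in> N; y \<in> N\<rbrakk> \<Longrightarrow> x \<oplus>\<^bsub>M\<^esub> y \<in> N"
    and 3: "\<And>x. x \<in> N \<Longrightarrow> \<ominus>\<^bsub>M\<^esub> x \<in> N"
    using N.subset N.one_closed N.m_closed N.m_inv_closed by (auto simp: a_inv_def)
  show "\<And>r x. \<lbrakk>r \<in> carrier R; x \<in> N\<rbrakk> \<Longrightarrow> r \<odot>\<^bsub>M\<^esub> x \<in> N"
    using assms by (rule submodule.smult_closed)
  show "\<And>x y. \<lbrakk>x \<in> N; y \<in> N\<rbrakk> \<Longrightarrow> x \<ominus>\<^bsub>M\<^esub> y \<in> N"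
    using 2 3 by (simp add: a_minus_def)
qed

lemma carrier_submod: "submodule (carrier M) R M"
  by (rule submodI) auto

lemma zero_submod: "submodule {\<zero>\<^bsub>M\<^esub>} R M"
  by (rule submodI) auto

lemma cyclic_submod:
  assumes "x \<in> carrier M"
  shows "submodule {r \<odot>\<^bsub>M\<^esub> x | r. r \<in> carrier R} R M"
proof (rule submodI)
  show "\<zero>\<^bsub>M\<^esub> \<in> {r \<odot>\<^bsub>M\<^esub> x | r. r \<in> carrier R}"
    using assms smult_l_null[symmetric] by blast
next
  fix y z assume "y \<in> {r \<odot>\<^bsub>M\<^esub> x | r. r \<in> carrier R}" "z \<in> {r \<odot>\<^bsub>M\<^esub> x | r. r \<in> carrier R}"
  then show "y \<oplus>\<^bsub>M\<^esub> z \<in> {r \<odot>\<^bsub>M\<^esub> x | r. r \<in> carrier R}"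
    using assms smult_l_distr[symmetric] R.add.m_closed by blast
next
  fix r y assume "r \<in> carrier R" "y \<in> {r \<odot>\<^bsub>M\<^esub> x | r. r \<in> carrier R}"
  then show "r \<odot>\<^bsub>M\<^esub> y \<in> {r \<odot>\<^bsub>M\<^esub> x | r. r \<in> carrier R}"
    using assms smult_assoc1[symmetric] R.m_closed by blast
qed (use assms in auto)

lemma submod_Int:
  assumes N: "submodule N R M" and N': "submodule N' R M"
  shows "submodule (N \<inter> N') R M"
  by (rule submodI) (use submodD[OF N] submodD[OF N'] in auto)

lemma submod_sum:
  assumes N: "submodule N R M" and N': "submodule N' R M"
  shows "submodule {x \<oplus>\<^bsub>M\<^esub> y | x y. x \<in> N \<and> y \<in> N'} R M" (is "submodule ?S R M")
proof (rule submodI)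
  show sub: "?S \<subseteq> carrier M" using submodD(1)[OF N] submodD(1)[OF N'] by auto
  show "\<zero>\<^bsub>M\<^esub> \<in> ?S" using submodD(2)[OF N] submodD(2)[OF N'] M.r_zero[OF M.zero_closed, symmetric] by blast
next
  fix a b assume "a \<in> ?S" "b \<in> ?S"
  then obtain x y x' y' where *: "a = x \<oplus>\<^bsub>M\<^esub> y" "b = x' \<oplus>\<^bsub>M\<^esub> y'"
    "x \<in> N" "x' \<in> N" "y \<in> N'" "y' \<in> N'" by blast
  moreover have "x \<in> carrier M" "x' \<in> carrier M" "y \<in> carrier M" "y' \<in> carrier M"
    using * submodD(1)[OF N] submodD(1)[OF N'] by auto
  ultimately have "a \<oplus>\<^bsub>M\<^esub> b = (x \<oplus>\<^bsub>M\<^esub> x') \<oplus>\<^bsub>M\<^esub> (y \<oplus>\<^bsub>M\<^esub> y')" by (simp add: M.add.m_ac)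
  then show "a \<oplus>\<^bsub>M\<^esub> b \<in> ?S" using * submodD(3)[OF N] submodD(3)[OF N'] by blast
next
  fix r a assume r: "r \<in> carrier R" and "a \<in> ?S"
  then obtain x y where *: "a = x \<oplus>\<^bsub>M\<^esub> y" "x \<in> N" "y \<in> N'" by blast
  then have "r \<odot>\<^bsub>M\<^esub> a = r \<odot>\<^bsub>M\<^esub> x \<oplus>\<^bsub>M\<^esub> r \<odot>\<^bsub>M\<^esub> y"
    using r submodD(1)[OF N] submodD(1)[OF N'] by (auto intro!: smult_r_distr)
  then show "r \<odot>\<^bsub>M\<^esub> a \<in> ?S" using * r submodD(4)[OF N] submodD(4)[OF N'] by blast
qed

lemma submod_left_module:
  assumes N: "submodule N R M"
  shows "left_module R (M\<lparr>carrier := N\<rparr>)"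
proof -
  have "abelian_group (M\<lparr>carrier := N\<rparr>)"
    by (rule abelian_groupI)
      (use submodD[OF N] in \<open>auto simp: M.a_assoc subset_iff intro: M.a_comm
         intro!: bexI[of _ "\<ominus>\<^bsub>M\<^esub> _"] M.l_neg\<close>)
  then show ?thesis
    using submodD[OF N] R.ring_axioms
    by (intro left_module.intro left_module_axioms.intro)
      (auto simp: subset_iff smult_l_distr smult_r_distr smult_assoc1)
qed

lemma submod_finsum:
  assumes N: "submodule N R M" and "f \<in> A \<rightarrow> N"
  shows "finsum M f A \<in> N"
  using assms(2)
proof (induction A rule: infinite_finite_induct)
  case (insert a A)
  then have "f \<in> A \<rightarrow> carrier M" "f a \<in> carrier M" using submodD(1)[OF N] by auto
  then show ?case using insert submodD(3)[OF N] by (simp add: Pi_def)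
qed (use submodD(2)[OF N] in auto)

lemma submod_add_cancel:
  assumes N: "submodule N R M" and "x \<in> N" "y \<in> carrier M" "x \<oplus>\<^bsub>M\<^esub> y \<in> N"
  shows "y \<in> N"
proof -
  have "x \<in> carrier M" using assms submodD(1)[OF N] by auto
  then have "y = (x \<oplus>\<^bsub>M\<^esub> y) \<ominus>\<^bsub>M\<^esub> x"
    using assms by (metis M.a_comm M.add.inv_solve_right' M.minus_eq M.a_closed)
  then show ?thesis using submodD(6)[OF N assms(4,2)] by simp
qed

lemma finsum_smult:
  "\<lbrakk>r \<in> carrier R; f \<in> A \<rightarrow> carrier M\<rbrakk> \<Longrightarrow>
     r \<odot>\<^bsub>M\<^esub> finsum M f A = (\<Oplus>\<^bsub>M\<^esub>i\<in>A. r \<odot>\<^bsub>M\<^esub> f i)"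
proof (induction A rule: infinite_finite_induct)
  case (insert x F)
  then have "f \<in> F \<rightarrow> carrier M" "f x \<in> carrier M" by auto
  with insert show ?case by (simp add: smult_r_distr Pi_def)
qed auto

end

section \<open>Images and quotients of modules\<close>

text \<open>Every module law in \<open>S\<close> is the image under \<open>p\<close> of the same law
  in \<open>M\<close>. The second ring with its surjection \<open>h\<close> turns a quotient of an
  \<open>R\<close>-module into a module over \<open>R Quot n\<close>; with \<open>h\<close> the
  identity the lemma covers ordinary quotients and inflations.\<close>

lemma left_module_image:
  assumes M: "left_module R M" and R': "ring R'" and S: "carrier S = p ` carrier M"
    and zero: "\<zero>\<^bsub>S\<^esub> = p \<zero>\<^bsub>M\<^esub>"
    and add: "\<And>x y. \<lbrakk>x \<in> carrier M; y \<in> carrier M\<rbrakk> \<Longrightarrow> p (x \<oplus>\<^bsub>M\<^esub> y) = p x \<oplus>\<^bsub>S\<^esub> p y"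
    and h: "h \<in> ring_hom R R'" and surj: "carrier R' \<subseteq> h ` carrier R"
    and smult: "\<And>r x. \<lbrakk>r \<in> carrier R; x \<in> carrier M\<rbrakk> \<Longrightarrow> p (r \<odot>\<^bsub>M\<^esub> x) = h r \<odot>\<^bsub>S\<^esub> p x"
  shows "left_module R' S"
proof -
  interpret left_module R M by (rule M)
  have "abelian_group S"
  proof (rule abelian_groupI)
    fix x assume "x \<in> carrier S"
    then obtain x' where x': "x = p x'" "x' \<in> carrier M" using S by auto
    then have "p (\<ominus>\<^bsub>M\<^esub> x') \<oplus>\<^bsub>S\<^esub> x = \<zero>\<^bsub>S\<^esub>"
      using add[of "\<ominus>\<^bsub>M\<^esub> x'" x'] by (simp add: zero M.l_neg)
    then show "\<exists>y\<in>carrier S. y \<oplus>\<^bsub>S\<^esub> x = \<zero>\<^bsub>S\<^esub>" using x' S by auto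
  qed (auto simp: S zero M.a_assoc simp flip: add, simp add: M.a_comm)
  moreover have "left_module_axioms R' S"
  proof -
    have *: "r \<odot>\<^bsub>S\<^esub> x \<in> carrier S \<and> (r \<oplus>\<^bsub>R'\<^esub> s) \<odot>\<^bsub>S\<^esub> x = r \<odot>\<^bsub>S\<^esub> x \<oplus>\<^bsub>S\<^esub> s \<odot>\<^bsub>S\<^esub> x \<and>
        r \<odot>\<^bsub>S\<^esub> (x \<oplus>\<^bsub>S\<^esub> y) = r \<odot>\<^bsub>S\<^esub> x \<oplus>\<^bsub>S\<^esub> r \<odot>\<^bsub>S\<^esub> y \<and>
        (r \<otimes>\<^bsub>R'\<^esub> s) \<odot>\<^bsub>S\<^esub> x = r \<odot>\<^bsub>S\<^esub> (s \<odot>\<^bsub>S\<^esub> x) \<and> \<one>\<^bsub>R'\<^esub> \<odot>\<^bsub>S\<^esub> x = x"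
      if rs: "r \<in> carrier R'" "s \<in> carrier R'" "x \<in> carrier S" "y \<in> carrier S" for r s x y
    proof -
      obtain r' s' x' y' where *: "r = h r'" "s = h s'" "x = p x'" "y = p y'"
        "r' \<in> carrier R" "s' \<in> carrier R" "x' \<in> carrier M" "y' \<in> carrier M"
        using rs S surj by (smt (verit) imageE subsetD)
      show ?thesis
        using * S by (simp flip: smult add ring_hom_add[OF h] ring_hom_mult[OF h] ring_hom_one[OF h]
            add: smult_l_distr smult_r_distr smult_assoc1)
    qed
    have "\<one>\<^bsub>R'\<^esub> \<in> carrier R'" using R' by (simp add: ring.ring_simprules(6))
    then show ?thesis using * by (intro left_module_axioms.intro) blast+
  qed
  ultimately show ?thesis using R' by (intro left_module.intro)
qed

lemma (in left_module)
  assumes N: "submodule N R M"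
  shows submod_abelian_subgroup: "abelian_subgroup N M"
    and quot_module_carrier: "carrier (quot_module M N) = (\<lambda>x. N +>\<^bsub>M\<^esub> x) ` carrier M"
    and quot_module_add: "\<lbrakk>x \<in> carrier M; y \<in> carrier M\<rbrakk> \<Longrightarrow>
      (N +>\<^bsub>M\<^esub> x) \<oplus>\<^bsub>quot_module M N\<^esub> (N +>\<^bsub>M\<^esub> y) = N +>\<^bsub>M\<^esub> (x \<oplus>\<^bsub>M\<^esub> y)"
    and quot_module_smult: "\<lbrakk>r \<in> carrier R; x \<in> carrier M\<rbrakk> \<Longrightarrow>
      r \<odot>\<^bsub>quot_module M N\<^esub> (N +>\<^bsub>M\<^esub> x) = N +>\<^bsub>M\<^esub> (r \<odot>\<^bsub>M\<^esub> x)"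
    and quot_module_zero: "\<zero>\<^bsub>quot_module M N\<^esub> = N +>\<^bsub>M\<^esub> \<zero>\<^bsub>M\<^esub>"
    and quot_module_left_module: "left_module R (quot_module M N)"
    and coset_eq_iff: "\<lbrakk>x \<in> carrier M; y \<in> carrier M\<rbrakk> \<Longrightarrow> N +>\<^bsub>M\<^esub> x = N +>\<^bsub>M\<^esub> y \<longleftrightarrow> x \<ominus>\<^bsub>M\<^esub> y \<in> N"
proof -
  show ab: "abelian_subgroup N M"
    by (rule abelian_subgroupI3) (use N M.abelian_group_axioms in \<open>auto intro: additive_subgroup.intro submodule.axioms\<close>)
  then interpret N: abelian_subgroup N M .
  show car: "carrier (quot_module M N) = (\<lambda>x. N +>\<^bsub>M\<^esub> x) ` carrier M"
    by (auto simp: quot_module_def A_RCOSETS_def' a_r_coset_def')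
  show add: "(N +>\<^bsub>M\<^esub> x) \<oplus>\<^bsub>quot_module M N\<^esub> (N +>\<^bsub>M\<^esub> y) = N +>\<^bsub>M\<^esub> (x \<oplus>\<^bsub>M\<^esub> y)"
    if "x \<in> carrier M" "y \<in> carrier M" for x y
    using that by (simp add: quot_module_def N.a_rcos_sum)
  show eq: "N +>\<^bsub>M\<^esub> x = N +>\<^bsub>M\<^esub> y \<longleftrightarrow> x \<ominus>\<^bsub>M\<^esub> y \<in> N" if "x \<in> carrier M" "y \<in> carrier M" for x y
  proof -
    have "x \<in> N +>\<^bsub>M\<^esub> y \<longleftrightarrow> x \<ominus>\<^bsub>M\<^esub> y \<in> N"
      using that by (simp add: N.a_rcos_module M.minus_eq)
    then show ?thesis using N.a_rcos_self[OF that(1)] N.a_repr_independence'[OF _ that(2)] by blast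
  qed
  show smult: "r \<odot>\<^bsub>quot_module M N\<^esub> (N +>\<^bsub>M\<^esub> x) = N +>\<^bsub>M\<^esub> (r \<odot>\<^bsub>M\<^esub> x)"
    if "r \<in> carrier R" "x \<in> carrier M" for r x
  proof -
    \<comment> \<open>\<open>quot_module\<close> defines the action as a union over all
      representatives; the union collapses because each of them gives the same coset.\<close>
    have "N +>\<^bsub>M\<^esub> (r \<odot>\<^bsub>M\<^esub> y) = N +>\<^bsub>M\<^esub> (r \<odot>\<^bsub>M\<^esub> x)" if y: "y \<in> N +>\<^bsub>M\<^esub> x" for y
    proof -
      have y': "y \<in> carrier M" using y \<open>x \<in> carrier M\<close> N.a_elemrcos_carrier by blast
      then have "y \<ominus>\<^bsub>M\<^esub> x \<in> N" using y \<open>x \<in> carrier M\<close> N.a_rcos_module M.minus_eq by metis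
      then have "r \<odot>\<^bsub>M\<^esub> (y \<ominus>\<^bsub>M\<^esub> x) \<in> N" using submodD(4)[OF N] \<open>r \<in> carrier R\<close> by blast
      then have "r \<odot>\<^bsub>M\<^esub> y \<ominus>\<^bsub>M\<^esub> r \<odot>\<^bsub>M\<^esub> x \<in> N"
        unfolding smult_r_diff[OF \<open>r \<in> carrier R\<close> y' \<open>x \<in> carrier M\<close>] .
      then show ?thesis
        using eq[OF smult_closed[OF \<open>r \<in> carrier R\<close> y'] smult_closed[OF \<open>r \<in> carrier R\<close> \<open>x \<in> carrier M\<close>]]
        by blast
    qed
    then have "(\<Union>y\<in>N +>\<^bsub>M\<^esub> x. N +>\<^bsub>M\<^esub> (r \<odot>\<^bsub>M\<^esub> y)) = (\<Union>y\<in>N +>\<^bsub>M\<^esub> x. N +>\<^bsub>M\<^esub> (r \<odot>\<^bsub>M\<^esub> x))"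
      by (rule SUP_cong[OF refl])
    also have "\<dots> = N +>\<^bsub>M\<^esub> (r \<odot>\<^bsub>M\<^esub> x)" using N.a_rcos_self[OF that(2)] by blast
    finally show ?thesis by (simp add: quot_module_def)
  qed
  show zero: "\<zero>\<^bsub>quot_module M N\<^esub> = N +>\<^bsub>M\<^esub> \<zero>\<^bsub>M\<^esub>"
    using submodD(1)[OF N] by (simp add: quot_module_def)
  show "left_module R (quot_module M N)"
    by (rule left_module_image[of R M R _ "\<lambda>x. N +>\<^bsub>M\<^esub> x" "\<lambda>r. r"])
      (auto simp: left_module_axioms R.ring_axioms car add smult zero ring_hom_def)
qed

text \<open>The set is the sum of the family \<open>N\<close>. For the weight spaces it is the
  submodule in which every vector will have to be found.\<close>

lemma (in left_module) finite_sums_submod: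
  assumes N: "\<And>i. i \<in> I \<Longrightarrow> submodule (N i) R M"
  shows "submodule {finsum M h A | h A. finite A \<and> A \<subseteq> I \<and> (\<forall>i\<in>A. h i \<in> N i)} R M"
    (is "submodule ?S R M")
proof (rule submodI)
  have NM: "x \<in> carrier M" if "i \<in> I" "x \<in> N i" for i x using submodD(1)[OF N] that by blast
  show "?S \<subseteq> carrier M"
  proof
    fix x assume "x \<in> ?S"
    then obtain h A where h: "finite A" "A \<subseteq> I" "\<forall>i\<in>A. h i \<in> N i" "x = finsum M h A" by blast
    have "h \<in> A \<rightarrow> carrier M" using h NM by blast
    then show "x \<in> carrier M" unfolding h(4) by (rule M.finsum_closed)
  qed
  show "\<zero>\<^bsub>M\<^esub> \<in> ?S" unfolding mem_Collect_eq by (intro exI[of _ undefined] exI[of _ "{}"]) simp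
  fix r assume r: "r \<in> carrier R"
  fix x assume "x \<in> ?S"
  then obtain h A where h: "finite A" "A \<subseteq> I" "\<forall>i\<in>A. h i \<in> N i" "x = finsum M h A" by blast
  have hM: "h \<in> A \<rightarrow> carrier M" using h NM by blast
  have "r \<odot>\<^bsub>M\<^esub> x = (\<Oplus>\<^bsub>M\<^esub>i\<in>A. r \<odot>\<^bsub>M\<^esub> h i)" unfolding h(4) by (rule finsum_smult[OF r hM])
  moreover have "\<forall>i\<in>A. r \<odot>\<^bsub>M\<^esub> h i \<in> N i" using h(2,3) submodD(4)[OF N r] by blast
  ultimately show "r \<odot>\<^bsub>M\<^esub> x \<in> ?S" using h(1,2) by blast
next
  have NM: "x \<in> carrier M" if "i \<in> I" "x \<in> N i" for i x using submodD(1)[OF N] that by blast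
  fix x y assume "x \<in> ?S" "y \<in> ?S"
  then obtain h A g B where h: "finite A" "A \<subseteq> I" "\<forall>i\<in>A. h i \<in> N i" "x = finsum M h A"
    and g: "finite B" "B \<subseteq> I" "\<forall>i\<in>B. g i \<in> N i" "y = finsum M g B" by blast
  \<comment> \<open>Families with different supports are padded by zero to the union, so that the
    two sums can be added termwise.\<close>
  let ?h = "\<lambda>i. if i \<in> A then h i else \<zero>\<^bsub>M\<^esub>" and ?g = "\<lambda>i. if i \<in> B then g i else \<zero>\<^bsub>M\<^esub>"
  have hN: "?h i \<in> N i" "?g i \<in> N i" if "i \<in> A \<union> B" for i
    using that h g submodD(2)[OF N, of i] by auto
  then have cl: "?h \<in> A \<union> B \<rightarrow> carrier M" "?g \<in> A \<union> B \<rightarrow> carrier M"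
    using NM h(2) g(2) by blast+
  have "finsum M ?h (A \<union> B) = finsum M h A" "finsum M ?g (A \<union> B) = finsum M g B"
    by (rule M.add.finprod_mono_neutral_cong_right; use h(1) g(1) cl in auto)+
  then have "x \<oplus>\<^bsub>M\<^esub> y = (\<Oplus>\<^bsub>M\<^esub>i\<in>A \<union> B. ?h i \<oplus>\<^bsub>M\<^esub> ?g i)"
    unfolding h(4) g(4) using M.finsum_addf[OF cl] by simp
  moreover have "\<forall>i\<in>A \<union> B. ?h i \<oplus>\<^bsub>M\<^esub> ?g i \<in> N i"
  proof
    fix i assume i: "i \<in> A \<union> B"
    then have "i \<in> I" using h(2) g(2) by blast
    show "?h i \<oplus>\<^bsub>M\<^esub> ?g i \<in> N i" using submodD(3)[OF N[OF \<open>i \<in> I\<close>] hN[OF i]] .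
  qed
  moreover have "finite (A \<union> B)" "A \<union> B \<subseteq> I" using h(1,2) g(1,2) by auto
  ultimately show "x \<oplus>\<^bsub>M\<^esub> y \<in> ?S" unfolding mem_Collect_eq
    by (intro exI[of _ "\<lambda>i. ?h i \<oplus>\<^bsub>M\<^esub> ?g i"] exI[of _ "A \<union> B"] conjI)
qed

text \<open>In contrast to \<open>mod_hom\<close>, values outside the carrier are left free, so
  action maps and compositions qualify without being restricted.\<close>

definition linear_map :: "('r, 'c) ring_scheme \<Rightarrow> ('r, 'm, 'd) module_scheme \<Rightarrow>
    ('r, 'n, 'e) module_scheme \<Rightarrow> ('m \<Rightarrow> 'n) \<Rightarrow> bool"
  where "linear_map R M N p \<longleftrightarrow> p \<in> carrier M \<rightarrow> carrier N \<and>
    (\<forall>x\<in>carrier M. \<forall>y\<in>carrier M. p (x \<oplus>\<^bsub>M\<^esub> y) = p x \<oplus>\<^bsub>N\<^esub> p y) \<and>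
    (\<forall>r\<in>carrier R. \<forall>x\<in>carrier M. p (r \<odot>\<^bsub>M\<^esub> x) = r \<odot>\<^bsub>N\<^esub> p x)"

lemma linear_mapD:
  assumes "linear_map R M N p"
  shows "x \<in> carrier M \<Longrightarrow> p x \<in> carrier N"
    and "\<lbrakk>x \<in> carrier M; y \<in> carrier M\<rbrakk> \<Longrightarrow> p (x \<oplus>\<^bsub>M\<^esub> y) = p x \<oplus>\<^bsub>N\<^esub> p y"
    and "\<lbrakk>r \<in> carrier R; x \<in> carrier M\<rbrakk> \<Longrightarrow> p (r \<odot>\<^bsub>M\<^esub> x) = r \<odot>\<^bsub>N\<^esub> p x"
  using assms by (auto simp: linear_map_def)

lemma linear_map_zero:
  assumes M: "left_module R M" and N: "left_module R N" and p: "linear_map R M N p"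
  shows "p \<zero>\<^bsub>M\<^esub> = \<zero>\<^bsub>N\<^esub>"
proof -
  interpret M: left_module R M by fact
  interpret N: left_module R N by fact
  have "p (\<zero>\<^bsub>R\<^esub> \<odot>\<^bsub>M\<^esub> \<zero>\<^bsub>M\<^esub>) = \<zero>\<^bsub>R\<^esub> \<odot>\<^bsub>N\<^esub> p \<zero>\<^bsub>M\<^esub>"
    by (rule linear_mapD(3)[OF p]) auto
  then show ?thesis using linear_mapD(1)[OF p] by simp
qed

lemma linear_map_diff:
  assumes M: "left_module R M" and N: "left_module R N" and p: "linear_map R M N p"
    and x: "x \<in> carrier M" and y: "y \<in> carrier M"
  shows "p (x \<ominus>\<^bsub>M\<^esub> y) = p x \<ominus>\<^bsub>N\<^esub> p y"
proof -
  interpret M: left_module R M by fact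
  interpret N: left_module R N by fact
  have "p (x \<ominus>\<^bsub>M\<^esub> y) \<oplus>\<^bsub>N\<^esub> p y = p ((x \<ominus>\<^bsub>M\<^esub> y) \<oplus>\<^bsub>M\<^esub> y)"
    by (rule linear_mapD(2)[OF p, symmetric]) (use x y in auto)
  also have "(x \<ominus>\<^bsub>M\<^esub> y) \<oplus>\<^bsub>M\<^esub> y = x"
    using x y by (simp add: M.minus_eq M.a_assoc M.l_neg)
  finally have "p (x \<ominus>\<^bsub>M\<^esub> y) \<oplus>\<^bsub>N\<^esub> p y = p x" .
  moreover have "p (x \<ominus>\<^bsub>M\<^esub> y) \<in> carrier N" "p y \<in> carrier N"
    using linear_mapD(1)[OF p] x y by auto
  ultimately show ?thesis by (metis N.add.inv_solve_right' N.minus_eq N.a_closed)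
qed

lemma linear_map_finsum:
  assumes M: "left_module R M" and N: "left_module R N" and p: "linear_map R M N p"
    and "f \<in> A \<rightarrow> carrier M"
  shows "p (finsum M f A) = (\<Oplus>\<^bsub>N\<^esub>x\<in>A. p (f x))"
proof -
  interpret M: left_module R M by fact
  interpret N: left_module R N by fact
  show ?thesis using assms(4)
  proof (induction A rule: infinite_finite_induct)
    case (insert a A)
    then have f: "f \<in> A \<rightarrow> carrier M" "f a \<in> carrier M" by auto
    then have pf: "(\<lambda>x. p (f x)) \<in> A \<rightarrow> carrier N" "p (f a) \<in> carrier N"
      using linear_mapD(1)[OF p] by auto
    have "p (finsum M f (insert a A)) = p (f a \<oplus>\<^bsub>M\<^esub> finsum M f A)" using insert f by simp
    also have "\<dots> = p (f a) \<oplus>\<^bsub>N\<^esub> p (finsum M f A)" using f by (intro linear_mapD(2)[OF p]) auto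
    also have "\<dots> = p (f a) \<oplus>\<^bsub>N\<^esub> (\<Oplus>\<^bsub>N\<^esub>x\<in>A. p (f x))" using insert.IH f by simp
    also have "\<dots> = (\<Oplus>\<^bsub>N\<^esub>x\<in>insert a A. p (f x))" using insert pf by simp
    finally show ?case .
  qed (simp_all add: linear_map_zero[OF M N p])
qed

section \<open>Spans and finite generation\<close>

text \<open>Generators form a list rather than the finite set of \<open>fin_gen\<close>: this
  permits induction on the generators, and the length of a list later bounds the dimension.\<close>

primrec lspan :: "('r, 'c) ring_scheme \<Rightarrow> ('r, 'm, 'd) module_scheme \<Rightarrow> 'm list \<Rightarrow> 'm set"
  where
    "lspan R M [] = {\<zero>\<^bsub>M\<^esub>}"
  | "lspan R M (x # xs) = {a \<odot>\<^bsub>M\<^esub> x \<oplus>\<^bsub>M\<^esub> y | a y. a \<in> carrier R \<and> y \<in> lspan R M xs}"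

text \<open>Only the operations enter a span, not the carrier, so a span computed in a submodule is
  the span in the whole module.\<close>

lemma lspan_cong:
  assumes "ring.add M = ring.add N" "ring.zero M = ring.zero N" "smult M = smult N"
  shows "lspan R M xs = lspan R N xs"
  using assms by (induction xs) auto

context left_module begin

lemma lspan_submod: "set xs \<subseteq> carrier M \<Longrightarrow> submodule (lspan R M xs) R M"
proof (induction xs)
  case (Cons x xs)
  then have "submodule {y \<oplus>\<^bsub>M\<^esub> z | y z. y \<in> {a \<odot>\<^bsub>M\<^esub> x | a. a \<in> carrier R} \<and> z \<in> lspan R M xs} R M"
    by (intro submod_sum cyclic_submod) auto
  moreover have "{y \<oplus>\<^bsub>M\<^esub> z | y z. y \<in> {a \<odot>\<^bsub>M\<^esub> x | a. a \<in> carrier R} \<and> z \<in> lspan R M xs}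
    = lspan R M (x # xs)" by auto
  ultimately show ?case by simp
qed (simp add: zero_submod)

lemma lspan_superset: "set xs \<subseteq> carrier M \<Longrightarrow> set xs \<subseteq> lspan R M xs"
proof (induction xs)
  case (Cons x xs)
  note sub = submodD[OF lspan_submod[of xs]]
  have x: "x \<in> carrier M" and xs: "set xs \<subseteq> carrier M" using Cons.prems by auto
  have "x \<in> lspan R M (x # xs)"
    unfolding lspan.simps mem_Collect_eq
    by (rule exI[of _ "\<one>\<^bsub>R\<^esub>"], rule exI[of _ "\<zero>\<^bsub>M\<^esub>"]) (use x sub(2)[OF xs] in simp)
  moreover have "y \<in> lspan R M (x # xs)" if "y \<in> lspan R M xs" for y
    unfolding lspan.simps mem_Collect_eq
    by (rule exI[of _ "\<zero>\<^bsub>R\<^esub>"], rule exI[of _ y]) (use x that sub(1)[OF xs] in auto)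
  ultimately show ?case using Cons by auto
qed simp

lemma lspan_minimal: "submodule N R M \<Longrightarrow> set xs \<subseteq> N \<Longrightarrow> lspan R M xs \<subseteq> N"
proof (induction xs)
  case (Cons x xs)
  then show ?case using submodD(3,4)[OF Cons.prems(1)] by auto
qed (simp add: submodD(2))

lemma lspan_mono:
  assumes "set xs \<subseteq> set ys" "set ys \<subseteq> carrier M"
  shows "lspan R M xs \<subseteq> lspan R M ys"
  using lspan_minimal[OF lspan_submod[OF assms(2)]] lspan_superset[OF assms(2)] assms(1) by blast

lemma lspan_finsum:
  assumes "set xs \<subseteq> carrier M" "y \<in> lspan R M xs"
  shows "\<exists>c\<in>set xs \<rightarrow> carrier R. y = (\<Oplus>\<^bsub>M\<^esub>a\<in>set xs. c a \<odot>\<^bsub>M\<^esub> a)"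
  using assms
proof (induction xs arbitrary: y)
  case (Cons x xs)
  then obtain a z where a: "a \<in> carrier R" "z \<in> lspan R M xs" "y = a \<odot>\<^bsub>M\<^esub> x \<oplus>\<^bsub>M\<^esub> z" by auto
  with Cons obtain c where c: "c \<in> set xs \<rightarrow> carrier R" "z = (\<Oplus>\<^bsub>M\<^esub>a\<in>set xs. c a \<odot>\<^bsub>M\<^esub> a)" by auto
  have x: "x \<in> carrier M" "set xs \<subseteq> carrier M" using Cons by auto
  \<comment> \<open>\<open>x\<close> may occur again in \<open>xs\<close>, while the sum over
    \<open>set (x # xs)\<close> counts it once. Its two coefficients \<open>a\<close> and
    \<open>d\<close> are therefore merged, and \<open>A\<close> collects the other
    generators.\<close>
  define A where "A = set xs - {x}"
  have A: "finite A" "x \<notin> A" "(\<lambda>a. c a \<odot>\<^bsub>M\<^esub> a) \<in> A \<rightarrow> carrier M" "c \<in> A \<rightarrow> carrier R"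
    using c x by (auto simp: A_def)
  define z' where "z' = (\<Oplus>\<^bsub>M\<^esub>a\<in>A. c a \<odot>\<^bsub>M\<^esub> a)"
  have z': "z' \<in> carrier M" using A by (simp add: z'_def)
  obtain d where d: "d \<in> carrier R" "z = d \<odot>\<^bsub>M\<^esub> x \<oplus>\<^bsub>M\<^esub> z'"
  proof (cases "x \<in> set xs")
    case True
    then have "set xs = insert x A" by (auto simp: A_def)
    then show ?thesis using that[of "c x"] c A x by (auto simp: z'_def)
  next
    case False
    then have "A = set xs" by (auto simp: A_def)
    then show ?thesis using that[of "\<zero>\<^bsub>R\<^esub>"] c x z' by (auto simp: z'_def)
  qed
  let ?c = "c(x := a \<oplus>\<^bsub>R\<^esub> d)"
  have "(\<Oplus>\<^bsub>M\<^esub>b\<in>A. ?c b \<odot>\<^bsub>M\<^esub> b) = z'"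
    unfolding z'_def by (rule M.finsum_cong') (use A in auto)
  moreover have "set (x # xs) = insert x A" by (auto simp: A_def)
  moreover have "(\<lambda>b. ?c b \<odot>\<^bsub>M\<^esub> b) \<in> A \<rightarrow> carrier M" using A by auto
  ultimately have "(\<Oplus>\<^bsub>M\<^esub>b\<in>set (x # xs). ?c b \<odot>\<^bsub>M\<^esub> b) = (a \<oplus>\<^bsub>R\<^esub> d) \<odot>\<^bsub>M\<^esub> x \<oplus>\<^bsub>M\<^esub> z'"
    using A x a d by simp
  also have "\<dots> = y" using a d x z' by (simp add: smult_l_distr M.a_assoc)
  finally show ?case using c a d by (intro bexI[of _ ?c]) auto
qed simp

lemma fin_gen_iff: "fin_gen R M \<longleftrightarrow> (\<exists>xs. set xs \<subseteq> carrier M \<and> carrier M \<subseteq> lspan R M xs)"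
proof
  assume "fin_gen R M"
  then obtain A where A: "finite A" "A \<subseteq> carrier M"
    "\<And>x. x \<in> carrier M \<Longrightarrow> \<exists>c\<in>A \<rightarrow> carrier R. x = (\<Oplus>\<^bsub>M\<^esub>a\<in>A. c a \<odot>\<^bsub>M\<^esub> a)"
    unfolding fin_gen_def by blast
  from A(1) obtain xs where xs: "set xs = A" using finite_list by blast
  have sub: "submodule (lspan R M xs) R M" using xs A lspan_submod by simp
  have "x \<in> lspan R M xs" if x: "x \<in> carrier M" for x
  proof -
    obtain c where "c \<in> A \<rightarrow> carrier R" "x = (\<Oplus>\<^bsub>M\<^esub>a\<in>A. c a \<odot>\<^bsub>M\<^esub> a)" using A(3)[OF x] by blast
    then show ?thesis
      using submodD(4)[OF sub] lspan_superset[of xs] xs A by (auto intro!: submod_finsum[OF sub])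
  qed
  then show "\<exists>xs. set xs \<subseteq> carrier M \<and> carrier M \<subseteq> lspan R M xs" using xs A by auto
next
  assume "\<exists>xs. set xs \<subseteq> carrier M \<and> carrier M \<subseteq> lspan R M xs"
  then show "fin_gen R M" unfolding fin_gen_def using lspan_finsum by (meson List.finite_set subsetD)
qed

lemma submod_fin_gen_iff:
  assumes "submodule N R M"
  shows "fin_gen R (M\<lparr>carrier := N\<rparr>) \<longleftrightarrow> (\<exists>xs. set xs \<subseteq> N \<and> N \<subseteq> lspan R M xs)"
proof -
  have "lspan R (M\<lparr>carrier := N\<rparr>) = lspan R M" by (rule ext, rule lspan_cong) simp_all
  then show ?thesis
    using left_module.fin_gen_iff[OF submod_left_module[OF assms]] by simp
qed

end

lemma linear_map_lspan:
  assumes M: "left_module R M" and N: "left_module R N" and p: "linear_map R M N p"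
    and "set xs \<subseteq> carrier M"
  shows "lspan R N (map p xs) = p ` lspan R M xs"
  using assms(4)
proof (induction xs)
  case Nil
  then show ?case by (simp add: linear_map_zero[OF M N p])
next
  case (Cons x xs)
  interpret M: left_module R M by (rule M)
  have x: "x \<in> carrier M" and xs: "set xs \<subseteq> carrier M" using Cons.prems by auto
  have L: "lspan R M xs \<subseteq> carrier M" by (rule M.submodD(1)[OF M.lspan_submod[OF xs]])
  have "lspan R N (map p (x # xs)) =
      (\<lambda>(a, y). a \<odot>\<^bsub>N\<^esub> p x \<oplus>\<^bsub>N\<^esub> p y) ` (carrier R \<times> lspan R M xs)"
    using Cons.IH[OF xs] by force
  also have "\<dots> = (\<lambda>(a, y). p (a \<odot>\<^bsub>M\<^esub> x \<oplus>\<^bsub>M\<^esub> y)) ` (carrier R \<times> lspan R M xs)"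
  proof (rule image_cong[OF refl], clarify)
    fix a y assume "a \<in> carrier R" "y \<in> lspan R M xs"
    then show "a \<odot>\<^bsub>N\<^esub> p x \<oplus>\<^bsub>N\<^esub> p y = p (a \<odot>\<^bsub>M\<^esub> x \<oplus>\<^bsub>M\<^esub> y)"
      using x L linear_mapD(2)[OF p, of "a \<odot>\<^bsub>M\<^esub> x" y] linear_mapD(3)[OF p] by auto
  qed
  also have "\<dots> = p ` (\<lambda>(a, y). a \<odot>\<^bsub>M\<^esub> x \<oplus>\<^bsub>M\<^esub> y) ` (carrier R \<times> lspan R M xs)"
    by (simp add: image_image case_prod_unfold)
  also have "(\<lambda>(a, y). a \<odot>\<^bsub>M\<^esub> x \<oplus>\<^bsub>M\<^esub> y) ` (carrier R \<times> lspan R M xs) = lspan R M (x # xs)"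
    by auto
  finally show ?case .
qed

context left_module begin

text \<open>Generation of the quotient is expressed by congruences in \<open>M\<close>; one
  representative is chosen for each coset in a generating list.\<close>

lemma quot_fin_gen_iff:
  assumes N: "submodule N R M"
  shows "fin_gen R (quot_module M N) \<longleftrightarrow>
    (\<exists>xs. set xs \<subseteq> carrier M \<and> (\<forall>x\<in>carrier M. \<exists>y\<in>lspan R M xs. x \<ominus>\<^bsub>M\<^esub> y \<in> N))"
proof -
  let ?Q = "quot_module M N" and ?p = "\<lambda>x. N +>\<^bsub>M\<^esub> x"
  interpret Q: left_module R ?Q by (rule quot_module_left_module[OF N])
  have "linear_map R M ?Q ?p"
    by (auto simp: linear_map_def quot_module_carrier[OF N] quot_module_add[OF N] quot_module_smult[OF N])
  note span = linear_map_lspan[OF left_module_axioms Q.left_module_axioms this]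
  have key: "carrier ?Q \<subseteq> lspan R ?Q (map ?p xs) \<longleftrightarrow>
      (\<forall>x\<in>carrier M. \<exists>y\<in>lspan R M xs. x \<ominus>\<^bsub>M\<^esub> y \<in> N)" if xs: "set xs \<subseteq> carrier M" for xs
  proof -
    have L: "lspan R M xs \<subseteq> carrier M" using submodD(1)[OF lspan_submod[OF xs]] .
    have "?p x \<in> ?p ` lspan R M xs \<longleftrightarrow> (\<exists>y\<in>lspan R M xs. x \<ominus>\<^bsub>M\<^esub> y \<in> N)" if "x \<in> carrier M" for x
      unfolding image_iff by (intro bex_cong refl coset_eq_iff[OF N that]) (use L in blast)
    then show ?thesis unfolding span[OF xs] quot_module_carrier[OF N] by blast
  qed
  show ?thesis
  proof
    assume "fin_gen R ?Q"
    then obtain Xs where Xs: "set Xs \<subseteq> carrier ?Q" "carrier ?Q \<subseteq> lspan R ?Q Xs"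
      using Q.fin_gen_iff by blast
    then have "Xs \<in> lists (?p ` carrier M)" unfolding quot_module_carrier[OF N] by auto
    then have "Xs \<in> map ?p ` lists (carrier M)" by (simp add: lists_image)
    then obtain xs where "set xs \<subseteq> carrier M" "Xs = map ?p xs" by auto
    then show "\<exists>xs. set xs \<subseteq> carrier M \<and> (\<forall>x\<in>carrier M. \<exists>y\<in>lspan R M xs. x \<ominus>\<^bsub>M\<^esub> y \<in> N)"
      using Xs key by blast
  next
    assume "\<exists>xs. set xs \<subseteq> carrier M \<and> (\<forall>x\<in>carrier M. \<exists>y\<in>lspan R M xs. x \<ominus>\<^bsub>M\<^esub> y \<in> N)"
    then obtain xs where xs: "set xs \<subseteq> carrier M" "\<forall>x\<in>carrier M. \<exists>y\<in>lspan R M xs. x \<ominus>\<^bsub>M\<^esub> y \<in> N"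
      by blast
    have "carrier ?Q \<subseteq> lspan R ?Q (map ?p xs)" using key[OF xs(1)] xs(2) by blast
    moreover have "set (map ?p xs) \<subseteq> carrier ?Q"
      using xs(1) unfolding quot_module_carrier[OF N] by auto
    ultimately show "fin_gen R ?Q" using Q.fin_gen_iff by blast
  qed
qed

end

section \<open>Finite dimension and finite codimension\<close>

locale vector_space_over = K?: field K + left_module K V
  for K :: "('k, 'c) ring_scheme" (structure) and V :: "('k, 'v, 'd) module_scheme" (structure)
begin

text \<open>A pivot argument in the style of Steinitz: when \<open>W\<close> leaves
  \<open>lspan K V xs\<close>, a vector \<open>w\<close> of \<open>W\<close> involving
  \<open>x\<close> with nonzero coefficient takes the place of \<open>x\<close>, and the rest of
  \<open>W\<close> is handled inside the smaller span. The strict inequality is what makes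
  \<open>rank\<close> strictly monotone.\<close>

lemma subspace_lspan:
  assumes "set xs \<subseteq> carrier V" "submodule W K V" "W \<subseteq> lspan K V xs"
  shows "\<exists>ys. set ys \<subseteq> W \<and> W \<subseteq> lspan K V ys \<and> length ys \<le> length xs \<and>
    (W \<noteq> lspan K V xs \<longrightarrow> length ys < length xs)"
  using assms
proof (induction xs arbitrary: W)
  case Nil
  then show ?case using submodD(2)[OF Nil(2)] by (intro exI[of _ "[]"]) auto
next
  case (Cons x xs)
  note W = submodD[OF Cons.prems(2)]
  have x: "x \<in> carrier V" and xs: "set xs \<subseteq> carrier V" using Cons.prems by auto
  note L = submodD[OF lspan_submod[OF xs]]
  show ?case
  proof (cases "W \<subseteq> lspan K V xs")
    case True
    then obtain ys where "set ys \<subseteq> W \<and> W \<subseteq> lspan K V ys \<and> length ys \<le> length xs"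
      using Cons.IH[OF xs Cons.prems(2)] by blast
    then show ?thesis by (intro exI[of _ ys]) auto
  next
    case False
    then obtain w where w: "w \<in> W" "w \<notin> lspan K V xs" by blast
    then obtain c v where cv: "c \<in> carrier K" "v \<in> lspan K V xs" "w = c \<odot>\<^bsub>V\<^esub> x \<oplus>\<^bsub>V\<^esub> v"
      using Cons.prems(3) by auto
    have vV: "v \<in> carrier V" and wV: "w \<in> carrier V" using cv w L W by auto
    have "c \<noteq> \<zero>\<^bsub>K\<^esub>" using cv w x vV by auto
    then have cU: "c \<in> Units K" using cv K.field_Units by blast
    let ?d = "inv\<^bsub>K\<^esub> c"
    have d: "?d \<in> carrier K" "?d \<otimes>\<^bsub>K\<^esub> c = \<one>\<^bsub>K\<^esub>" using cU by auto
    have dw: "x = ?d \<odot>\<^bsub>V\<^esub> w \<ominus>\<^bsub>V\<^esub> ?d \<odot>\<^bsub>V\<^esub> v"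
    proof -
      have "?d \<odot>\<^bsub>V\<^esub> w = x \<oplus>\<^bsub>V\<^esub> ?d \<odot>\<^bsub>V\<^esub> v"
        using cv d x vV by (simp add: smult_r_distr smult_assoc1[symmetric])
      then show ?thesis using x d vV by (simp add: M.minus_eq M.a_assoc M.r_neg)
    qed
    \<comment> \<open>After a suitable multiple of the pivot is subtracted, every vector of
      \<open>W\<close> lies in this intersection.\<close>
    let ?W = "W \<inter> lspan K V xs"
    have W': "submodule ?W K V" using Cons.prems(2) lspan_submod[OF xs] by (rule submod_Int)
    then obtain ys where ys: "set ys \<subseteq> ?W" "?W \<subseteq> lspan K V ys" "length ys \<le> length xs"
      "?W \<noteq> lspan K V xs \<longrightarrow> length ys < length xs"
      using Cons.IH[OF xs W'] by blast
    have "W \<subseteq> lspan K V (w # ys)"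
    proof
      fix u assume u: "u \<in> W"
      then obtain a z where az: "a \<in> carrier K" "z \<in> lspan K V xs" "u = a \<odot>\<^bsub>V\<^esub> x \<oplus>\<^bsub>V\<^esub> z"
        using Cons.prems(3) by auto
      have zV: "z \<in> carrier V" and uV: "u \<in> carrier V" using az L u W by auto
      let ?e = "a \<otimes>\<^bsub>K\<^esub> ?d"
      have e: "?e \<in> carrier K" using az d by simp
      have "a \<odot>\<^bsub>V\<^esub> x = ?e \<odot>\<^bsub>V\<^esub> w \<ominus>\<^bsub>V\<^esub> ?e \<odot>\<^bsub>V\<^esub> v"
        by (subst dw) (use az d wV vV in \<open>simp add: smult_r_diff smult_assoc1\<close>)
      then have "u = (?e \<odot>\<^bsub>V\<^esub> w \<ominus>\<^bsub>V\<^esub> ?e \<odot>\<^bsub>V\<^esub> v) \<oplus>\<^bsub>V\<^esub> z" using az(3) by simp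
      then have u': "u = ?e \<odot>\<^bsub>V\<^esub> w \<oplus>\<^bsub>V\<^esub> (z \<ominus>\<^bsub>V\<^esub> ?e \<odot>\<^bsub>V\<^esub> v)"
        using smult_closed[OF e wV] smult_closed[OF e vV] zV
        by (simp only: M.minus_eq) (simp add: M.add.m_ac)
      have "z \<ominus>\<^bsub>V\<^esub> ?e \<odot>\<^bsub>V\<^esub> v \<in> lspan K V xs"
        using L(6)[OF az(2) L(4)[OF e cv(2)]] .
      moreover have "z \<ominus>\<^bsub>V\<^esub> ?e \<odot>\<^bsub>V\<^esub> v \<in> W"
      proof (rule submod_add_cancel[OF Cons.prems(2), of "?e \<odot>\<^bsub>V\<^esub> w"])
        show "?e \<odot>\<^bsub>V\<^esub> w \<in> W" using W(4)[OF e w(1)] .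
        show "z \<ominus>\<^bsub>V\<^esub> ?e \<odot>\<^bsub>V\<^esub> v \<in> carrier V" using zV vV e by simp
      qed (use u u' in simp)
      ultimately have in_ys: "z \<ominus>\<^bsub>V\<^esub> ?e \<odot>\<^bsub>V\<^esub> v \<in> lspan K V ys" using ys(2) by blast
      show "u \<in> lspan K V (w # ys)"
        unfolding lspan.simps mem_Collect_eq
        by (rule exI[of _ ?e], rule exI[of _ "z \<ominus>\<^bsub>V\<^esub> ?e \<odot>\<^bsub>V\<^esub> v"]) (use u' e in_ys in blast)
    qed
    moreover have "length ys < length xs" if ne: "W \<noteq> lspan K V (x # xs)"
    proof -
      \<comment> \<open>If the intersection filled \<open>lspan K V xs\<close>, then
        \<open>v\<close> would lie in \<open>W\<close>, hence so would \<open>x\<close>, and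
        \<open>W\<close> would be the full span.\<close>
      have "?W \<noteq> lspan K V xs"
      proof
        assume *: "?W = lspan K V xs"
        then have "v \<in> W" using cv by auto
        have "?d \<odot>\<^bsub>V\<^esub> w \<ominus>\<^bsub>V\<^esub> ?d \<odot>\<^bsub>V\<^esub> v \<in> W" using W(6)[OF W(4)[OF d(1) w(1)] W(4)[OF d(1) \<open>v \<in> W\<close>]] .
        then have "x \<in> W" using dw by (rule ssubst[rotated])
        moreover have "set xs \<subseteq> W" using * lspan_superset[OF xs] by auto
        ultimately have "set (x # xs) \<subseteq> W" by simp
        then have "lspan K V (x # xs) \<subseteq> W" by (rule lspan_minimal[OF Cons.prems(2)])
        then show False using ne Cons.prems(3) by auto
      qed
      then show ?thesis using ys by auto
    qed
    ultimately show ?thesis using ys w by (intro exI[of _ "w # ys"]) auto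
  qed
qed

definition findim :: "'v set \<Rightarrow> bool"
  where "findim W \<longleftrightarrow> submodule W K V \<and> (\<exists>xs. set xs \<subseteq> W \<and> W \<subseteq> lspan K V xs)"

text \<open>For finite-dimensional \<open>W\<close> this is the dimension, taken as the least number
  of generators; bases never enter.\<close>

definition rank :: "'v set \<Rightarrow> nat"
  where "rank W = (LEAST n. \<exists>xs. length xs = n \<and> set xs \<subseteq> W \<and> W \<subseteq> lspan K V xs)"

text \<open>The span of a shortest generating list of \<open>W\<close> properly contains
  \<open>W'\<close>, so \<open>subspace_lspan\<close> gives a strictly shorter list for
  \<open>W'\<close>.\<close>

lemma rank_mono:
  assumes W: "findim W" and W': "submodule W' K V" "W' \<subset> W"
  shows "findim W'" "rank W' < rank W"
proof -
  have "\<exists>n xs. length xs = n \<and> set xs \<subseteq> W \<and> W \<subseteq> lspan K V xs" using W by (auto simp: findim_def)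
  from LeastI_ex[OF this] obtain xs where xs: "length xs = rank W" "set xs \<subseteq> W" "W \<subseteq> lspan K V xs"
    unfolding rank_def by blast
  have WV: "W \<subseteq> carrier V" using W submodD(1) by (auto simp: findim_def)
  then obtain ys where ys: "set ys \<subseteq> W'" "W' \<subseteq> lspan K V ys"
    "W' \<noteq> lspan K V xs \<longrightarrow> length ys < length xs"
    using subspace_lspan[of xs W'] xs W' by (metis dual_order.strict_implies_order order_trans)
  then show "findim W'" using W' by (auto simp: findim_def)
  have "length ys < length xs" using ys W' xs by auto
  moreover have "rank W' \<le> length ys" unfolding rank_def using ys by (intro Least_le) auto
  ultimately show "rank W' < rank W" using xs by simp
qed

lemma findim_subspace: "findim W \<Longrightarrow> submodule W' K V \<Longrightarrow> W' \<subseteq> W \<Longrightarrow> findim W'"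
  using rank_mono(1) by blast

lemma findim_sum:
  assumes "findim W" "findim W'"
  shows "findim {x \<oplus>\<^bsub>V\<^esub> y | x y. x \<in> W \<and> y \<in> W'}"
proof -
  let ?S = "{x \<oplus>\<^bsub>V\<^esub> y | x y. x \<in> W \<and> y \<in> W'}"
  obtain xs ys where W: "submodule W K V" "set xs \<subseteq> W" "W \<subseteq> lspan K V xs"
    and W': "submodule W' K V" "set ys \<subseteq> W'" "W' \<subseteq> lspan K V ys"
    using assms by (auto simp: findim_def)
  have c: "W \<subseteq> carrier V" "W' \<subseteq> carrier V" using submodD(1) W(1) W'(1) by auto
  then have xy: "set (xs @ ys) \<subseteq> carrier V" using W W' by auto
  have S: "submodule ?S K V" by (rule submod_sum[OF W(1) W'(1)])
  have "W \<subseteq> ?S"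
  proof
    fix x assume "x \<in> W"
    then show "x \<in> ?S" unfolding mem_Collect_eq
      by (intro exI[of _ x] exI[of _ "\<zero>\<^bsub>V\<^esub>"]) (use c submodD(2)[OF W'(1)] in auto)
  qed
  moreover have "W' \<subseteq> ?S"
  proof
    fix x assume "x \<in> W'"
    then show "x \<in> ?S" unfolding mem_Collect_eq
      by (intro exI[of _ "\<zero>\<^bsub>V\<^esub>"] exI[of _ x]) (use c submodD(2)[OF W(1)] in auto)
  qed
  ultimately have "set (xs @ ys) \<subseteq> ?S" using W W' by auto
  moreover have "W \<subseteq> lspan K V (xs @ ys)" "W' \<subseteq> lspan K V (xs @ ys)"
    using W(3) W'(3) lspan_mono[OF _ xy, of xs] lspan_mono[OF _ xy, of ys] by auto
  then have "?S \<subseteq> lspan K V (xs @ ys)" using submodD(3)[OF lspan_submod[OF xy]] by blast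
  ultimately show ?thesis using S unfolding findim_def by blast
qed

text \<open>For a subspace \<open>L\<close> this is finite dimension of the image of
  \<open>N\<close> in \<open>V/L\<close>, phrased without quotients. The spanning list may lie
  outside \<open>N\<close>.\<close>

definition fin_codim :: "'v set \<Rightarrow> 'v set \<Rightarrow> bool"
  where "fin_codim L N \<longleftrightarrow>
    (\<exists>xs. set xs \<subseteq> carrier V \<and> (\<forall>x\<in>N. \<exists>y\<in>lspan K V xs. x \<ominus>\<^bsub>V\<^esub> y \<in> L))"

lemma fin_codim_trans:
  assumes N: "N \<subseteq> carrier V" and L: "L' \<subseteq> carrier V" and "fin_codim L N" "fin_codim L' L"
  shows "fin_codim L' N"
proof -
  obtain xs where xs: "set xs \<subseteq> carrier V" "\<forall>x\<in>N. \<exists>y\<in>lspan K V xs. x \<ominus>\<^bsub>V\<^esub> y \<in> L"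
    using assms by (auto simp: fin_codim_def)
  obtain ys where ys: "set ys \<subseteq> carrier V" "\<forall>x\<in>L. \<exists>y\<in>lspan K V ys. x \<ominus>\<^bsub>V\<^esub> y \<in> L'"
    using assms by (auto simp: fin_codim_def)
  have xy: "set (xs @ ys) \<subseteq> carrier V" using xs ys by auto
  have "\<exists>y\<in>lspan K V (xs @ ys). x \<ominus>\<^bsub>V\<^esub> y \<in> L'" if x: "x \<in> N" for x
  proof -
    obtain y where y: "y \<in> lspan K V xs" "x \<ominus>\<^bsub>V\<^esub> y \<in> L" using xs x by blast
    then obtain z where z: "z \<in> lspan K V ys" "x \<ominus>\<^bsub>V\<^esub> y \<ominus>\<^bsub>V\<^esub> z \<in> L'" using ys by blast
    have "y \<in> lspan K V (xs @ ys)" "z \<in> lspan K V (xs @ ys)"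
      using y z lspan_mono[OF _ xy, of xs] lspan_mono[OF _ xy, of ys] by auto
    then have yz: "y \<oplus>\<^bsub>V\<^esub> z \<in> lspan K V (xs @ ys)" using submodD(3)[OF lspan_submod[OF xy]] by blast
    have "x \<in> carrier V" "y \<in> carrier V" "z \<in> carrier V"
      using x N y z submodD(1)[OF lspan_submod[OF xs(1)]] submodD(1)[OF lspan_submod[OF ys(1)]] by auto
    then have "x \<ominus>\<^bsub>V\<^esub> y \<ominus>\<^bsub>V\<^esub> z = x \<ominus>\<^bsub>V\<^esub> (y \<oplus>\<^bsub>V\<^esub> z)"
      by (simp add: M.minus_eq M.minus_add M.a_assoc)
    then show ?thesis using z yz by auto
  qed
  then show ?thesis using xy unfolding fin_codim_def by blast
qed

lemma fin_codim_mono: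
  assumes "fin_codim L N" "L \<subseteq> L'"
  shows "fin_codim L' N"
proof -
  obtain xs where xs: "set xs \<subseteq> carrier V" "\<And>x. x \<in> N \<Longrightarrow> \<exists>y\<in>lspan K V xs. x \<ominus>\<^bsub>V\<^esub> y \<in> L"
    using assms(1) unfolding fin_codim_def by meson
  have "\<exists>y\<in>lspan K V xs. x \<ominus>\<^bsub>V\<^esub> y \<in> L'" if "x \<in> N" for x
    using xs(2)[OF that] assms(2) by (meson subsetD)
  then show ?thesis using xs(1) unfolding fin_codim_def by meson
qed

end

section \<open>Extensions\<close>

lemma (in ring) free_mod_memD:
  assumes "f \<in> carrier (free_mod R X)"
  shows "f x \<in> carrier R" "finite {x. f x \<noteq> \<zero>}" "{x. f x \<noteq> \<zero>} \<subseteq> X"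
  using assms zero_closed by (auto simp: free_mod_def)

lemma (in ring) free_mod_memI:
  assumes "\<And>x. f x \<in> carrier R" "finite D" "{x. f x \<noteq> \<zero>} \<subseteq> D" "D \<subseteq> X"
  shows "f \<in> carrier (free_mod R X)"
  using assms finite_subset by (auto simp: free_mod_def)

lemma (in ring) free_left_module: "left_module R (free_mod R X)"
proof (intro left_module.intro left_module_axioms.intro)
  let ?F = "free_mod R X"
  have sim: "\<zero>\<^bsub>?F\<^esub> = (\<lambda>x. \<zero>)" "\<And>f g. f \<oplus>\<^bsub>?F\<^esub> g = (\<lambda>x. f x \<oplus> g x)"
    "\<And>r f. r \<odot>\<^bsub>?F\<^esub> f = (\<lambda>x. r \<otimes> f x)" by (simp_all add: free_mod_def)
  note D = free_mod_memD
  have add: "f \<oplus>\<^bsub>?F\<^esub> g \<in> carrier ?F" if f: "f \<in> carrier ?F" and g: "g \<in> carrier ?F" for f g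
    by (rule free_mod_memI[of _ "{x. f x \<noteq> \<zero>} \<union> {x. g x \<noteq> \<zero>}"]) (use D[OF f] D[OF g] in \<open>auto simp: sim\<close>)
  have smult: "r \<odot>\<^bsub>?F\<^esub> f \<in> carrier ?F" if f: "f \<in> carrier ?F" and r: "r \<in> carrier R" for f r
    by (rule free_mod_memI[of _ "{x. f x \<noteq> \<zero>}"]) (use D[OF f] r in \<open>auto simp: sim\<close>)
  have zero: "\<zero>\<^bsub>?F\<^esub> \<in> carrier ?F" by (rule free_mod_memI[of _ "{}"]) (auto simp: sim)
  show "abelian_group ?F"
  proof (rule abelian_groupI)
    fix f assume f: "f \<in> carrier ?F"
    have "(\<lambda>x. \<ominus> f x) \<in> carrier ?F"
      by (rule free_mod_memI[of _ "{x. f x \<noteq> \<zero>}"]) (use D[OF f] in auto)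
    moreover have "(\<lambda>x. \<ominus> f x) \<oplus>\<^bsub>?F\<^esub> f = \<zero>\<^bsub>?F\<^esub>" using D(1)[OF f] by (simp add: sim l_neg)
    ultimately show "\<exists>g\<in>carrier ?F. g \<oplus>\<^bsub>?F\<^esub> f = \<zero>\<^bsub>?F\<^esub>" by blast
  next
    fix f g assume f: "f \<in> carrier ?F" and g: "g \<in> carrier ?F"
    show "f \<oplus>\<^bsub>?F\<^esub> g = g \<oplus>\<^bsub>?F\<^esub> f" using D(1)[OF f] D(1)[OF g] by (simp add: sim a_comm)
    fix h assume h: "h \<in> carrier ?F"
    show "f \<oplus>\<^bsub>?F\<^esub> g \<oplus>\<^bsub>?F\<^esub> h = f \<oplus>\<^bsub>?F\<^esub> (g \<oplus>\<^bsub>?F\<^esub> h)"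
      using D(1)[OF f] D(1)[OF g] D(1)[OF h] by (simp add: sim a_assoc)
  next
    fix f assume f: "f \<in> carrier ?F"
    show "\<zero>\<^bsub>?F\<^esub> \<oplus>\<^bsub>?F\<^esub> f = f" using D(1)[OF f] by (simp add: sim)
  qed (use add zero in auto)
  show "ring R" by (rule ring_axioms)
  show "\<And>r x. \<lbrakk>r \<in> carrier R; x \<in> carrier ?F\<rbrakk> \<Longrightarrow> r \<odot>\<^bsub>?F\<^esub> x \<in> carrier ?F" using smult .
  show "\<And>x. x \<in> carrier ?F \<Longrightarrow> \<one> \<odot>\<^bsub>?F\<^esub> x = x" 
    using D(1)[where X = X] by (auto simp: sim fun_eq_iff)
  fix r s f assume rs: "r \<in> carrier R" "s \<in> carrier R" and f: "f \<in> carrier ?F"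
  show "(r \<oplus> s) \<odot>\<^bsub>?F\<^esub> f = r \<odot>\<^bsub>?F\<^esub> f \<oplus>\<^bsub>?F\<^esub> s \<odot>\<^bsub>?F\<^esub> f"
    using rs D(1)[OF f] by (simp add: sim l_distr)
  show "(r \<otimes> s) \<odot>\<^bsub>?F\<^esub> f = r \<odot>\<^bsub>?F\<^esub> (s \<odot>\<^bsub>?F\<^esub> f)"
    using rs D(1)[OF f] by (simp add: sim m_assoc)
next
  fix r f g assume "r \<in> carrier R" and f: "f \<in> carrier (free_mod R X)" and g: "g \<in> carrier (free_mod R X)"
  then show "r \<odot>\<^bsub>free_mod R X\<^esub> (f \<oplus>\<^bsub>free_mod R X\<^esub> g) =
      r \<odot>\<^bsub>free_mod R X\<^esub> f \<oplus>\<^bsub>free_mod R X\<^esub> r \<odot>\<^bsub>free_mod R X\<^esub> g"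
    using free_mod_memD(1)[OF f] free_mod_memD(1)[OF g] by (simp add: free_mod_def r_distr)
qed

text \<open>The homomorphism from the free module that sends the basis vector at \<open>x\<close> to
  \<open>h x\<close>. Besides \<open>free_eval\<close>, where \<open>h\<close> is the identity, it
  covers the linear extension of a set-theoretic section.\<close>

definition lincomb :: "('r, 'c) ring_scheme \<Rightarrow> ('r, 'm, 'd) module_scheme \<Rightarrow> ('x \<Rightarrow> 'm) \<Rightarrow>
    ('x \<Rightarrow> 'r) \<Rightarrow> 'm"
  where "lincomb R M h f = (\<Oplus>\<^bsub>M\<^esub>x\<in>{x. f x \<noteq> \<zero>\<^bsub>R\<^esub>}. f x \<odot>\<^bsub>M\<^esub> h x)"

lemma free_eval_eq_lincomb: "free_eval R M = lincomb R M (\<lambda>x. x)"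
  by (simp add: fun_eq_iff free_eval_def lincomb_def)

text \<open>The basis vector of \<open>free_mod\<close> at \<open>a\<close>.\<close>

definition delta :: "('r, 'c) ring_scheme \<Rightarrow> 'x \<Rightarrow> 'x \<Rightarrow> 'r"
  where "delta R a = (\<lambda>x. if x = a then \<one>\<^bsub>R\<^esub> else \<zero>\<^bsub>R\<^esub>)"

lemma (in ring) delta_closed: "a \<in> X \<Longrightarrow> delta R a \<in> carrier (free_mod R X)"
  by (rule free_mod_memI[of _ "{a}"]) (auto simp: delta_def)

context left_module begin

text \<open>Enlarging the index set beyond the support adds only zero terms. This gives two elements
  a common finite index set, as additivity requires.\<close>

lemma lincomb_eq_finsum:
  assumes f: "f \<in> carrier (free_mod R X)" and h: "h \<in> X \<rightarrow> carrier M"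
    and D: "finite D" "{x. f x \<noteq> \<zero>\<^bsub>R\<^esub>} \<subseteq> D" "D \<subseteq> X"
  shows "lincomb R M h f = (\<Oplus>\<^bsub>M\<^esub>x\<in>D. f x \<odot>\<^bsub>M\<^esub> h x)"
  unfolding lincomb_def
proof (rule M.add.finprod_mono_neutral_cong_left)
  have hD: "h i \<in> carrier M" if "i \<in> D" for i using D h that by auto
  show "(\<lambda>x. f x \<odot>\<^bsub>M\<^esub> h x) \<in> D \<rightarrow> carrier M" using hD R.free_mod_memD(1)[OF f] by auto
  show "f i \<odot>\<^bsub>M\<^esub> h i = \<zero>\<^bsub>M\<^esub>" if "i \<in> D - {x. f x \<noteq> \<zero>\<^bsub>R\<^esub>}" for i
    using hD[of i] that by auto
qed (use D in auto)

lemma lincomb_delta: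
  assumes "a \<in> X" "h \<in> X \<rightarrow> carrier M"
  shows "lincomb R M h (delta R a) = h a"
proof -
  have "lincomb R M h (delta R a) = (\<Oplus>\<^bsub>M\<^esub>x\<in>{a}. delta R a x \<odot>\<^bsub>M\<^esub> h x)"
    by (rule lincomb_eq_finsum[OF R.delta_closed]) (use assms in \<open>auto simp: delta_def\<close>)
  also have "\<dots> = delta R a a \<odot>\<^bsub>M\<^esub> h a"
    using Pi_mem[OF assms(2,1)] by (subst M.finsum_insert) (auto simp: delta_def)
  also have "\<dots> = h a" using Pi_mem[OF assms(2,1)] by (simp add: delta_def)
  finally show ?thesis .
qed

lemma free_mod_smult_funcset:
  assumes N: "submodule N R M" and f: "f \<in> carrier (free_mod R X)" and h: "h \<in> X \<rightarrow> N"
  shows "(\<lambda>x. f x \<odot>\<^bsub>M\<^esub> h x) \<in> {x. f x \<noteq> \<zero>\<^bsub>R\<^esub>} \<rightarrow> N"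
proof (rule funcsetI)
  fix x assume "x \<in> {x. f x \<noteq> \<zero>\<^bsub>R\<^esub>}"
  then have "h x \<in> N" using R.free_mod_memD(3)[OF f] h by blast
  then show "f x \<odot>\<^bsub>M\<^esub> h x \<in> N" using submodD(4)[OF N] R.free_mod_memD(1)[OF f] by blast
qed

lemma lincomb_submod:
  assumes N: "submodule N R M" and f: "f \<in> carrier (free_mod R X)" and h: "h \<in> X \<rightarrow> N"
  shows "lincomb R M h f \<in> N"
  unfolding lincomb_def by (rule submod_finsum[OF N free_mod_smult_funcset[OF assms]])

lemma lincomb_linear:
  assumes h: "h \<in> X \<rightarrow> carrier M"
  shows "linear_map R (free_mod R X) M (lincomb R M h)"
  unfolding linear_map_def
proof (intro conjI ballI funcsetI)
  let ?F = "free_mod R X"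
  interpret F: left_module R ?F by (rule R.free_left_module)
  fix f assume f: "f \<in> carrier ?F"
  then show "lincomb R M h f \<in> carrier M" using lincomb_submod[OF carrier_submod] h by blast
  fix g assume g: "g \<in> carrier ?F"
  let ?D = "{x. f x \<noteq> \<zero>\<^bsub>R\<^esub>} \<union> {x. g x \<noteq> \<zero>\<^bsub>R\<^esub>}"
  have D: "finite ?D" "?D \<subseteq> X" using R.free_mod_memD(2,3)[OF f] R.free_mod_memD(2,3)[OF g] by auto
  note cl = R.free_mod_memD(1)[OF f] R.free_mod_memD(1)[OF g]
  have hD: "\<And>x. x \<in> ?D \<Longrightarrow> h x \<in> carrier M" using D(2) h by auto
  have "lincomb R M h (f \<oplus>\<^bsub>?F\<^esub> g) = (\<Oplus>\<^bsub>M\<^esub>x\<in>?D. (f \<oplus>\<^bsub>?F\<^esub> g) x \<odot>\<^bsub>M\<^esub> h x)"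
    by (rule lincomb_eq_finsum[OF F.M.a_closed[OF f g] h D(1) _ D(2)]) (auto simp: free_mod_def)
  also have "\<dots> = (\<Oplus>\<^bsub>M\<^esub>x\<in>?D. f x \<odot>\<^bsub>M\<^esub> h x \<oplus>\<^bsub>M\<^esub> g x \<odot>\<^bsub>M\<^esub> h x)"
    by (rule M.finsum_cong') (use hD cl in \<open>auto simp: free_mod_def smult_l_distr\<close>)
  also have "\<dots> = (\<Oplus>\<^bsub>M\<^esub>x\<in>?D. f x \<odot>\<^bsub>M\<^esub> h x) \<oplus>\<^bsub>M\<^esub> (\<Oplus>\<^bsub>M\<^esub>x\<in>?D. g x \<odot>\<^bsub>M\<^esub> h x)"
    by (rule M.finsum_addf) (use hD cl in auto)
  also have "\<dots> = lincomb R M h f \<oplus>\<^bsub>M\<^esub> lincomb R M h g"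
    using lincomb_eq_finsum[OF f h D(1) _ D(2)] lincomb_eq_finsum[OF g h D(1) _ D(2)] by simp
  finally show "lincomb R M h (f \<oplus>\<^bsub>?F\<^esub> g) = lincomb R M h f \<oplus>\<^bsub>M\<^esub> lincomb R M h g" .
next
  let ?F = "free_mod R X"
  interpret F: left_module R ?F by (rule R.free_left_module)
  fix r f assume r: "r \<in> carrier R" and f: "f \<in> carrier ?F"
  let ?D = "{x. f x \<noteq> \<zero>\<^bsub>R\<^esub>}"
  have D: "finite ?D" "?D \<subseteq> X" using R.free_mod_memD(2,3)[OF f] by auto
  have hD: "\<And>x. x \<in> ?D \<Longrightarrow> h x \<in> carrier M" using D(2) h by auto
  have "lincomb R M h (r \<odot>\<^bsub>?F\<^esub> f) = (\<Oplus>\<^bsub>M\<^esub>x\<in>?D. (r \<odot>\<^bsub>?F\<^esub> f) x \<odot>\<^bsub>M\<^esub> h x)"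
    by (rule lincomb_eq_finsum[OF F.smult_closed[OF r f] h D(1) _ D(2)]) (use r in \<open>auto simp: free_mod_def\<close>)
  also have "\<dots> = (\<Oplus>\<^bsub>M\<^esub>x\<in>?D. r \<odot>\<^bsub>M\<^esub> (f x \<odot>\<^bsub>M\<^esub> h x))"
    by (rule M.finsum_cong') (use hD R.free_mod_memD(1)[OF f] r in \<open>auto simp: free_mod_def smult_assoc1\<close>)
  also have "\<dots> = r \<odot>\<^bsub>M\<^esub> lincomb R M h f"
    unfolding lincomb_def
    by (rule finsum_smult[symmetric, OF r]) (use hD R.free_mod_memD(1)[OF f] in auto)
  finally show "lincomb R M h (r \<odot>\<^bsub>?F\<^esub> f) = r \<odot>\<^bsub>M\<^esub> lincomb R M h f" .
qed

lemma linear_map_lincomb: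
  assumes N: "left_module R N" and p: "linear_map R M N p"
    and f: "f \<in> carrier (free_mod R X)" and h: "h \<in> X \<rightarrow> carrier M"
  shows "p (lincomb R M h f) = lincomb R N (\<lambda>x. p (h x)) f"
proof -
  interpret N: left_module R N by (rule N)
  have hD: "h x \<in> carrier M" if "f x \<noteq> \<zero>\<^bsub>R\<^esub>" for x using R.free_mod_memD(3)[OF f] h that by auto
  have "p (lincomb R M h f) = (\<Oplus>\<^bsub>N\<^esub>x\<in>{x. f x \<noteq> \<zero>\<^bsub>R\<^esub>}. p (f x \<odot>\<^bsub>M\<^esub> h x))"
    unfolding lincomb_def
    by (rule linear_map_finsum[OF left_module_axioms N p]) (use hD R.free_mod_memD(1)[OF f] in auto)
  also have "\<dots> = lincomb R N (\<lambda>x. p (h x)) f"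
    unfolding lincomb_def
    by (rule N.M.finsum_cong')
      (use hD R.free_mod_memD(1)[OF f] linear_mapD[OF p] in auto)
  finally show ?thesis .
qed

lemma kernel_submod:
  assumes N: "left_module R N" and p: "linear_map R M N p"
  shows "submodule {x \<in> carrier M. p x = \<zero>\<^bsub>N\<^esub>} R M"
proof -
  interpret N: left_module R N by (rule N)
  show ?thesis
    by (rule submodI) (auto simp: linear_map_zero[OF left_module_axioms N p] linear_mapD[OF p])
qed

end

section \<open>Extension and splitting when \<open>Ext1\<close> is trivial\<close>

text \<open>
  Every linear map \<open>c\<close> on the kernel of \<open>F\<^sub>0 \<rightarrow> A\<close> becomes a cocycle on \<open>F\<^sub>1\<close> by composition with
  \<open>F\<^sub>1 \<rightarrow> F\<^sub>0\<close>; writing that cocycle as a coboundary extends \<open>c\<close> to \<open>F\<^sub>0\<close>.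
\<close>

lemma trivial_Ext1_extend:
  fixes A :: "('r, 'a, 'd) module_scheme" and B :: "('r, 'b, 'e) module_scheme"
  assumes A: "left_module R A" and B: "left_module R B" and ext: "trivial_group (Ext1 R A B)"
    and c: "linear_map R ((free_mod R (carrier A))\<lparr>carrier := eval_kernel R A (carrier A)\<rparr>) B c"
  shows "\<exists>g. linear_map R (free_mod R (carrier A)) B g \<and> (\<forall>k\<in>eval_kernel R A (carrier A). g k = c k)"
proof -
  interpret A: left_module R A by (rule A)
  interpret B: left_module R B by (rule B)
  let ?F0 = "free_mod R (carrier A)" and ?K = "eval_kernel R A (carrier A)"
  let ?F1 = "free_mod R ?K" and ?d = "lincomb R ?F0 (\<lambda>x. x)"
  interpret F0: left_module R ?F0 by (rule A.R.free_left_module)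
  interpret F1: left_module R ?F1 by (rule A.R.free_left_module)
  have "linear_map R ?F0 A (free_eval R A)"
    unfolding free_eval_eq_lincomb by (rule A.lincomb_linear) auto
  then have K: "submodule ?K R ?F0"
    unfolding eval_kernel_def by (rule F0.kernel_submod[OF A])
  note cD = linear_mapD[OF c, simplified]
  have KF: "(\<lambda>x. x) \<in> ?K \<rightarrow> carrier ?F0" using F0.submodD(1)[OF K] by auto
  note d = linear_mapD[OF F0.lincomb_linear[OF KF]]
  have dK: "?d y \<in> ?K" if "y \<in> carrier ?F1" for y
    by (rule F0.lincomb_submod[OF K that]) auto
  define z where "z = (\<lambda>y\<in>carrier ?F1. c (?d y))"
  have z_hom: "z \<in> mod_hom R ?F1 B"
    unfolding mod_hom_def hom_def z_def by (auto simp: d cD dK)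
  have "z (res_d2 R A w) = \<zero>\<^bsub>B\<^esub>" if "w \<in> carrier (res2 R A)" for w
  proof -
    \<comment> \<open>\<open>res2\<close> is free on the kernel of \<open>?d\<close>, so the second
      differential takes values in that kernel, where \<open>z\<close> reduces to \<open>c\<close>
      at zero.\<close>
    let ?K1 = "{y \<in> carrier ?F1. ?d y = \<zero>\<^bsub>?F0\<^esub>}"
    have K1: "submodule ?K1 R ?F1"
      by (rule F1.kernel_submod[OF F0.left_module_axioms F0.lincomb_linear[OF KF]])
    have "w \<in> carrier (free_mod R ?K1)"
      using that by (simp add: res2_def res0_def eval_kernel_def[of R ?F0] free_eval_eq_lincomb)
    then have "res_d2 R A w \<in> ?K1"
      unfolding res_d2_def res1_def free_eval_eq_lincomb by (rule F1.lincomb_submod[OF K1]) auto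
    then have "z (res_d2 R A w) = c \<zero>\<^bsub>?F0\<^esub>" by (simp add: z_def)
    also have "c \<zero>\<^bsub>?F0\<^esub> = \<zero>\<^bsub>B\<^esub>"
      using linear_map_zero[OF F0.submod_left_module[OF K] B c] by simp
    finally show ?thesis .
  qed
  then have z_cocycle: "z \<in> ext1_cocycles R A B"
    using z_hom by (simp add: ext1_cocycles_def res1_def)
  define H where "H = ext1_coboundaries R A B"
  define G where "G = (hom_group R (res1 R A) B)\<lparr>carrier := ext1_cocycles R A B\<rparr>"
  \<comment> \<open>In a trivial quotient the coset of \<open>z\<close> equals \<open>H\<close>.
    That \<open>z\<close> belongs to its own coset is read off from the zero coboundary, which acts
    as the identity on \<open>z\<close>, without appeal to group laws of \<open>G\<close>.\<close>
  have "carrier (G Mod H) = {\<one>\<^bsub>G Mod H\<^esub>}"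
    using ext by (simp add: trivial_group_def Ext1_def G_def H_def)
  then have "rcosets\<^bsub>G\<^esub> H = {H}" by (simp add: FactGroup_def)
  moreover have "H #>\<^bsub>G\<^esub> z \<in> rcosets\<^bsub>G\<^esub> H"
    using z_cocycle by (auto simp: RCOSETS_def G_def)
  ultimately have Hz: "H #>\<^bsub>G\<^esub> z = H" by simp
  have "(\<lambda>x\<in>carrier ?F0. \<zero>\<^bsub>B\<^esub>) \<in> mod_hom R (res0 R A) B"
    by (auto simp: mod_hom_def hom_def res0_def)
  then have "(\<lambda>y\<in>carrier ?F1. (\<lambda>x\<in>carrier ?F0. \<zero>\<^bsub>B\<^esub>) (res_d1 R A y)) \<in> H"
    unfolding H_def ext1_coboundaries_def res1_def by (rule imageI)
  moreover have "(\<lambda>y\<in>carrier ?F1. (\<lambda>x\<in>carrier ?F0. \<zero>\<^bsub>B\<^esub>) (res_d1 R A y)) = (\<lambda>y\<in>carrier ?F1. \<zero>\<^bsub>B\<^esub>)"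
    by (rule restrict_ext) (use d(1) in \<open>simp add: res_d1_def res0_def free_eval_eq_lincomb\<close>)
  ultimately have "(\<lambda>y\<in>carrier ?F1. \<zero>\<^bsub>B\<^esub>) \<in> H" by simp
  then have "(\<lambda>y\<in>carrier ?F1. \<zero>\<^bsub>B\<^esub>) \<otimes>\<^bsub>G\<^esub> z \<in> H #>\<^bsub>G\<^esub> z" by (auto simp: r_coset_def)
  moreover have "(\<lambda>y\<in>carrier ?F1. \<zero>\<^bsub>B\<^esub>) \<otimes>\<^bsub>G\<^esub> z = z"
    using cD(1) dK by (auto simp: G_def hom_group_def res1_def z_def restrict_def fun_eq_iff)
  ultimately have "z \<in> H" using Hz by simp
  then obtain g where g: "g \<in> mod_hom R ?F0 B" "z = (\<lambda>y\<in>carrier ?F1. g (?d y))"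
    by (auto simp: H_def ext1_coboundaries_def res0_def res1_def res_d1_def free_eval_eq_lincomb)
  have "g k = c k" if "k \<in> ?K" for k
  proof -
    \<comment> \<open>Each \<open>k\<close> in the kernel is the value of \<open>?d\<close> at its
      own basis vector, so an equality of maps on \<open>?F1\<close> becomes one on
      \<open>?K\<close>.\<close>
    have "delta R k \<in> carrier ?F1" by (rule A.R.delta_closed[OF that])
    then have "g (?d (delta R k)) = c (?d (delta R k))"
      using fun_cong[OF g(2), of "delta R k"] by (simp add: z_def)
    then show ?thesis using F0.lincomb_delta[OF that KF] by simp
  qed
  moreover have "linear_map R ?F0 B g"
    using g(1) by (auto simp: mod_hom_def linear_map_def hom_def)
  ultimately show ?thesis by blast
qed

text \<open>Finite sums, like negation in the next lemma, are defined with reference to the carrier.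
  Shrinking the carrier therefore yields operations that must first be compared with the old
  ones.\<close>

lemma (in left_module) finsum_submod:
  assumes N: "submodule N R M" and "f \<in> A \<rightarrow> N"
  shows "finsum (M\<lparr>carrier := N\<rparr>) f A = finsum M f A"
proof -
  interpret N: left_module R "M\<lparr>carrier := N\<rparr>" by (rule submod_left_module[OF N])
  show ?thesis using assms(2)
  proof (induction A rule: infinite_finite_induct)
    case (insert a A)
    then have "f \<in> A \<rightarrow> carrier M" "f a \<in> carrier M" using submodD(1)[OF N] by auto
    then show ?case using insert N.M.finsum_insert[of A a f] by auto
  qed auto
qed

lemma (in left_module) minus_submod:
  assumes N: "submodule N R M" and "y \<in> N"
  shows "x \<ominus>\<^bsub>M\<lparr>carrier := N\<rparr>\<^esub> y = x \<ominus>\<^bsub>M\<^esub> y"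
proof -
  interpret N: left_module R "M\<lparr>carrier := N\<rparr>" by (rule submod_left_module[OF N])
  have "\<ominus>\<^bsub>M\<lparr>carrier := N\<rparr>\<^esub> y = \<ominus>\<^bsub>M\<^esub> y"
    by (rule N.M.minus_equality) (use assms(2) submodD[OF N] in \<open>auto simp: M.l_neg subset_iff\<close>)
  then show ?thesis by (simp add: a_minus_def)
qed

text \<open>Vanishing of \<open>Ext1\<close> extends \<open>q\<close> from \<open>W\<close> to a
  linear map on all of \<open>V\<close>, and \<open>V'\<close> is the kernel of that extension: it
  meets \<open>W\<close> in the kernel of \<open>q\<close>, and together with \<open>W\<close> it
  fills \<open>V\<close> because \<open>q\<close> is already surjective on \<open>W\<close>.\<close>

lemma (in left_module) trivial_Ext1_split:
  assumes A: "left_module R A" and B: "left_module R B" and ext: "trivial_group (Ext1 R A B)"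
    and V: "submodule V R M" and W: "submodule W R M" and WV: "W \<subseteq> V"
    and p: "linear_map R (M\<lparr>carrier := V\<rparr>) A p" and p_surj: "carrier A \<subseteq> p ` V"
    and p_ker: "\<And>x. x \<in> V \<Longrightarrow> p x = \<zero>\<^bsub>A\<^esub> \<longleftrightarrow> x \<in> W"
    and q: "linear_map R (M\<lparr>carrier := W\<rparr>) B q" and q_surj: "carrier B \<subseteq> q ` W"
  shows "\<exists>V'. submodule V' R M \<and> V' \<subseteq> V \<and> (\<forall>x\<in>V. \<exists>y\<in>V'. x \<ominus>\<^bsub>M\<^esub> y \<in> W) \<and>
    V' \<inter> W = {x \<in> W. q x = \<zero>\<^bsub>B\<^esub>}"
proof -
  interpret A: left_module R A by (rule A)
  interpret B: left_module R B by (rule B)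
  let ?F0 = "free_mod R (carrier A)" and ?K = "eval_kernel R A (carrier A)"
  interpret F0: left_module R ?F0 by (rule R.free_left_module)
  note V' = submodD[OF V] and W' = submodD[OF W]
  have MV: "left_module R (M\<lparr>carrier := V\<rparr>)" by (rule submod_left_module[OF V])
  have MW: "left_module R (M\<lparr>carrier := W\<rparr>)" by (rule submod_left_module[OF W])
  have p_diff: "p (x \<ominus>\<^bsub>M\<^esub> y) = p x \<ominus>\<^bsub>A\<^esub> p y" if "x \<in> V" "y \<in> V" for x y
    using linear_map_diff[OF MV A p] that by (simp add: minus_submod[OF V])
  have q_diff: "q (x \<ominus>\<^bsub>M\<^esub> y) = q x \<ominus>\<^bsub>B\<^esub> q y" if "x \<in> W" "y \<in> W" for x y
    using linear_map_diff[OF MW B q] that by (simp add: minus_submod[OF W])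
  note pD = linear_mapD[OF p, simplified] and qD = linear_mapD[OF q, simplified]
  have q0: "q \<zero>\<^bsub>M\<^esub> = \<zero>\<^bsub>B\<^esub>" using linear_map_zero[OF MW B q] by simp
  \<comment> \<open>A section of \<open>p\<close>, merely set-theoretic. Its linear extension
    \<open>\<phi>\<close> to the free module on \<open>A\<close> lifts the evaluation map through
    \<open>p\<close>.\<close>
  obtain s where s: "\<And>a. a \<in> carrier A \<Longrightarrow> s a \<in> V \<and> p (s a) = a"
    using p_surj by (metis (no_types, lifting) image_iff subset_iff)
  define \<phi> where "\<phi> = lincomb R M s"
  have sV: "s \<in> carrier A \<rightarrow> V" and sM: "s \<in> carrier A \<rightarrow> carrier M" using s V'(1) by auto
  note \<phi>D = linear_mapD[OF lincomb_linear[OF sM], folded \<phi>_def]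
  have \<phi>0: "\<phi> \<zero>\<^bsub>?F0\<^esub> = \<zero>\<^bsub>M\<^esub>"
    using linear_map_zero[OF F0.left_module_axioms left_module_axioms lincomb_linear[OF sM]]
    by (simp add: \<phi>_def)
  have \<phi>V: "\<phi> f \<in> V" if "f \<in> carrier ?F0" for f
    unfolding \<phi>_def by (rule lincomb_submod[OF V that sV])
  have p\<phi>: "p (\<phi> f) = free_eval R A f" if f: "f \<in> carrier ?F0" for f
  proof -
    have "\<phi> f = lincomb R (M\<lparr>carrier := V\<rparr>) s f"
      unfolding \<phi>_def lincomb_def
      using finsum_submod[OF V free_mod_smult_funcset[OF V f sV]] by simp
    then have "p (\<phi> f) = lincomb R A (\<lambda>a. p (s a)) f"
      using left_module.linear_map_lincomb[OF MV A p f, of s] sV by simp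
    also have "\<dots> = free_eval R A f"
      unfolding lincomb_def free_eval_def
      by (rule A.M.finsum_cong') (use s R.free_mod_memD(1,3)[OF f] in auto)
    finally show ?thesis .
  qed
  have KW: "\<phi> k \<in> W" "k \<in> carrier ?F0" if "k \<in> ?K" for k
  proof -
    show k: "k \<in> carrier ?F0" using that by (simp add: eval_kernel_def)
    show "\<phi> k \<in> W" using p_ker[OF \<phi>V[OF k]] p\<phi>[OF k] that by (simp add: eval_kernel_def)
  qed
  \<comment> \<open>On the kernel of the evaluation map \<open>\<phi>\<close> lands in
    \<open>W\<close>, so \<open>q\<close> can be applied after it; triviality of \<open>Ext1\<close>
    extends the composite to a map \<open>g\<close> on the whole free module.\<close>
  have "linear_map R (?F0\<lparr>carrier := ?K\<rparr>) B (\<lambda>k. q (\<phi> k))"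
    unfolding linear_map_def by (auto simp: KW \<phi>D qD)
  then obtain g where g: "linear_map R ?F0 B g" "\<And>k. k \<in> ?K \<Longrightarrow> g k = q (\<phi> k)"
    using trivial_Ext1_extend[OF A B ext] by blast
  note gD = linear_mapD[OF g(1)]
  \<comment> \<open>For x in \<open>V\<close> take f with \<phi> f congruent to x modulo
    \<open>W\<close>. The value g f - q (\<phi> f - x) does not depend on f, because
    \<open>g\<close> agrees with \<open>q\<close> after \<open>\<phi>\<close> on the kernel; it is
    the extension of \<open>q\<close> to \<open>V\<close>, and \<open>T\<close> is its zero
    set.\<close>
  define T where "T = {x \<in> V. \<exists>f\<in>carrier ?F0. \<phi> f \<ominus>\<^bsub>M\<^esub> x \<in> W \<and> q (\<phi> f \<ominus>\<^bsub>M\<^esub> x) = g f}"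
  have "submodule T R M"
  proof (rule submodI)
    show "T \<subseteq> carrier M" using V'(1) by (auto simp: T_def)
    have "\<zero>\<^bsub>?F0\<^esub> \<in> carrier ?F0" "g \<zero>\<^bsub>?F0\<^esub> = \<zero>\<^bsub>B\<^esub>"
      using linear_map_zero[OF F0.left_module_axioms B g(1)] by auto
    then show "\<zero>\<^bsub>M\<^esub> \<in> T"
      unfolding T_def using V'(2) W'(2) q0 by (auto intro!: bexI[of _ "\<zero>\<^bsub>?F0\<^esub>"] simp: \<phi>0 M.minus_eq M.a_inv_zero)
  next
    fix x y assume "x \<in> T" "y \<in> T"
    then obtain f f' where f: "x \<in> V" "f \<in> carrier ?F0" "\<phi> f \<ominus>\<^bsub>M\<^esub> x \<in> W" "q (\<phi> f \<ominus>\<^bsub>M\<^esub> x) = g f"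
      and f': "y \<in> V" "f' \<in> carrier ?F0" "\<phi> f' \<ominus>\<^bsub>M\<^esub> y \<in> W" "q (\<phi> f' \<ominus>\<^bsub>M\<^esub> y) = g f'"
      by (auto simp: T_def)
    have "x \<in> carrier M" "y \<in> carrier M" using f f' V'(1) by auto
    then have eq: "\<phi> (f \<oplus>\<^bsub>?F0\<^esub> f') \<ominus>\<^bsub>M\<^esub> (x \<oplus>\<^bsub>M\<^esub> y) = (\<phi> f \<ominus>\<^bsub>M\<^esub> x) \<oplus>\<^bsub>M\<^esub> (\<phi> f' \<ominus>\<^bsub>M\<^esub> y)"
      using f f' \<phi>D(1)[of f] \<phi>D(1)[of f'] by (simp add: \<phi>D(2) M.minus_eq M.minus_add M.add.m_ac)
    show "x \<oplus>\<^bsub>M\<^esub> y \<in> T"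
      unfolding T_def using f f' V'(3) W'(3)
      by (auto intro!: bexI[of _ "f \<oplus>\<^bsub>?F0\<^esub> f'"] simp: eq qD gD)
  next
    fix r x assume r: "r \<in> carrier R" and "x \<in> T"
    then obtain f where f: "x \<in> V" "f \<in> carrier ?F0" "\<phi> f \<ominus>\<^bsub>M\<^esub> x \<in> W" "q (\<phi> f \<ominus>\<^bsub>M\<^esub> x) = g f"
      by (auto simp: T_def)
    have "x \<in> carrier M" using f V'(1) by auto
    then have eq: "\<phi> (r \<odot>\<^bsub>?F0\<^esub> f) \<ominus>\<^bsub>M\<^esub> r \<odot>\<^bsub>M\<^esub> x = r \<odot>\<^bsub>M\<^esub> (\<phi> f \<ominus>\<^bsub>M\<^esub> x)"
      using f r \<phi>D(1)[of f] by (simp add: \<phi>D(3) smult_r_diff)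
    show "r \<odot>\<^bsub>M\<^esub> x \<in> T"
      unfolding T_def using f r V'(4) W'(4)
      by (auto intro!: bexI[of _ "r \<odot>\<^bsub>?F0\<^esub> f"] simp: eq qD gD)
  qed
  moreover have "T \<subseteq> V" by (auto simp: T_def)
  moreover have "\<exists>y\<in>T. x \<ominus>\<^bsub>M\<^esub> y \<in> W" if x: "x \<in> V" for x
  proof -
    have pxA: "p x \<in> carrier A" using pD(1)[OF x] .
    let ?f = "delta R (p x)"
    have f: "?f \<in> carrier ?F0" by (rule R.delta_closed[OF pxA])
    have \<phi>f: "\<phi> ?f = s (p x)" unfolding \<phi>_def by (rule lincomb_delta[OF pxA sM])
    have "p (x \<ominus>\<^bsub>M\<^esub> \<phi> ?f) = \<zero>\<^bsub>A\<^esub>"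
      using s[OF pxA] x pxA by (simp add: \<phi>f p_diff A.M.minus_eq A.M.r_neg)
    then have xf: "x \<ominus>\<^bsub>M\<^esub> \<phi> ?f \<in> W" using p_ker[OF V'(6)[OF x \<phi>V[OF f]]] by simp
    \<comment> \<open>Surjectivity of \<open>q\<close> provides the correction \<open>w\<close> that
      moves the lift \<open>\<phi> ?f\<close> into \<open>T\<close>.\<close>
    obtain w where w: "w \<in> W" "q w = g ?f" using gD(1)[OF f] q_surj by (metis image_iff subset_iff)
    have cl: "x \<in> carrier M" "w \<in> carrier M" "\<phi> ?f \<in> carrier M" using x w f V'(1) W'(1) \<phi>D(1) by auto
    let ?y = "\<phi> ?f \<ominus>\<^bsub>M\<^esub> w"
    have "\<phi> ?f \<ominus>\<^bsub>M\<^esub> ?y = w"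
      using cl by (simp add: M.minus_eq M.minus_add M.a_assoc[symmetric] M.r_neg)
    moreover have "?y \<in> V" using \<phi>V[OF f] w WV V'(6) by blast
    ultimately have "?y \<in> T" using f w unfolding T_def by (auto intro!: bexI[of _ ?f])
    moreover have "x \<ominus>\<^bsub>M\<^esub> ?y = (x \<ominus>\<^bsub>M\<^esub> \<phi> ?f) \<oplus>\<^bsub>M\<^esub> w"
      using cl by (simp add: M.minus_eq M.minus_add M.a_assoc)
    then have "x \<ominus>\<^bsub>M\<^esub> ?y \<in> W" using W'(3)[OF xf w(1)] by simp
    ultimately show ?thesis by blast
  qed
  moreover have "T \<inter> W = {x \<in> W. q x = \<zero>\<^bsub>B\<^esub>}"
  proof (rule equalityI; rule subsetI)
    fix x assume "x \<in> T \<inter> W"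
    then obtain f where f: "x \<in> W" "f \<in> carrier ?F0" "\<phi> f \<ominus>\<^bsub>M\<^esub> x \<in> W" "q (\<phi> f \<ominus>\<^bsub>M\<^esub> x) = g f"
      by (auto simp: T_def)
    have cl: "x \<in> carrier M" "\<phi> f \<in> carrier M" using f W'(1) \<phi>D(1) by auto
    have "(\<phi> f \<ominus>\<^bsub>M\<^esub> x) \<oplus>\<^bsub>M\<^esub> x \<in> W" using W'(3) f by blast
    moreover have "(\<phi> f \<ominus>\<^bsub>M\<^esub> x) \<oplus>\<^bsub>M\<^esub> x = \<phi> f" using cl by (simp add: M.minus_eq M.a_assoc M.l_neg)
    ultimately have \<phi>W: "\<phi> f \<in> W" by simp
    then have "p (\<phi> f) = \<zero>\<^bsub>A\<^esub>" using p_ker WV by blast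
    then have "f \<in> ?K" using f p\<phi> by (simp add: eval_kernel_def)
    then have "g f = q (\<phi> f)" by (rule g(2))
    then have "q (\<phi> f) \<ominus>\<^bsub>B\<^esub> q x = q (\<phi> f)" using f q_diff[OF \<phi>W f(1)] by simp
    moreover have qcl: "q (\<phi> f) \<in> carrier B" "q x \<in> carrier B" using qD(1) \<phi>W f by auto
    ultimately have "\<ominus>\<^bsub>B\<^esub> q x = \<zero>\<^bsub>B\<^esub>" by (simp add: B.M.minus_eq)
    then have "q x = \<zero>\<^bsub>B\<^esub>" using qcl(2) by (metis B.M.minus_minus B.M.a_inv_zero)
    then show "x \<in> {x \<in> W. q x = \<zero>\<^bsub>B\<^esub>}" using f by simp
  next
    fix x assume x: "x \<in> {x \<in> W. q x = \<zero>\<^bsub>B\<^esub>}"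
    have "x \<in> carrier M" using x W'(1) by auto
    have "\<zero>\<^bsub>M\<^esub> \<ominus>\<^bsub>M\<^esub> x \<in> W" using x W'(2,6) by blast
    moreover have "q (\<zero>\<^bsub>M\<^esub> \<ominus>\<^bsub>M\<^esub> x) = \<zero>\<^bsub>B\<^esub>"
      using x q_diff[OF W'(2), of x] q0 by (simp add: B.M.minus_eq)
    moreover have "g \<zero>\<^bsub>?F0\<^esub> = \<zero>\<^bsub>B\<^esub>" using linear_map_zero[OF F0.left_module_axioms B g(1)] .
    ultimately show "x \<in> T \<inter> W"
      unfolding T_def using x WV by (auto simp: \<phi>0 intro!: bexI[of _ "\<zero>\<^bsub>?F0\<^esub>"])
  qed
  ultimately show ?thesis by blast
qed

section \<open>Powers of ideals and comaximality\<close>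

context ring begin

lemma ideal_pow_ideal: "ideal I R \<Longrightarrow> ideal (ideal_pow R I n) R"
  by (induction n) (simp_all add: oneideal ideal_prod_is_ideal)

lemma ideal_pow_antimono:
  assumes "ideal I R" "m \<le> n"
  shows "ideal_pow R I n \<subseteq> ideal_pow R I m"
  using assms(2)
proof (induction n rule: dec_induct)
  case (step n)
  then show ?case using ideal_prod_inter[OF ideal_pow_ideal[OF assms(1)] assms(1), of n] by auto
qed simp

lemma ideal_pow_1:
  assumes I: "ideal I R"
  shows "ideal_pow R I 1 = I"
proof
  show "ideal_pow R I 1 \<subseteq> I" using ideal_prod_inter[OF oneideal I] by simp
  show "I \<subseteq> ideal_pow R I 1"
  proof
    fix x assume x: "x \<in> I"
    then have "\<one> \<otimes> x \<in> ideal_prod R (carrier R) I" by (intro ideal_prod.prod) auto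
    then show "x \<in> ideal_pow R I 1" using ideal.Icarr[OF I x] by simp
  qed
qed

text \<open>\<open>ideal_pow\<close> puts each new factor on the right. In a noncommutative ring,
  multiplication from the left needs its own induction, which regroups i (b j) as (i b) j.\<close>

lemma ideal_mult_pow:
  assumes I: "ideal I R" and "i \<in> I" "a \<in> ideal_pow R I n"
  shows "i \<otimes> a \<in> ideal_pow R I (Suc n)"
  using assms(3)
proof (induction n arbitrary: a)
  case 0
  then have "a \<in> carrier R" by simp
  then have "i \<otimes> a \<in> I" by (rule ideal.I_r_closed[OF I assms(2)])
  then show ?case using ideal_pow_1[OF I] unfolding One_nat_def by blast
next
  case (Suc n)
  have P: "ideal (ideal_pow R I (Suc (Suc n))) R" by (rule ideal_pow_ideal[OF I])
  have i: "i \<in> carrier R" by (rule ideal.Icarr[OF I assms(2)])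
  have sub: "ideal_prod R (ideal_pow R I n) I \<subseteq> carrier R"
    by (rule ideal_prod_in_carrier[OF ideal_pow_ideal[OF I] I])
  have "a \<in> ideal_prod R (ideal_pow R I n) I" using Suc.prems by simp
  then show ?case
  proof (induction a rule: ideal_prod.induct)
    case (prod b j)
    then have "b \<in> carrier R" "j \<in> carrier R"
      using ideal.Icarr[OF ideal_pow_ideal[OF I]] ideal.Icarr[OF I] by auto
    then have "i \<otimes> (b \<otimes> j) = (i \<otimes> b) \<otimes> j" using i by (simp add: m_assoc)
    moreover have "i \<otimes> b \<in> ideal_pow R I (Suc n)" using Suc.IH prod by blast
    ultimately show ?case
      using prod(2) ideal_prod.prod[of "i \<otimes> b" "ideal_pow R I (Suc n)" j I R]
      by (simp only: ideal_pow.simps(2)[of R I "Suc n"])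
  next
    case (sum s t)
    then have "s \<in> carrier R" "t \<in> carrier R" using sub by auto
    then have "i \<otimes> (s \<oplus> t) = i \<otimes> s \<oplus> i \<otimes> t" using i by (simp add: r_distr)
    then show ?case
      using additive_subgroup.a_closed[OF ideal.axioms(1)[OF P] sum.IH] by (simp only:)
  qed
qed

text \<open>For two-sided ideals this is I + J = R, recorded through an element that is 1 modulo
  \<open>I\<close> and 0 modulo \<open>J\<close>; such witnesses are multiplied in the proofs
  below.\<close>

definition comaximal :: "'a set \<Rightarrow> 'a set \<Rightarrow> bool"
  where "comaximal I J \<longleftrightarrow> (\<exists>b\<in>J. \<one> \<ominus> b \<in> I)"

lemma comaximal_sym:
  assumes "ideal J R" "comaximal I J"
  shows "comaximal J I"
proof -
  obtain b where b: "b \<in> J" "\<one> \<ominus> b \<in> I" using assms by (auto simp: comaximal_def)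
  have "b \<in> carrier R" using ideal.Icarr[OF assms(1) b(1)] .
  then have "\<one> \<ominus> (\<one> \<ominus> b) = b" by (simp add: minus_eq minus_add a_assoc[symmetric] r_neg)
  then have "\<one> \<ominus> (\<one> \<ominus> b) \<in> J" using b(1) by simp
  then show ?thesis using b(2) unfolding comaximal_def by blast
qed

text \<open>By the identity 1 - bc = (1 - b) + b (1 - c). It keeps products of comaximality
  witnesses congruent to 1.\<close>

lemma one_minus_mult:
  assumes I: "ideal I R" and b: "b \<in> carrier R" "c \<in> carrier R" "\<one> \<ominus> b \<in> I" "\<one> \<ominus> c \<in> I"
  shows "\<one> \<ominus> b \<otimes> c \<in> I"
proof -
  interpret I: ideal I R by (rule I)
  have "(\<one> \<ominus> b) \<oplus> b \<otimes> (\<one> \<ominus> c) = \<one> \<ominus> b \<otimes> c"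
    using b(1,2) by (simp add: minus_eq r_distr r_minus a_assoc[symmetric]) (simp add: a_assoc l_neg)
  then show ?thesis using I.a_closed[OF b(3) I.I_l_closed[OF b(4) b(1)]] by simp
qed

lemma comaximal_pow:
  assumes I: "ideal I R" and J: "ideal J R" and IJ: "comaximal I J"
  shows "comaximal I (ideal_pow R J n)"
proof (induction n)
  case 0
  then show ?case
    using additive_subgroup.zero_closed[OF ideal.axioms(1)[OF I]]
    unfolding comaximal_def by (intro bexI[of _ \<one>]) (simp_all add: minus_eq r_neg)
next
  case (Suc n)
  then obtain b c where b: "b \<in> ideal_pow R J n" "\<one> \<ominus> b \<in> I" and c: "c \<in> J" "\<one> \<ominus> c \<in> I"
    using IJ by (auto simp: comaximal_def)
  have "b \<in> carrier R" "c \<in> carrier R"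
    using ideal.Icarr[OF ideal_pow_ideal[OF J] b(1)] ideal.Icarr[OF J c(1)] by auto
  then have "\<one> \<ominus> b \<otimes> c \<in> I" using one_minus_mult[OF I] b c by blast
  moreover have "b \<otimes> c \<in> ideal_pow R J (Suc n)" using b c by (auto intro: ideal_prod.prod)
  ultimately show ?case unfolding comaximal_def by blast
qed

text \<open>The sum I + J is an ideal above \<open>I\<close>. Were it equal to \<open>I\<close>,
  then \<open>J\<close> would lie in \<open>I\<close>, and maximality of \<open>J\<close> would
  force I = J.\<close>

lemma maximal_comaximal:
  assumes I: "maximalideal I R" and J: "maximalideal J R" and "I \<noteq> J"
  shows "comaximal I J"
proof -
  interpret I: maximalideal I R by (rule I)
  interpret J: maximalideal J R by (rule J)
  have id: "ideal (I <+>\<^bsub>R\<^esub> J) R" by (rule add_ideals[OF I.ideal_axioms J.ideal_axioms])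
  have mem: "x \<oplus> y \<in> I <+>\<^bsub>R\<^esub> J" if "x \<in> I" "y \<in> J" for x y
    using that by (auto simp: set_add_def')
  have "I \<subseteq> I <+>\<^bsub>R\<^esub> J"
  proof
    fix x assume "x \<in> I"
    then show "x \<in> I <+>\<^bsub>R\<^esub> J" using mem[of x \<zero>] J.zero_closed I.Icarr by simp
  qed
  then have "I <+>\<^bsub>R\<^esub> J = I \<or> I <+>\<^bsub>R\<^esub> J = carrier R"
    using I.I_maximal[OF id] ideal.Icarr[OF id] by blast
  moreover have "I <+>\<^bsub>R\<^esub> J \<noteq> I"
  proof
    assume eq: "I <+>\<^bsub>R\<^esub> J = I"
    have "J \<subseteq> I"
    proof
      fix x assume "x \<in> J"
      then show "x \<in> I" using mem[of \<zero> x] I.zero_closed J.Icarr eq by simp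
    qed
    then have "I = J \<or> I = carrier R" using J.I_maximal[OF I.ideal_axioms] I.Icarr by blast
    then show False using assms(3) I.I_notcarr by auto
  qed
  ultimately have "\<one> \<in> I <+>\<^bsub>R\<^esub> J" by simp
  then obtain a b where ab: "a \<in> I" "b \<in> J" "\<one> = a \<oplus> b" by (auto simp: set_add_def')
  then have "\<one> \<ominus> b = a" using I.Icarr J.Icarr by (simp add: minus_eq a_assoc r_neg)
  then have "\<one> \<ominus> b \<in> I" using ab(1) by simp
  then show ?thesis using ab(2) unfolding comaximal_def by blast
qed

text \<open>A product of comaximality witnesses stays 1 modulo \<open>I\<close> and, the ideals
  being two-sided, lies in every \<open>J j\<close>. This is the part of the Chinese remainder
  theorem that isolates one summand in a sum of weight vectors.\<close>

lemma comaximal_Inter: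
  assumes I: "ideal I R" and "finite B" and "\<And>j. j \<in> B \<Longrightarrow> ideal (J j) R" "\<And>j. j \<in> B \<Longrightarrow> comaximal I (J j)"
  shows "\<exists>e\<in>carrier R. \<one> \<ominus> e \<in> I \<and> (\<forall>j\<in>B. e \<in> J j)"
  using assms(2-4)
proof (induction B rule: finite_induct)
  case empty
  then show ?case
    using additive_subgroup.zero_closed[OF ideal.axioms(1)[OF I]]
    by (intro bexI[of _ \<one>]) (simp_all add: minus_eq r_neg)
next
  case (insert j B)
  then obtain e where e: "e \<in> carrier R" "\<one> \<ominus> e \<in> I" "\<And>i. i \<in> B \<Longrightarrow> e \<in> J i" by auto
  have "comaximal I (J j)" using insert by simp
  then obtain b where b: "b \<in> J j" "\<one> \<ominus> b \<in> I" by (auto simp: comaximal_def)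
  have Jj: "ideal (J j) R" using insert by simp
  have bR: "b \<in> carrier R" using ideal.Icarr[OF Jj b(1)] .
  have "\<one> \<ominus> e \<otimes> b \<in> I" using one_minus_mult[OF I e(1) bR e(2) b(2)] .
  moreover have "e \<otimes> b \<in> J i" if "i \<in> insert j B" for i
  proof (cases "i = j")
    case True
    then show ?thesis using ideal.I_l_closed[OF Jj b(1) e(1)] by simp
  next
    case False
    then have "i \<in> B" using that by simp
    then show ?thesis using ideal.I_r_closed[OF insert.prems(1) e(3)] bR by blast
  qed
  ultimately show ?case using e bR by (intro bexI[of _ "e \<otimes> b"]) auto
qed

end

section \<open>Modules over an algebra\<close>

text \<open>\<open>R\<close> plays the part of \<Gamma> itself; the larger algebra enters only at
  the end, through restriction of scalars.\<close>

locale alg_module = KR: assoc_algebra K R + RM: left_module R M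
  for K :: "('k, 'c) ring_scheme" and R :: "('k, 'r, 'd) module_scheme"
    and M :: "('r, 'm, 'e) module_scheme"
begin

abbreviation MK :: "('k, 'm) module" where "MK \<equiv> underlying_space R M"

lemma MK_simps [simp]:
  "carrier MK = carrier M" "\<zero>\<^bsub>MK\<^esub> = \<zero>\<^bsub>M\<^esub>" "x \<oplus>\<^bsub>MK\<^esub> y = x \<oplus>\<^bsub>M\<^esub> y"
  "a \<odot>\<^bsub>MK\<^esub> x = (a \<odot>\<^bsub>R\<^esub> \<one>\<^bsub>R\<^esub>) \<odot>\<^bsub>M\<^esub> x"
  by (simp_all add: underlying_space_def)

lemma left_regular_simps [simp]:
  "carrier (left_regular R) = carrier R" "\<zero>\<^bsub>left_regular R\<^esub> = \<zero>\<^bsub>R\<^esub>"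
  "r \<oplus>\<^bsub>left_regular R\<^esub> s = r \<oplus>\<^bsub>R\<^esub> s" "r \<odot>\<^bsub>left_regular R\<^esub> s = r \<otimes>\<^bsub>R\<^esub> s"
  by (simp_all add: left_regular_def)

lemma scalar_closed: "a \<in> carrier K \<Longrightarrow> a \<odot>\<^bsub>R\<^esub> \<one>\<^bsub>R\<^esub> \<in> carrier R"
  by (rule KR.smult_closed) auto

lemma scalar_mult_left:
  "\<lbrakk>a \<in> carrier K; r \<in> carrier R\<rbrakk> \<Longrightarrow> (a \<odot>\<^bsub>R\<^esub> \<one>\<^bsub>R\<^esub>) \<otimes>\<^bsub>R\<^esub> r = a \<odot>\<^bsub>R\<^esub> r"
  using KR.smult_mult_left[of a "\<one>\<^bsub>R\<^esub>" r] by simp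

lemma scalar_mult_right:
  "\<lbrakk>a \<in> carrier K; r \<in> carrier R\<rbrakk> \<Longrightarrow> r \<otimes>\<^bsub>R\<^esub> (a \<odot>\<^bsub>R\<^esub> \<one>\<^bsub>R\<^esub>) = a \<odot>\<^bsub>R\<^esub> r"
  using KR.smult_mult_right[of a r "\<one>\<^bsub>R\<^esub>"] by simp

lemma scalar_smult:
  "\<lbrakk>a \<in> carrier K; r \<in> carrier R; x \<in> carrier M\<rbrakk> \<Longrightarrow>
    (a \<odot>\<^bsub>R\<^esub> r) \<odot>\<^bsub>M\<^esub> x = (a \<odot>\<^bsub>R\<^esub> \<one>\<^bsub>R\<^esub>) \<odot>\<^bsub>M\<^esub> (r \<odot>\<^bsub>M\<^esub> x)"
  using RM.smult_assoc1[OF scalar_closed, of a r x] scalar_mult_left[of a r] by simp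

text \<open>Scalars are central, so each element of \<open>R\<close> acts linearly over the
  field.\<close>

lemma smult_scalar_commute:
  "\<lbrakk>a \<in> carrier K; r \<in> carrier R; x \<in> carrier M\<rbrakk> \<Longrightarrow>
    r \<odot>\<^bsub>M\<^esub> ((a \<odot>\<^bsub>R\<^esub> \<one>\<^bsub>R\<^esub>) \<odot>\<^bsub>M\<^esub> x) = (a \<odot>\<^bsub>R\<^esub> \<one>\<^bsub>R\<^esub>) \<odot>\<^bsub>M\<^esub> (r \<odot>\<^bsub>M\<^esub> x)"
  using RM.smult_assoc1[OF _ scalar_closed, of r a x] scalar_mult_right[of a r] scalar_smult[of a r x]
  by simp

end

text \<open>Three linear structures coexist: \<open>KA\<close> is \<open>R\<close> over the field,
  \<open>KV\<close> is \<open>M\<close> over the field, and \<open>RL\<close> is \<open>R\<close> as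
  a left module over itself. Dimensions are measured in the first two, the Noetherian condition in
  the third.\<close>

sublocale alg_module \<subseteq> KA: vector_space_over K R
proof -
  have "left_module K R"
    by (intro left_module.intro left_module_axioms.intro KR.K.ring_axioms KR.M.abelian_group_axioms)
      (auto simp: KR.smult_l_distr KR.smult_r_distr KR.smult_assoc1)
  then show "vector_space_over K R" by (intro vector_space_over.intro KR.K.field_axioms)
qed

sublocale alg_module \<subseteq> KV: vector_space_over K "underlying_space R M"
proof -
  have "abelian_group MK"
    by (rule abelian_groupI) (auto simp: RM.M.a_assoc intro: RM.M.a_comm intro!: bexI[of _ "\<ominus>\<^bsub>M\<^esub> _"] RM.M.l_neg)
  moreover have "left_module_axioms K MK"
  proof (intro left_module_axioms.intro)
    fix a b x assume ab: "a \<in> carrier K" "b \<in> carrier K" and "x \<in> carrier MK"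
    then have x: "x \<in> carrier M" by simp
    have "(a \<oplus>\<^bsub>K\<^esub> b) \<odot>\<^bsub>R\<^esub> \<one>\<^bsub>R\<^esub> = a \<odot>\<^bsub>R\<^esub> \<one>\<^bsub>R\<^esub> \<oplus>\<^bsub>R\<^esub> b \<odot>\<^bsub>R\<^esub> \<one>\<^bsub>R\<^esub>"
      using ab by (simp add: KR.smult_l_distr)
    then show "(a \<oplus>\<^bsub>K\<^esub> b) \<odot>\<^bsub>MK\<^esub> x = a \<odot>\<^bsub>MK\<^esub> x \<oplus>\<^bsub>MK\<^esub> b \<odot>\<^bsub>MK\<^esub> x"
      using ab x scalar_closed by (simp add: RM.smult_l_distr)
    have "(a \<otimes>\<^bsub>K\<^esub> b) \<odot>\<^bsub>R\<^esub> \<one>\<^bsub>R\<^esub> = a \<odot>\<^bsub>R\<^esub> (b \<odot>\<^bsub>R\<^esub> \<one>\<^bsub>R\<^esub>)"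
      using ab by (simp add: KR.smult_assoc1)
    then show "(a \<otimes>\<^bsub>K\<^esub> b) \<odot>\<^bsub>MK\<^esub> x = a \<odot>\<^bsub>MK\<^esub> (b \<odot>\<^bsub>MK\<^esub> x)"
      using scalar_smult[OF ab(1) scalar_closed[OF ab(2)] x] by simp
  qed (auto simp: scalar_closed RM.smult_r_distr)
  ultimately have "left_module K MK" using KR.K.ring_axioms by (intro left_module.intro)
  then show "vector_space_over K (underlying_space R M)"
    by (intro vector_space_over.intro KR.K.field_axioms)
qed

sublocale alg_module \<subseteq> RL: left_module R "left_regular R"
proof -
  have "abelian_group (left_regular R)"
    by (rule abelian_groupI)
      (auto simp: KR.M.a_assoc intro: KR.M.a_comm intro!: bexI[of _ "\<ominus>\<^bsub>R\<^esub> _"] KR.M.l_neg)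
  then show "left_module R (left_regular R)"
    by (intro left_module.intro left_module_axioms.intro KR.U.ring_axioms)
      (auto simp: KR.U.l_distr KR.U.r_distr KR.U.m_assoc)
qed

context alg_module begin

lemma MK_minus [simp]:
  assumes "y \<in> carrier M"
  shows "x \<ominus>\<^bsub>MK\<^esub> y = x \<ominus>\<^bsub>M\<^esub> y"
proof -
  have "\<ominus>\<^bsub>MK\<^esub> y = \<ominus>\<^bsub>M\<^esub> y" by (rule KV.M.minus_equality) (use assms in \<open>auto simp: RM.M.l_neg\<close>)
  then show ?thesis by (simp add: a_minus_def)
qed

lemma submod_subspace:
  assumes "submodule N R M"
  shows "submodule N K MK"
  by (rule KV.submodI) (use RM.submodD(1-4)[OF assms] scalar_closed in auto)

lemma ideal_subspace:
  assumes "ideal I R"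
  shows "submodule I K R"
proof -
  interpret I: ideal I R by (rule assms)
  show ?thesis
  proof (rule KA.submodI)
    fix a x assume "a \<in> carrier K" "x \<in> I"
    then show "a \<odot>\<^bsub>R\<^esub> x \<in> I"
      using I.I_l_closed[OF _ scalar_closed, of x a] scalar_mult_left[of a x] I.Icarr by simp
  qed (use I.Icarr in auto)
qed

lemma ideal_left_submod:
  assumes "ideal I R"
  shows "submodule I R (left_regular R)"
proof -
  interpret I: ideal I R by (rule assms)
  show ?thesis by (rule RL.submodI) (use I.Icarr I.I_l_closed in auto)
qed

lemma act_linear: "x \<in> carrier M \<Longrightarrow> linear_map K R MK (\<lambda>r. r \<odot>\<^bsub>M\<^esub> x)"
  unfolding linear_map_def by (auto simp: RM.smult_l_distr intro: scalar_smult)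

lemma mult_right_linear: "x \<in> carrier R \<Longrightarrow> linear_map K R R (\<lambda>r. r \<otimes>\<^bsub>R\<^esub> x)"
  by (auto simp: linear_map_def KR.U.l_distr KR.smult_mult_left)

section \<open>Simple quotients and their annihilators\<close>

text \<open>This says that \<open>W/X\<close> is simple, without forming the quotient.\<close>

definition max_submod :: "'m set \<Rightarrow> 'm set \<Rightarrow> bool"
  where "max_submod X W \<longleftrightarrow> submodule X R M \<and> submodule W R M \<and> X \<subset> W \<and>
    (\<forall>Z. submodule Z R M \<longrightarrow> X \<subseteq> Z \<longrightarrow> Z \<subseteq> W \<longrightarrow> Z = X \<or> Z = W)"

lemma max_submodD:
  assumes "max_submod X W"
  shows "submodule X R M" "submodule W R M" "X \<subset> W"
    and "\<lbrakk>submodule Z R M; X \<subseteq> Z; Z \<subseteq> W\<rbrakk> \<Longrightarrow> Z = X \<or> Z = W"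
  using assms unfolding max_submod_def by auto

text \<open>Among the proper submodules above \<open>Y\<close> one of largest rank is taken. Ranks
  are bounded by that of \<open>W\<close>, and a submodule strictly in between would have larger
  rank.\<close>

lemma ex_max_submod:
  assumes fin: "KV.findim W" and W: "submodule W R M" and Y: "submodule Y R M" "Y \<subset> W"
  shows "\<exists>X. max_submod X W \<and> Y \<subseteq> X"
proof -
  let ?P = "\<lambda>X. submodule X R M \<and> Y \<subseteq> X \<and> X \<subset> W"
  have rk: "KV.rank X < KV.rank W" if "?P X" for X
    using KV.rank_mono(2)[OF fin submod_subspace, of X] that by auto
  have "\<exists>X. ?P X \<and> (\<forall>Z. ?P Z \<longrightarrow> KV.rank Z \<le> KV.rank X)"
    by (intro ex_has_greatest_nat[of ?P Y KV.rank "KV.rank W"]) (use Y rk in blast)+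
  then obtain X where X: "?P X" and X_max: "\<And>Z. ?P Z \<Longrightarrow> KV.rank Z \<le> KV.rank X" by meson
  have "Z = X \<or> Z = W" if Z: "submodule Z R M" "X \<subseteq> Z" "Z \<subseteq> W" for Z
  proof (rule ccontr)
    assume ne: "\<not> (Z = X \<or> Z = W)"
    then have "?P Z" using Z X by auto
    then have "KV.rank Z \<le> KV.rank X" by (rule X_max)
    moreover have "KV.findim Z" using KV.findim_subspace[OF fin submod_subspace[OF Z(1)] Z(3)] .
    then have "KV.rank X < KV.rank Z" using KV.rank_mono(2)[OF _ submod_subspace[of X]] X Z(2) ne by auto
    ultimately show False by simp
  qed
  then show ?thesis using X W unfolding max_submod_def by blast
qed

text \<open>Stability under \<open>R\<close> uses that \<open>J\<close> absorbs factors on the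
  right: j (r x) = (j r) x.\<close>

lemma colon_submod:
  assumes J: "ideal J R" and X: "submodule X R M"
  shows "submodule {x \<in> carrier M. \<forall>j\<in>J. j \<odot>\<^bsub>M\<^esub> x \<in> X} R M"
proof -
  note JR = ideal.Icarr[OF J]
  show ?thesis
  proof (rule RM.submodI)
    fix r x assume r: "r \<in> carrier R" and x: "x \<in> {x \<in> carrier M. \<forall>j\<in>J. j \<odot>\<^bsub>M\<^esub> x \<in> X}"
    have "j \<odot>\<^bsub>M\<^esub> (r \<odot>\<^bsub>M\<^esub> x) \<in> X" if j: "j \<in> J" for j
    proof -
      have "(j \<otimes>\<^bsub>R\<^esub> r) \<odot>\<^bsub>M\<^esub> x \<in> X" using ideal.I_r_closed[OF J j r] x by blast
      then show ?thesis using RM.smult_assoc1[OF JR[OF j] r] x by simp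
    qed
    then show "r \<odot>\<^bsub>M\<^esub> x \<in> {x \<in> carrier M. \<forall>j\<in>J. j \<odot>\<^bsub>M\<^esub> x \<in> X}" using r x by simp
  qed (use RM.submodD(2,3)[OF X] JR in \<open>auto simp: RM.smult_r_distr\<close>)
qed

text \<open>Induction on the list: the elements killing \<open>ys\<close> and also \<open>s\<close>
  form the kernel of \<open>r \<mapsto> r s\<close> on those killing \<open>ys\<close>, and the
  image of that map lies in the finite-dimensional \<open>V\<close>.\<close>

lemma codim_ann_list:
  assumes V: "KV.findim V" "submodule V R M" and "set ys \<subseteq> V"
  shows "KA.fin_codim {r \<in> carrier R. \<forall>y\<in>set ys. r \<odot>\<^bsub>M\<^esub> y = \<zero>\<^bsub>M\<^esub>} (carrier R)"
  using assms(3)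
proof (induction ys)
  case Nil
  show ?case unfolding KA.fin_codim_def by (intro exI[of _ "[]"]) (auto simp: KR.M.minus_eq)
next
  case (Cons s ys)
  let ?L = "{r \<in> carrier R. \<forall>y\<in>set ys. r \<odot>\<^bsub>M\<^esub> y = \<zero>\<^bsub>M\<^esub>}"
  let ?L' = "{r \<in> carrier R. \<forall>y\<in>set (s # ys). r \<odot>\<^bsub>M\<^esub> y = \<zero>\<^bsub>M\<^esub>}"
  have VM: "V \<subseteq> carrier M" by (rule RM.submodD(1)[OF V(2)])
  have s: "s \<in> carrier M" and ysM: "set ys \<subseteq> carrier M" using Cons.prems VM by auto
  have L: "submodule ?L K R"
  proof (rule KA.submodI)
    fix a r assume "a \<in> carrier K" "r \<in> ?L"
    then have "(a \<odot>\<^bsub>R\<^esub> r) \<odot>\<^bsub>M\<^esub> y = \<zero>\<^bsub>M\<^esub>" if "y \<in> set ys" for y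
      using scalar_smult[of a r y] scalar_closed[of a] that ysM by auto
    then show "a \<odot>\<^bsub>R\<^esub> r \<in> ?L" using \<open>a \<in> carrier K\<close> \<open>r \<in> ?L\<close> by simp
  qed (use ysM in \<open>auto simp: RM.smult_l_distr subset_iff\<close>)
  let ?p = "\<lambda>r. r \<odot>\<^bsub>M\<^esub> s"
  note p = act_linear[OF s]
  have "KA.fin_codim ?L' ?L"
  proof -
    let ?S = "?p ` ?L"
    have "submodule ?S K MK"
    proof (rule KV.submodI)
      show "\<zero>\<^bsub>MK\<^esub> \<in> ?S" using KA.submodD(2)[OF L] s by (auto intro!: image_eqI[of _ _ "\<zero>\<^bsub>R\<^esub>"])
    next
      fix x y assume "x \<in> ?S" "y \<in> ?S"
      then obtain a b where ab: "a \<in> ?L" "b \<in> ?L" "x = ?p a" "y = ?p b" by blast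
      then have "x \<oplus>\<^bsub>MK\<^esub> y = ?p (a \<oplus>\<^bsub>R\<^esub> b)" using s by (auto simp: RM.smult_l_distr)
      then show "x \<oplus>\<^bsub>MK\<^esub> y \<in> ?S" using KA.submodD(3)[OF L ab(1,2)] by blast
    next
      fix a x assume a: "a \<in> carrier K" and "x \<in> ?S"
      then obtain b where b: "b \<in> ?L" "x = ?p b" by blast
      then have "a \<odot>\<^bsub>MK\<^esub> x = ?p (a \<odot>\<^bsub>R\<^esub> b)" using scalar_smult[OF a _ s, of b] by simp
      then show "a \<odot>\<^bsub>MK\<^esub> x \<in> ?S" using KA.submodD(4)[OF L a b(1)] by blast
    qed (use s in auto)
    moreover have "?S \<subseteq> V" using Cons.prems RM.submodD(4)[OF V(2)] by auto
    ultimately have "KV.findim ?S" by (rule KV.findim_subspace[OF V(1)])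
    then obtain zs where zs: "set zs \<subseteq> ?S" "?S \<subseteq> lspan K MK zs" by (auto simp: KV.findim_def)
    \<comment> \<open>A spanning list of the image is lifted to \<open>as\<close>; subtracting a
      suitable combination of the lifts puts \<open>r\<close> into the kernel.\<close>
    have "zs \<in> lists (?p ` ?L)" using zs(1) by blast
    then have "zs \<in> map ?p ` lists ?L" by (simp only: lists_image)
    then obtain as where as: "set as \<subseteq> ?L" "zs = map ?p as" by blast
    have asR: "set as \<subseteq> carrier R" using as(1) by blast
    have span: "lspan K MK zs = ?p ` lspan K R as"
      unfolding as(2) by (rule linear_map_lspan[OF KA.left_module_axioms KV.left_module_axioms p asR])
    have "\<exists>y\<in>lspan K R as. r \<ominus>\<^bsub>R\<^esub> y \<in> ?L'" if r: "r \<in> ?L" for r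
    proof -
      have "?p r \<in> ?p ` lspan K R as" using zs(2) r unfolding span by blast
      then obtain y where y: "y \<in> lspan K R as" "?p r = ?p y" by blast
      have yL: "y \<in> ?L" using KA.lspan_minimal[OF L as(1)] y(1) by blast
      then have "r \<ominus>\<^bsub>R\<^esub> y \<in> ?L" by (rule KA.submodD(6)[OF L r])
      moreover have "?p (r \<ominus>\<^bsub>R\<^esub> y) = \<zero>\<^bsub>M\<^esub>"
        using r yL s y(2) by (simp add: RM.smult_l_diff RM.M.minus_eq RM.M.r_neg)
      ultimately have "r \<ominus>\<^bsub>R\<^esub> y \<in> ?L'" by simp
      then show ?thesis using y(1) by blast
    qed
    then show ?thesis using asR unfolding KA.fin_codim_def by blast
  qed
  then show ?case
    using KA.fin_codim_trans[OF _ _ Cons.IH, of ?L'] Cons.prems by auto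
qed

text \<open>The density step, by induction on the list. The element \<open>e\<close> already acts as
  the identity on \<open>ys\<close> modulo \<open>W\<close>, and the defect u = e s - s at the new
  vector has to be removed without disturbing \<open>ys\<close>. The available corrections are the
  elements of \<open>J\<close> mapping \<open>ys\<close> into \<open>W\<close>; simplicity of
  \<open>V/W\<close> leaves two possibilities for what they do to \<open>s\<close>.\<close>

lemma max_submod_unit:
  assumes WV: "max_submod W V" and J: "ideal J R"
    and ne: "\<exists>j\<in>J. \<exists>v\<in>V. j \<odot>\<^bsub>M\<^esub> v \<notin> W" and "set ys \<subseteq> V"
  shows "\<exists>e\<in>J. \<forall>y\<in>set ys. e \<odot>\<^bsub>M\<^esub> y \<ominus>\<^bsub>M\<^esub> y \<in> W"
  using assms(4)
proof (induction ys)
  case Nil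
  show ?case using additive_subgroup.zero_closed[OF ideal.axioms(1)[OF J]] by auto
next
  case (Cons s ys)
  note W = max_submodD(1)[OF WV] and V = max_submodD(2)[OF WV]
  note W' = RM.submodD[OF W] and V' = RM.submodD[OF V]
  interpret J: ideal J R by (rule J)
  from Cons obtain e where e: "e \<in> J" "\<And>y. y \<in> set ys \<Longrightarrow> e \<odot>\<^bsub>M\<^esub> y \<ominus>\<^bsub>M\<^esub> y \<in> W" by auto
  have eR: "e \<in> carrier R" using e(1) by (rule J.Icarr)
  have sV: "s \<in> V" and ysV: "set ys \<subseteq> V" using Cons.prems by auto
  have sM: "s \<in> carrier M" and ysM: "set ys \<subseteq> carrier M" using sV ysV V'(1) by auto
  let ?u = "e \<odot>\<^bsub>M\<^esub> s \<ominus>\<^bsub>M\<^esub> s"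
  have uV: "?u \<in> V" using V'(6)[OF V'(4)[OF eR sV] sV] .
  let ?J = "{a \<in> J. \<forall>y\<in>set ys. a \<odot>\<^bsub>M\<^esub> y \<in> W}"
  let ?N = "{x \<oplus>\<^bsub>M\<^esub> w | x w. x \<in> (\<lambda>a. a \<odot>\<^bsub>M\<^esub> s) ` ?J \<and> w \<in> W}"
  have Js: "submodule ((\<lambda>a. a \<odot>\<^bsub>M\<^esub> s) ` ?J) R M"
  proof (rule RM.submodI)
    have "\<zero>\<^bsub>R\<^esub> \<in> ?J" using ysM W'(2) by auto
    then show "\<zero>\<^bsub>M\<^esub> \<in> (\<lambda>a. a \<odot>\<^bsub>M\<^esub> s) ` ?J" using sM by (auto intro!: image_eqI[of _ _ "\<zero>\<^bsub>R\<^esub>"])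
  next
    fix x y assume "x \<in> (\<lambda>a. a \<odot>\<^bsub>M\<^esub> s) ` ?J" "y \<in> (\<lambda>a. a \<odot>\<^bsub>M\<^esub> s) ` ?J"
    then obtain a b where ab: "a \<in> ?J" "b \<in> ?J" "x = a \<odot>\<^bsub>M\<^esub> s" "y = b \<odot>\<^bsub>M\<^esub> s" by blast
    have abR: "a \<in> carrier R" "b \<in> carrier R" using ab J.Icarr by auto
    have "a \<oplus>\<^bsub>R\<^esub> b \<in> ?J" using ab abR ysM W'(3) by (auto simp: RM.smult_l_distr subset_iff)
    moreover have "x \<oplus>\<^bsub>M\<^esub> y = (a \<oplus>\<^bsub>R\<^esub> b) \<odot>\<^bsub>M\<^esub> s" using ab abR sM by (simp add: RM.smult_l_distr)
    ultimately show "x \<oplus>\<^bsub>M\<^esub> y \<in> (\<lambda>a. a \<odot>\<^bsub>M\<^esub> s) ` ?J" by blast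
  next
    fix r x assume r: "r \<in> carrier R" and "x \<in> (\<lambda>a. a \<odot>\<^bsub>M\<^esub> s) ` ?J"
    then obtain a where a: "a \<in> ?J" "x = a \<odot>\<^bsub>M\<^esub> s" by blast
    have aR: "a \<in> carrier R" using a J.Icarr by auto
    have "r \<otimes>\<^bsub>R\<^esub> a \<in> ?J"
      using a aR r ysM W'(4) J.I_l_closed by (auto simp: RM.smult_assoc1 subset_iff)
    moreover have "r \<odot>\<^bsub>M\<^esub> x = (r \<otimes>\<^bsub>R\<^esub> a) \<odot>\<^bsub>M\<^esub> s" using a aR r sM by (simp add: RM.smult_assoc1)
    ultimately show "r \<odot>\<^bsub>M\<^esub> x \<in> (\<lambda>a. a \<odot>\<^bsub>M\<^esub> s) ` ?J" by blast
  qed (use sM J.Icarr in auto)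
  have N: "submodule ?N R M" by (rule RM.submod_sum[OF Js W])
  have WN: "W \<subseteq> ?N"
  proof
    fix w assume "w \<in> W"
    then have "\<zero>\<^bsub>M\<^esub> \<oplus>\<^bsub>M\<^esub> w \<in> ?N" using RM.submodD(2)[OF Js] by blast
    moreover have "\<zero>\<^bsub>M\<^esub> \<oplus>\<^bsub>M\<^esub> w = w" using \<open>w \<in> W\<close> W'(1) by auto
    ultimately show "w \<in> ?N" by (simp only:)
  qed
  have "?N \<subseteq> V"
  proof
    fix x assume "x \<in> ?N"
    then obtain a w where aw: "a \<in> J" "w \<in> W" "x = a \<odot>\<^bsub>M\<^esub> s \<oplus>\<^bsub>M\<^esub> w" by blast
    have "w \<in> V" using aw(2) max_submodD(3)[OF WV] by blast
    then show "x \<in> V" using V'(3)[OF V'(4)[OF J.Icarr[OF aw(1)] sV]] aw(3) by simp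
  qed
  then consider "?N = V" | "?N = W" using max_submodD(4)[OF WV N WN] by blast
  then show ?case
  proof cases
    \<comment> \<open>The corrections move \<open>s\<close> to everything in \<open>V\<close> modulo
      \<open>W\<close>, so one of them takes \<open>s\<close> to -u modulo \<open>W\<close>; adding
      it to \<open>e\<close> repairs \<open>s\<close>.\<close>
    case 1
    then have "\<ominus>\<^bsub>M\<^esub> ?u \<in> ?N" using V'(5)[OF uV] by simp
    then obtain a w where aw: "a \<in> ?J" "w \<in> W" "\<ominus>\<^bsub>M\<^esub> ?u = a \<odot>\<^bsub>M\<^esub> s \<oplus>\<^bsub>M\<^esub> w" by blast
    have aR: "a \<in> carrier R" using aw J.Icarr by auto
    have wM: "w \<in> carrier M" using aw(2) W'(1) by blast
    have split: "(e \<oplus>\<^bsub>R\<^esub> a) \<odot>\<^bsub>M\<^esub> y \<ominus>\<^bsub>M\<^esub> y = (e \<odot>\<^bsub>M\<^esub> y \<ominus>\<^bsub>M\<^esub> y) \<oplus>\<^bsub>M\<^esub> a \<odot>\<^bsub>M\<^esub> y"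
      if "y \<in> carrier M" for y
      using that aR eR RM.smult_closed[OF eR that] RM.smult_closed[OF aR that]
      by (simp add: RM.smult_l_distr RM.M.minus_eq RM.M.add.m_ac)
    have uM: "?u \<in> carrier M" "a \<odot>\<^bsub>M\<^esub> s \<in> carrier M" using sM eR aR by auto
    have "(?u \<oplus>\<^bsub>M\<^esub> a \<odot>\<^bsub>M\<^esub> s) \<oplus>\<^bsub>M\<^esub> w = ?u \<oplus>\<^bsub>M\<^esub> \<ominus>\<^bsub>M\<^esub> ?u"
      unfolding aw(3) by (rule RM.M.a_assoc[OF uM wM])
    also have "\<dots> = \<zero>\<^bsub>M\<^esub>" by (rule RM.M.r_neg[OF uM(1)])
    finally have "?u \<oplus>\<^bsub>M\<^esub> a \<odot>\<^bsub>M\<^esub> s = \<ominus>\<^bsub>M\<^esub> w"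
      by (rule RM.M.minus_equality[symmetric, OF _ wM]) (use uM in simp)
    then have "?u \<oplus>\<^bsub>M\<^esub> a \<odot>\<^bsub>M\<^esub> s \<in> W" using W'(5)[OF aw(2)] by simp
    then have "(e \<oplus>\<^bsub>R\<^esub> a) \<odot>\<^bsub>M\<^esub> s \<ominus>\<^bsub>M\<^esub> s \<in> W" using split[OF sM] by simp
    moreover have "(e \<oplus>\<^bsub>R\<^esub> a) \<odot>\<^bsub>M\<^esub> y \<ominus>\<^bsub>M\<^esub> y \<in> W" if y: "y \<in> set ys" for y
    proof -
      have "y \<in> carrier M" "a \<odot>\<^bsub>M\<^esub> y \<in> W" using y ysM aw(1) by auto
      then show ?thesis using split[of y] W'(3)[OF e(2)[OF y]] by simp
    qed
    moreover have "e \<oplus>\<^bsub>R\<^esub> a \<in> J" using e(1) aw(1) by (intro J.a_closed) auto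
    ultimately show ?thesis by (intro bexI[of _ "e \<oplus>\<^bsub>R\<^esub> a"]) auto
  next
    case 2
    \<comment> \<open>Here the corrections send \<open>s\<close> into \<open>W\<close>. Since j e -
      j is a correction for every \<open>j\<close> in \<open>J\<close>, and (j e - j) s = j u, the
      defect is killed by \<open>J\<close> modulo \<open>W\<close>.\<close>
    have ju: "j \<odot>\<^bsub>M\<^esub> ?u \<in> W" if j: "j \<in> J" for j
    proof -
      have jR: "j \<in> carrier R" using j by (rule J.Icarr)
      have je: "(j \<otimes>\<^bsub>R\<^esub> e \<ominus>\<^bsub>R\<^esub> j) \<odot>\<^bsub>M\<^esub> y = j \<odot>\<^bsub>M\<^esub> (e \<odot>\<^bsub>M\<^esub> y \<ominus>\<^bsub>M\<^esub> y)" if "y \<in> carrier M" for y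
        using that jR eR by (simp add: RM.smult_l_diff RM.smult_r_diff RM.smult_assoc1)
      have "j \<otimes>\<^bsub>R\<^esub> e \<in> J" using J.I_l_closed[OF e(1) jR] .
      then have "j \<otimes>\<^bsub>R\<^esub> e \<ominus>\<^bsub>R\<^esub> j \<in> J" using j by (simp add: KR.M.minus_eq)
      then have "j \<otimes>\<^bsub>R\<^esub> e \<ominus>\<^bsub>R\<^esub> j \<in> ?J"
        using je ysM W'(4)[OF jR e(2)] by auto
      then have "(j \<otimes>\<^bsub>R\<^esub> e \<ominus>\<^bsub>R\<^esub> j) \<odot>\<^bsub>M\<^esub> s \<oplus>\<^bsub>M\<^esub> \<zero>\<^bsub>M\<^esub> \<in> ?N" using W'(2) by blast
      then show ?thesis using 2 je[OF sM] jR uV V'(1) by auto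
    qed
    \<comment> \<open>The vectors of \<open>V\<close> killed by \<open>J\<close> modulo
      \<open>W\<close> form a submodule above \<open>W\<close>. It differs from \<open>V\<close> by
      assumption, so it is \<open>W\<close>; hence the defect was in \<open>W\<close> all along and
      \<open>e\<close> is kept.\<close>
    let ?Q = "{v \<in> carrier M. \<forall>j\<in>J. j \<odot>\<^bsub>M\<^esub> v \<in> W} \<inter> V"
    have Q: "submodule ?Q R M" by (rule RM.submod_Int[OF colon_submod[OF J W] V])
    have "W \<subseteq> ?Q" using W'(1,4) J.Icarr max_submodD(3)[OF WV] by blast
    then have "?Q = W \<or> ?Q = V" using max_submodD(4)[OF WV Q] by blast
    moreover have "?Q \<noteq> V" using ne by blast
    moreover have "?u \<in> ?Q" using ju uV V'(1) by blast
    ultimately have "?u \<in> W" by blast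
    then show ?thesis using e by (intro bexI[of _ e]) auto
  qed
qed

text \<open>An ideal \<open>J\<close> strictly above the annihilator contains an \<open>e\<close>
  acting as the identity on \<open>V/W\<close>. Then e - 1 annihilates \<open>V/W\<close>, so it
  lies in \<open>J\<close>, and with it 1 = e - (e - 1). Finite codimension is inherited from the
  smaller annihilator of a finite spanning list of \<open>V\<close>.\<close>

lemma ann_quotient_cfs:
  assumes WV: "max_submod W V" and fin: "KV.findim V"
  shows "{r \<in> carrier R. \<forall>v\<in>V. r \<odot>\<^bsub>M\<^esub> v \<in> W} \<in> cfs K R" (is "?P \<in> _")
proof -
  note W = max_submodD(1)[OF WV] and V = max_submodD(2)[OF WV]
  note W' = RM.submodD[OF W] and V' = RM.submodD[OF V]
  have VM: "\<And>v. v \<in> V \<Longrightarrow> v \<in> carrier M" using V'(1) by blast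
  obtain ys where ys: "set ys \<subseteq> V" "V \<subseteq> lspan K MK ys" using fin by (auto simp: KV.findim_def)
  have PI: "ideal ?P R"
  proof (rule idealI)
    show "ring R" by (rule KR.U.ring_axioms)
    have P0: "\<zero>\<^bsub>R\<^esub> \<in> ?P" using VM W'(2) by auto
    have Padd: "a \<oplus>\<^bsub>R\<^esub> b \<in> ?P" if "a \<in> ?P" "b \<in> ?P" for a b
      using that VM W'(3) by (auto simp: RM.smult_l_distr)
    have Pl: "r \<otimes>\<^bsub>R\<^esub> a \<in> ?P" if "a \<in> ?P" "r \<in> carrier R" for a r
      using that VM W'(4) by (auto simp: RM.smult_assoc1)
    have "submodule ?P K R"
    proof (rule KA.submodI)
      fix a r assume a: "a \<in> carrier K" and r: "r \<in> ?P"
      then have "(a \<odot>\<^bsub>R\<^esub> r) \<odot>\<^bsub>M\<^esub> v \<in> W" if "v \<in> V" for v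
        using scalar_smult[OF a _ VM, of r v] W'(4)[OF scalar_closed[OF a], of "r \<odot>\<^bsub>M\<^esub> v"] that by simp
      then show "a \<odot>\<^bsub>R\<^esub> r \<in> ?P" using a r by simp
    qed (use P0 Padd in auto)
    then show "subgroup ?P (add_monoid R)" by (rule submodule.axioms(1))
    show "\<And>a x. \<lbrakk>a \<in> ?P; x \<in> carrier R\<rbrakk> \<Longrightarrow> x \<otimes>\<^bsub>R\<^esub> a \<in> ?P" by (rule Pl)
    show "\<And>a x. \<lbrakk>a \<in> ?P; x \<in> carrier R\<rbrakk> \<Longrightarrow> a \<otimes>\<^bsub>R\<^esub> x \<in> ?P"
      using VM V'(4) by (auto simp: RM.smult_assoc1)
  qed
  have span: "v \<in> X" if X: "submodule X K MK" "set ys \<subseteq> X" and "v \<in> V" for X v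
    using KV.lspan_minimal[OF X] ys(2) that(3) by blast
  have "maximalideal ?P R"
  proof (rule maximalidealI[OF PI])
    show "carrier R \<noteq> ?P"
    proof
      assume "carrier R = ?P"
      then have "\<one>\<^bsub>R\<^esub> \<in> ?P" by auto
      then have "V \<subseteq> W" using VM by auto
      then show False using max_submodD(3)[OF WV] by blast
    qed
    fix J assume J: "ideal J R" "?P \<subseteq> J" "J \<subseteq> carrier R"
    show "J = ?P \<or> J = carrier R"
    proof (rule ccontr)
      assume ne: "\<not> (J = ?P \<or> J = carrier R)"
      then have "\<exists>j\<in>J. \<exists>v\<in>V. j \<odot>\<^bsub>M\<^esub> v \<notin> W" using J by blast
      then obtain e where e: "e \<in> J" "\<And>y. y \<in> set ys \<Longrightarrow> e \<odot>\<^bsub>M\<^esub> y \<ominus>\<^bsub>M\<^esub> y \<in> W"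
        using max_submod_unit[OF WV J(1) _ ys(1)] by blast
      have eR: "e \<in> carrier R" using e J by blast
      \<comment> \<open>The vectors that e - 1 sends into \<open>W\<close> form in general only a
        subspace, not an \<open>R\<close>-submodule; this is why \<open>ys\<close> is taken to span
        \<open>V\<close> over the field.\<close>
      let ?X = "{v \<in> carrier M. (e \<ominus>\<^bsub>R\<^esub> \<one>\<^bsub>R\<^esub>) \<odot>\<^bsub>M\<^esub> v \<in> W}"
      have "submodule ?X K MK"
      proof (rule KV.submodI)
        fix a v assume av: "a \<in> carrier K" "v \<in> ?X"
        have "(e \<ominus>\<^bsub>R\<^esub> \<one>\<^bsub>R\<^esub>) \<odot>\<^bsub>M\<^esub> ((a \<odot>\<^bsub>R\<^esub> \<one>\<^bsub>R\<^esub>) \<odot>\<^bsub>M\<^esub> v) = (a \<odot>\<^bsub>R\<^esub> \<one>\<^bsub>R\<^esub>) \<odot>\<^bsub>M\<^esub> ((e \<ominus>\<^bsub>R\<^esub> \<one>\<^bsub>R\<^esub>) \<odot>\<^bsub>M\<^esub> v)"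
          by (rule smult_scalar_commute) (use av eR in auto)
        then show "a \<odot>\<^bsub>MK\<^esub> v \<in> ?X" using av scalar_closed[OF av(1)] W'(4) by auto
      qed (use eR W'(2,3) in \<open>auto simp: RM.smult_r_distr\<close>)
      moreover have "set ys \<subseteq> ?X"
        using e(2) eR ys(1) VM by (auto simp: RM.smult_l_diff subset_iff)
      ultimately have "V \<subseteq> ?X" using span by blast
      then have "e \<ominus>\<^bsub>R\<^esub> \<one>\<^bsub>R\<^esub> \<in> ?P" using eR by auto
      then have "e \<ominus>\<^bsub>R\<^esub> \<one>\<^bsub>R\<^esub> \<in> J" using J(2) by blast
      then have "e \<ominus>\<^bsub>R\<^esub> (e \<ominus>\<^bsub>R\<^esub> \<one>\<^bsub>R\<^esub>) \<in> J"
        by (rule KA.submodD(6)[OF ideal_subspace[OF J(1)] e(1)])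
      moreover have "e \<ominus>\<^bsub>R\<^esub> (e \<ominus>\<^bsub>R\<^esub> \<one>\<^bsub>R\<^esub>) = \<one>\<^bsub>R\<^esub>"
        using eR by (simp add: KR.M.minus_eq KR.M.minus_add KR.M.a_assoc[symmetric] KR.M.r_neg)
      ultimately have "\<one>\<^bsub>R\<^esub> \<in> J" by simp
      then show False using ne J(1) ideal.one_imp_carrier by blast
    qed
  qed
  moreover have "fin_gen K (quot_module R ?P)"
  proof -
    let ?L = "{r \<in> carrier R. \<forall>y\<in>set ys. r \<odot>\<^bsub>M\<^esub> y = \<zero>\<^bsub>M\<^esub>}"
    have "?L \<subseteq> ?P"
    proof
      fix r assume r: "r \<in> ?L"
      let ?X = "{v \<in> carrier M. r \<odot>\<^bsub>M\<^esub> v = \<zero>\<^bsub>M\<^esub>}"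
      have "submodule ?X K MK"
        by (rule KV.submodI) (use r scalar_closed in \<open>auto simp: RM.smult_r_distr smult_scalar_commute\<close>)
      moreover have "set ys \<subseteq> ?X" using r ys(1) VM by blast
      ultimately have "V \<subseteq> ?X" using span by blast
      then show "r \<in> ?P" using r W'(2) by auto
    qed
    then have "KA.fin_codim ?P (carrier R)"
      by (rule KA.fin_codim_mono[OF codim_ann_list[OF fin V ys(1)]])
    then show ?thesis
      unfolding KA.quot_fin_gen_iff[OF ideal_subspace[OF PI]] KA.fin_codim_def .
  qed
  ultimately show ?thesis by (simp add: cfs_def)
qed

section \<open>Generalised weight spaces\<close>

abbreviation weight :: "'r set \<Rightarrow> 'm set" where "weight \<equiv> gen_weight_space R M"

lemma cfs_ideal:
  assumes "n \<in> cfs K R"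
  shows "ideal n R" "maximalideal n R"
  using assms maximalideal.axioms(1)[of n R] by (auto simp: cfs_def)

lemma weight_submod:
  assumes n: "ideal n R"
  shows "submodule (weight n) R M"
proof (rule RM.submodI)
  show "weight n \<subseteq> carrier M" by (auto simp: gen_weight_space_def)
  \<comment> \<open>\<open>gen_weight_space\<close> asks for a positive exponent, hence 1 rather
    than 0.\<close>
  have "\<forall>r\<in>ideal_pow R n 1. r \<odot>\<^bsub>M\<^esub> \<zero>\<^bsub>M\<^esub> = \<zero>\<^bsub>M\<^esub>"
    using ideal.Icarr[OF KR.U.ideal_pow_ideal[OF n, of 1]] by auto
  then show "\<zero>\<^bsub>M\<^esub> \<in> weight n" unfolding gen_weight_space_def by (auto intro!: exI[of _ 1])
next
  fix x y assume "x \<in> weight n" "y \<in> weight n"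
  then obtain i j where x: "x \<in> carrier M" "i > 0" "\<And>r. r \<in> ideal_pow R n i \<Longrightarrow> r \<odot>\<^bsub>M\<^esub> x = \<zero>\<^bsub>M\<^esub>"
    and y: "y \<in> carrier M" "j > 0" "\<And>r. r \<in> ideal_pow R n j \<Longrightarrow> r \<odot>\<^bsub>M\<^esub> y = \<zero>\<^bsub>M\<^esub>"
    unfolding gen_weight_space_def by blast
  have "r \<odot>\<^bsub>M\<^esub> (x \<oplus>\<^bsub>M\<^esub> y) = \<zero>\<^bsub>M\<^esub>" if r: "r \<in> ideal_pow R n (max i j)" for r
  proof -
    have "r \<in> ideal_pow R n i" "r \<in> ideal_pow R n j"
      using r KR.U.ideal_pow_antimono[OF n, of i "max i j"] KR.U.ideal_pow_antimono[OF n, of j "max i j"]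
      by auto
    then show ?thesis
      using x y ideal.Icarr[OF KR.U.ideal_pow_ideal[OF n] r] by (simp add: RM.smult_r_distr)
  qed
  then show "x \<oplus>\<^bsub>M\<^esub> y \<in> weight n"
    unfolding gen_weight_space_def using x y by (auto intro!: exI[of _ "max i j"])
next
  fix r x assume r: "r \<in> carrier R" and "x \<in> weight n"
  then obtain i where x: "x \<in> carrier M" "i > 0" "\<And>r. r \<in> ideal_pow R n i \<Longrightarrow> r \<odot>\<^bsub>M\<^esub> x = \<zero>\<^bsub>M\<^esub>"
    unfolding gen_weight_space_def by blast
  have "x \<in> {x \<in> carrier M. \<forall>r\<in>ideal_pow R n i. r \<odot>\<^bsub>M\<^esub> x \<in> {\<zero>\<^bsub>M\<^esub>}}" using x by simp
  then have "r \<odot>\<^bsub>M\<^esub> x \<in> {x \<in> carrier M. \<forall>r\<in>ideal_pow R n i. r \<odot>\<^bsub>M\<^esub> x \<in> {\<zero>\<^bsub>M\<^esub>}}"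
    by (rule RM.submodD(4)[OF colon_submod[OF KR.U.ideal_pow_ideal[OF n] RM.zero_submod] r])
  then show "r \<odot>\<^bsub>M\<^esub> x \<in> weight n" unfolding gen_weight_space_def using x(2) by auto
qed

text \<open>The largest exponent needed along a finite spanning list serves all of \<open>W\<close>,
  because the vectors killed by a fixed power form a subspace.\<close>

lemma uniform_nilpotent:
  assumes fin: "KV.findim W" and n: "ideal n R" and sub: "W \<subseteq> weight n"
  shows "\<exists>k. \<forall>w\<in>W. \<forall>r\<in>ideal_pow R n k. r \<odot>\<^bsub>M\<^esub> w = \<zero>\<^bsub>M\<^esub>"
proof -
  obtain ys where ys: "set ys \<subseteq> W" "W \<subseteq> lspan K MK ys" using fin by (auto simp: KV.findim_def)
  have "\<exists>k. \<forall>y\<in>set zs. \<forall>r\<in>ideal_pow R n k. r \<odot>\<^bsub>M\<^esub> y = \<zero>\<^bsub>M\<^esub>" if "set zs \<subseteq> W" for zs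
    using that
  proof (induction zs)
    case (Cons z zs)
    then obtain k where k: "\<And>y r. \<lbrakk>y \<in> set zs; r \<in> ideal_pow R n k\<rbrakk> \<Longrightarrow> r \<odot>\<^bsub>M\<^esub> y = \<zero>\<^bsub>M\<^esub>" by auto
    have "z \<in> weight n" using Cons.prems sub by auto
    then obtain l where l: "\<And>r. r \<in> ideal_pow R n l \<Longrightarrow> r \<odot>\<^bsub>M\<^esub> z = \<zero>\<^bsub>M\<^esub>"
      unfolding gen_weight_space_def by blast
    have "ideal_pow R n (max k l) \<subseteq> ideal_pow R n k" "ideal_pow R n (max k l) \<subseteq> ideal_pow R n l"
      by (simp_all add: KR.U.ideal_pow_antimono[OF n])
    then show ?case using k l by (intro exI[of _ "max k l"]) auto
  qed simp
  then obtain k where k: "\<forall>y\<in>set ys. \<forall>r\<in>ideal_pow R n k. r \<odot>\<^bsub>M\<^esub> y = \<zero>\<^bsub>M\<^esub>" using ys(1) by blast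
  let ?X = "{x \<in> carrier M. \<forall>r\<in>ideal_pow R n k. r \<odot>\<^bsub>M\<^esub> x \<in> {\<zero>\<^bsub>M\<^esub>}}"
  have "submodule ?X K MK"
    by (rule submod_subspace[OF colon_submod[OF KR.U.ideal_pow_ideal[OF n] RM.zero_submod]])
  moreover have "W \<subseteq> carrier M" using sub by (auto simp: gen_weight_space_def)
  then have "set ys \<subseteq> ?X" using k ys(1) by auto
  ultimately have "W \<subseteq> ?X" using KV.lspan_minimal[of ?X ys] ys(2) by (meson order_trans)
  then show ?thesis by (intro exI[of _ k]) auto
qed

text \<open>If m^k kills \<open>W\<close> and m sends \<open>V\<close> into \<open>W\<close>, then
  m^(k+1) kills \<open>V\<close>. The factor that \<open>ideal_pow\<close> adds stands on the right
  and so acts first, as this argument requires.\<close>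

lemma weight_extension:
  assumes fin: "KV.findim W" and m: "ideal m R" and sub: "W \<subseteq> weight m" and V: "V \<subseteq> carrier M"
    and mV: "\<And>r v. \<lbrakk>r \<in> m; v \<in> V\<rbrakk> \<Longrightarrow> r \<odot>\<^bsub>M\<^esub> v \<in> W"
  shows "V \<subseteq> weight m"
proof
  fix v assume v: "v \<in> V"
  have vM: "v \<in> carrier M" using v V by blast
  obtain k where k: "\<And>w r. \<lbrakk>w \<in> W; r \<in> ideal_pow R m k\<rbrakk> \<Longrightarrow> r \<odot>\<^bsub>M\<^esub> w = \<zero>\<^bsub>M\<^esub>"
    using uniform_nilpotent[OF fin m sub] by blast
  have P: "ideal (ideal_pow R m k) R" by (rule KR.U.ideal_pow_ideal[OF m])
  have "r \<odot>\<^bsub>M\<^esub> v = \<zero>\<^bsub>M\<^esub>" if "r \<in> ideal_prod R (ideal_pow R m k) m" for r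
    using that
  proof (induction r rule: ideal_prod.induct)
    case (prod i j)
    then have "(i \<otimes>\<^bsub>R\<^esub> j) \<odot>\<^bsub>M\<^esub> v = i \<odot>\<^bsub>M\<^esub> (j \<odot>\<^bsub>M\<^esub> v)"
      using ideal.Icarr[OF P, of i] ideal.Icarr[OF m, of j] vM by (simp add: RM.smult_assoc1)
    then show ?case using k[OF mV[OF prod(2) v] prod(1)] by simp
  next
    case (sum s t)
    then have "s \<in> carrier R" "t \<in> carrier R" using KR.U.ideal_prod_in_carrier[OF P m] by auto
    then show ?case using sum vM by (simp add: RM.smult_l_distr)
  qed
  then show "v \<in> weight m"
    unfolding gen_weight_space_def using vM by (auto intro!: exI[of _ "Suc k"])
qed

text \<open>Powers of n push \<open>x\<close> towards \<open>X\<close>. At the last power that does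
  not send \<open>x\<close> into \<open>X\<close> there is a vector a x outside \<open>X\<close>
  which n sends into \<open>X\<close>. The vectors of \<open>W\<close> that n sends into
  \<open>X\<close> form a submodule above \<open>X\<close>, now strictly larger, hence equal to
  \<open>W\<close>.\<close>

lemma weight_quotient:
  assumes XW: "max_submod X W" and n: "ideal n R" and x: "x \<in> W" "x \<in> weight n" "x \<notin> X"
    and r: "r \<in> n" and w: "w \<in> W"
  shows "r \<odot>\<^bsub>M\<^esub> w \<in> X"
proof -
  note X = max_submodD(1)[OF XW] and W = max_submodD(2)[OF XW]
  have xM: "x \<in> carrier M" using x(1) RM.submodD(1)[OF W] by blast
  let ?P = "\<lambda>k. \<forall>a\<in>ideal_pow R n k. a \<odot>\<^bsub>M\<^esub> x \<in> X"
  obtain l where "\<forall>r\<in>ideal_pow R n l. r \<odot>\<^bsub>M\<^esub> x = \<zero>\<^bsub>M\<^esub>"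
    using x(2) unfolding gen_weight_space_def by blast
  then have "?P l" using RM.submodD(2)[OF X] by simp
  then have "\<exists>k. ?P k" by (rule exI)
  then have P: "?P (LEAST k. ?P k)" by (rule LeastI_ex)
  \<comment> \<open>The least exponent is positive, since the zeroth power contains 1 and
    \<open>x\<close> is outside \<open>X\<close>; its predecessor \<open>k\<close> supplies the
    element \<open>a\<close>.\<close>
  have "\<not> ?P 0" using x(3) xM by (auto intro!: bexI[of _ "\<one>\<^bsub>R\<^esub>"])
  then have "(LEAST k. ?P k) \<noteq> 0" using P by metis
  then obtain k where k: "(LEAST k. ?P k) = Suc k" using not0_implies_Suc by blast
  then have "\<not> ?P k" using not_less_Least[of k ?P] by simp
  then obtain a where a: "a \<in> ideal_pow R n k" "a \<odot>\<^bsub>M\<^esub> x \<notin> X" by blast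
  have aR: "a \<in> carrier R" using ideal.Icarr[OF KR.U.ideal_pow_ideal[OF n] a(1)] .
  let ?Q = "{v \<in> carrier M. \<forall>j\<in>n. j \<odot>\<^bsub>M\<^esub> v \<in> X} \<inter> W"
  have Q: "submodule ?Q R M" by (rule RM.submod_Int[OF colon_submod[OF n X] W])
  have "X \<subseteq> ?Q"
    using RM.submodD(1)[OF X] RM.submodD(4)[OF X ideal.Icarr[OF n]] max_submodD(3)[OF XW] by blast
  then have "?Q = X \<or> ?Q = W" using max_submodD(4)[OF XW Q] by blast
  moreover have "a \<odot>\<^bsub>M\<^esub> x \<in> ?Q"
  proof -
    have "j \<odot>\<^bsub>M\<^esub> (a \<odot>\<^bsub>M\<^esub> x) \<in> X" if j: "j \<in> n" for j
    proof -
      have "(j \<otimes>\<^bsub>R\<^esub> a) \<odot>\<^bsub>M\<^esub> x \<in> X"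
        using P KR.U.ideal_mult_pow[OF n j a(1)] unfolding k by blast
      then show ?thesis using RM.smult_assoc1[OF ideal.Icarr[OF n j] aR xM] by simp
    qed
    then show ?thesis using aR xM RM.submodD(4)[OF W aR x(1)] by blast
  qed
  ultimately have "?Q = W" using a(2) by blast
  then show ?thesis using r w by blast
qed

text \<open>
  The quotient \<open>W/X\<close> is realised inside \<^typ>\<open>'r set\<close>, as \<^const>\<open>quasicommutative\<close> demands: fix
  \<open>w\<^sub>0 \<in> W - X\<close> and send \<open>x\<close> to the coset of all \<open>r\<close> with \<open>r w\<^sub>0 \<equiv> x\<close> modulo \<open>X\<close>.
\<close>

lemma simple_quotient:
  assumes XW: "max_submod X W" and n: "ideal n R"
    and nW: "\<And>r w. \<lbrakk>r \<in> n; w \<in> W\<rbrakk> \<Longrightarrow> r \<odot>\<^bsub>M\<^esub> w \<in> X"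
  obtains S :: "('r set, 'r set) module" and p where "simple_module (R Quot n) S"
    and "left_module R (inflate R n S)" and "linear_map R (M\<lparr>carrier := W\<rparr>) (inflate R n S) p"
    and "carrier (inflate R n S) \<subseteq> p ` W"
    and "\<And>x. x \<in> W \<Longrightarrow> p x = \<zero>\<^bsub>inflate R n S\<^esub> \<longleftrightarrow> x \<in> X"
proof -
  note X = max_submodD(1)[OF XW] and W = max_submodD(2)[OF XW]
  note X' = RM.submodD[OF X] and W' = RM.submodD[OF W]
  have WM: "\<And>x. x \<in> W \<Longrightarrow> x \<in> carrier M" using W'(1) by blast
  obtain w0 where w0: "w0 \<in> W" "w0 \<notin> X" using max_submodD(3)[OF XW] by blast
  have w0M: "w0 \<in> carrier M" using WM w0 by blast
  define p where "p x = {r \<in> carrier R. r \<odot>\<^bsub>M\<^esub> w0 \<ominus>\<^bsub>M\<^esub> x \<in> X}" for x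
  \<comment> \<open>By simplicity, \<open>w0\<close> generates \<open>W\<close> modulo
    \<open>X\<close>. Nonemptiness matters because the empty set could not tell different cosets
    apart in \<open>p_eq\<close>.\<close>
  have p_nonempty: "\<exists>r. r \<in> p x" if x: "x \<in> W" for x
  proof -
    let ?N = "{y \<oplus>\<^bsub>M\<^esub> z | y z. y \<in> {r \<odot>\<^bsub>M\<^esub> w0 | r. r \<in> carrier R} \<and> z \<in> X}"
    have N: "submodule ?N R M" by (rule RM.submod_sum[OF RM.cyclic_submod[OF w0M] X])
    have "X \<subseteq> ?N"
    proof
      fix z assume z: "z \<in> X"
      then have "\<zero>\<^bsub>M\<^esub> \<oplus>\<^bsub>M\<^esub> z \<in> ?N" using RM.submodD(2)[OF RM.cyclic_submod[OF w0M]] by blast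
      moreover have "\<zero>\<^bsub>M\<^esub> \<oplus>\<^bsub>M\<^esub> z = z" using z X'(1) by auto
      ultimately show "z \<in> ?N" by (simp only:)
    qed
    moreover have "?N \<subseteq> W"
    proof
      fix y assume "y \<in> ?N"
      then obtain r z where rz: "r \<in> carrier R" "z \<in> X" "y = r \<odot>\<^bsub>M\<^esub> w0 \<oplus>\<^bsub>M\<^esub> z" by blast
      have "z \<in> W" using rz(2) max_submodD(3)[OF XW] by blast
      then show "y \<in> W" using W'(3)[OF W'(4)[OF rz(1) w0(1)]] rz(3) by simp
    qed
    ultimately have "?N = X \<or> ?N = W" using max_submodD(4)[OF XW N] by blast
    moreover have "w0 \<in> ?N"
    proof -
      have "\<one>\<^bsub>R\<^esub> \<odot>\<^bsub>M\<^esub> w0 \<oplus>\<^bsub>M\<^esub> \<zero>\<^bsub>M\<^esub> \<in> ?N" using X'(2) KR.U.one_closed by blast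
      then show ?thesis using w0M by simp
    qed
    ultimately have "x \<in> ?N" using x w0(2) by blast
    then obtain r z where rz: "r \<in> carrier R" "z \<in> X" "x = r \<odot>\<^bsub>M\<^esub> w0 \<oplus>\<^bsub>M\<^esub> z" by blast
    have zM: "z \<in> carrier M" "r \<odot>\<^bsub>M\<^esub> w0 \<in> carrier M" using rz X'(1) w0M by auto
    have "r \<odot>\<^bsub>M\<^esub> w0 \<ominus>\<^bsub>M\<^esub> x = \<ominus>\<^bsub>M\<^esub> z"
      using zM by (simp add: rz(3) RM.M.minus_eq RM.M.minus_add RM.M.a_assoc[symmetric] RM.M.r_neg)
    then have "r \<in> p x" using X'(5)[OF rz(2)] rz(1) by (simp add: p_def)
    then show ?thesis by blast
  qed
  have p_mono: "p x \<subseteq> p y" if "x \<in> W" "y \<in> W" "x \<ominus>\<^bsub>M\<^esub> y \<in> X" for x y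
  proof
    fix r assume r: "r \<in> p x"
    then have "(r \<odot>\<^bsub>M\<^esub> w0 \<ominus>\<^bsub>M\<^esub> x) \<oplus>\<^bsub>M\<^esub> (x \<ominus>\<^bsub>M\<^esub> y) \<in> X" using X'(3) that(3) by (simp add: p_def)
    moreover have "(r \<odot>\<^bsub>M\<^esub> w0 \<ominus>\<^bsub>M\<^esub> x) \<oplus>\<^bsub>M\<^esub> (x \<ominus>\<^bsub>M\<^esub> y) = r \<odot>\<^bsub>M\<^esub> w0 \<ominus>\<^bsub>M\<^esub> y"
    proof -
      have "r \<odot>\<^bsub>M\<^esub> w0 \<in> carrier M" "x \<in> carrier M" "y \<in> carrier M" using r that WM w0M by (auto simp: p_def)
      then show ?thesis
        by (simp add: RM.M.minus_eq RM.M.a_assoc) (simp add: RM.M.a_assoc[symmetric] RM.M.l_neg)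
    qed
    ultimately show "r \<in> p y" using r by (simp add: p_def)
  qed
  have p_eq: "p x = p y \<longleftrightarrow> x \<ominus>\<^bsub>M\<^esub> y \<in> X" if xy: "x \<in> W" "y \<in> W" for x y
  proof
    have xyM: "x \<in> carrier M" "y \<in> carrier M" using xy WM by auto
    {
      assume "x \<ominus>\<^bsub>M\<^esub> y \<in> X"
      moreover have "\<ominus>\<^bsub>M\<^esub> (x \<ominus>\<^bsub>M\<^esub> y) = y \<ominus>\<^bsub>M\<^esub> x"
        using xyM by (simp add: RM.M.minus_eq RM.M.minus_add RM.M.a_comm)
      ultimately have "y \<ominus>\<^bsub>M\<^esub> x \<in> X" using X'(5) by metis
      then show "p x = p y" using p_mono xy \<open>x \<ominus>\<^bsub>M\<^esub> y \<in> X\<close> by blast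
    }
    assume eq: "p x = p y"
    obtain r where r: "r \<in> p x" using p_nonempty[OF xy(1)] by blast
    then have "r \<in> p y" using eq by simp
    then have "(r \<odot>\<^bsub>M\<^esub> w0 \<ominus>\<^bsub>M\<^esub> y) \<ominus>\<^bsub>M\<^esub> (r \<odot>\<^bsub>M\<^esub> w0 \<ominus>\<^bsub>M\<^esub> x) \<in> X" using r X'(6) by (simp add: p_def)
    moreover have "(r \<odot>\<^bsub>M\<^esub> w0 \<ominus>\<^bsub>M\<^esub> y) \<ominus>\<^bsub>M\<^esub> (r \<odot>\<^bsub>M\<^esub> w0 \<ominus>\<^bsub>M\<^esub> x) = x \<ominus>\<^bsub>M\<^esub> y"
    proof -
      define t where "t = r \<odot>\<^bsub>M\<^esub> w0"
      have tM: "t \<in> carrier M" using r w0M by (simp add: p_def t_def)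
      have "(t \<ominus>\<^bsub>M\<^esub> y) \<ominus>\<^bsub>M\<^esub> (t \<ominus>\<^bsub>M\<^esub> x) = (t \<ominus>\<^bsub>M\<^esub> t) \<oplus>\<^bsub>M\<^esub> (x \<ominus>\<^bsub>M\<^esub> y)"
        using tM xyM by (simp add: RM.M.minus_eq RM.M.minus_add RM.M.add.m_ac)
      then show ?thesis using tM xyM by (simp add: t_def[symmetric] RM.M.minus_eq RM.M.r_neg)
    qed
    ultimately show "x \<ominus>\<^bsub>M\<^esub> y \<in> X" by simp
  qed
  interpret n: ideal n R by (rule n)
  define h where "h r = n +>\<^bsub>R\<^esub> r" for r
  have h: "h \<in> ring_hom R (R Quot n)" using n.rcos_ring_hom by (simp add: h_def[abs_def])
  have h_eq: "r \<ominus>\<^bsub>R\<^esub> s \<in> n" if "r \<in> carrier R" "s \<in> carrier R" "h r = h s" for r s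
    using KA.coset_eq_iff[OF ideal_subspace[OF n]] that by (simp add: h_def)
  have h_surj: "carrier (R Quot n) \<subseteq> h ` carrier R"
    by (auto simp: FactRing_def A_RCOSETS_def' a_r_coset_def' h_def)
  \<comment> \<open>The operations of \<open>S\<close> act on sets, so they are defined through
    chosen representatives; \<open>S_add\<close> and \<open>S_smult\<close> show that the choice is
    immaterial.\<close>
  define rep where "rep A = (SOME x. x \<in> W \<and> p x = A)" for A
  define repR where "repR C = (SOME r. r \<in> carrier R \<and> h r = C)" for C
  have rep: "rep (p x) \<in> W" "p (rep (p x)) = p x" if "x \<in> W" for x
    using someI[of "\<lambda>y. y \<in> W \<and> p y = p x" x] that by (auto simp: rep_def)
  have repR: "repR (h r) \<in> carrier R" "h (repR (h r)) = h r" if "r \<in> carrier R" for r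
    using someI[of "\<lambda>s. s \<in> carrier R \<and> h s = h r" r] that by (auto simp: repR_def)
  define S :: "('r set, 'r set) module" where "S = \<lparr>carrier = p ` W, monoid.mult = undefined,
    one = undefined, ring.zero = p \<zero>\<^bsub>M\<^esub>, ring.add = (\<lambda>A B. p (rep A \<oplus>\<^bsub>M\<^esub> rep B)),
    smult = (\<lambda>C A. p (repR C \<odot>\<^bsub>M\<^esub> rep A))\<rparr>"
  have S_simps: "carrier S = p ` W" "\<zero>\<^bsub>S\<^esub> = p \<zero>\<^bsub>M\<^esub>" by (simp_all add: S_def)
  have S_add: "p (x \<oplus>\<^bsub>M\<^esub> y) = p x \<oplus>\<^bsub>S\<^esub> p y" if xy: "x \<in> W" "y \<in> W" for x y
  proof -
    let ?x = "rep (p x)" and ?y = "rep (p y)"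
    have c: "?x \<in> W" "?y \<in> W" using rep(1) xy by auto
    have "x \<ominus>\<^bsub>M\<^esub> ?x \<in> X" "y \<ominus>\<^bsub>M\<^esub> ?y \<in> X"
      using p_eq[OF xy(1) c(1)] p_eq[OF xy(2) c(2)] rep(2)[OF xy(1)] rep(2)[OF xy(2)] by auto
    then have "(x \<ominus>\<^bsub>M\<^esub> ?x) \<oplus>\<^bsub>M\<^esub> (y \<ominus>\<^bsub>M\<^esub> ?y) \<in> X" by (rule X'(3))
    moreover have "(x \<ominus>\<^bsub>M\<^esub> ?x) \<oplus>\<^bsub>M\<^esub> (y \<ominus>\<^bsub>M\<^esub> ?y) = (x \<oplus>\<^bsub>M\<^esub> y) \<ominus>\<^bsub>M\<^esub> (?x \<oplus>\<^bsub>M\<^esub> ?y)"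
      using xy[THEN WM] c[THEN WM] by (simp add: RM.M.minus_eq RM.M.minus_add RM.M.add.m_ac)
    ultimately have "p (x \<oplus>\<^bsub>M\<^esub> y) = p (?x \<oplus>\<^bsub>M\<^esub> ?y)"
      using p_eq[OF W'(3)[OF xy] W'(3)[OF c]] by simp
    then show ?thesis by (simp add: S_def)
  qed
  have S_smult: "p (r \<odot>\<^bsub>M\<^esub> x) = h r \<odot>\<^bsub>S\<^esub> p x" if r: "r \<in> carrier R" and x: "x \<in> W" for r x
  proof -
    let ?x = "rep (p x)" and ?r = "repR (h r)"
    have c: "?x \<in> W" "?r \<in> carrier R" using rep(1)[OF x] repR(1)[OF r] by auto
    have "x \<ominus>\<^bsub>M\<^esub> ?x \<in> X" using p_eq[OF x c(1)] rep(2)[OF x] by auto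
    then have "r \<odot>\<^bsub>M\<^esub> (x \<ominus>\<^bsub>M\<^esub> ?x) \<in> X" by (rule X'(4)[OF r])
    \<comment> \<open>Here \<open>nW\<close> makes the action depend only on the coset of
      \<open>r\<close> modulo \<open>n\<close>.\<close>
    moreover have "(r \<ominus>\<^bsub>R\<^esub> ?r) \<odot>\<^bsub>M\<^esub> ?x \<in> X"
      using nW[OF h_eq[OF r c(2)] c(1)] repR(2)[OF r] by simp
    ultimately have "r \<odot>\<^bsub>M\<^esub> (x \<ominus>\<^bsub>M\<^esub> ?x) \<oplus>\<^bsub>M\<^esub> (r \<ominus>\<^bsub>R\<^esub> ?r) \<odot>\<^bsub>M\<^esub> ?x \<in> X" by (rule X'(3))
    moreover have "r \<odot>\<^bsub>M\<^esub> (x \<ominus>\<^bsub>M\<^esub> ?x) \<oplus>\<^bsub>M\<^esub> (r \<ominus>\<^bsub>R\<^esub> ?r) \<odot>\<^bsub>M\<^esub> ?x = r \<odot>\<^bsub>M\<^esub> x \<ominus>\<^bsub>M\<^esub> ?r \<odot>\<^bsub>M\<^esub> ?x"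
    proof -
      have m: "r \<odot>\<^bsub>M\<^esub> x \<in> carrier M" "r \<odot>\<^bsub>M\<^esub> ?x \<in> carrier M" "?r \<odot>\<^bsub>M\<^esub> ?x \<in> carrier M"
        using r c x WM by auto
      have "r \<odot>\<^bsub>M\<^esub> (x \<ominus>\<^bsub>M\<^esub> ?x) \<oplus>\<^bsub>M\<^esub> (r \<ominus>\<^bsub>R\<^esub> ?r) \<odot>\<^bsub>M\<^esub> ?x
        = (r \<odot>\<^bsub>M\<^esub> x \<ominus>\<^bsub>M\<^esub> r \<odot>\<^bsub>M\<^esub> ?x) \<oplus>\<^bsub>M\<^esub> (r \<odot>\<^bsub>M\<^esub> ?x \<ominus>\<^bsub>M\<^esub> ?r \<odot>\<^bsub>M\<^esub> ?x)"
        using r c x WM by (simp add: RM.smult_r_diff RM.smult_l_diff)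
      also have "\<dots> = r \<odot>\<^bsub>M\<^esub> x \<ominus>\<^bsub>M\<^esub> ?r \<odot>\<^bsub>M\<^esub> ?x"
        using m by (simp add: RM.M.minus_eq RM.M.a_assoc) (simp add: RM.M.a_assoc[symmetric] RM.M.l_neg)
      finally show ?thesis .
    qed
    ultimately have "p (r \<odot>\<^bsub>M\<^esub> x) = p (?r \<odot>\<^bsub>M\<^esub> ?x)"
      using p_eq[OF W'(4)[OF r x] W'(4)[OF c(2,1)]] by simp
    then show ?thesis by (simp add: S_def)
  qed
  have MW: "left_module R (M\<lparr>carrier := W\<rparr>)" by (rule RM.submod_left_module[OF W])
  have LS: "left_module (R Quot n) S"
    by (rule left_module_image[OF MW n.quotient_is_ring _ _ _ h h_surj, of S p])
      (auto simp: S_simps S_add S_smult)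
  have inf: "carrier (inflate R n S) = p ` W" "\<zero>\<^bsub>inflate R n S\<^esub> = p \<zero>\<^bsub>M\<^esub>"
    "A \<oplus>\<^bsub>inflate R n S\<^esub> B = A \<oplus>\<^bsub>S\<^esub> B" "r \<odot>\<^bsub>inflate R n S\<^esub> A = h r \<odot>\<^bsub>S\<^esub> A" for A B r
    by (simp_all add: inflate_def S_simps h_def)
  have id_hom: "(\<lambda>r. r) \<in> ring_hom R R" by (auto simp: ring_hom_def)
  have LI: "left_module R (inflate R n S)"
    by (rule left_module_image[OF MW KR.U.ring_axioms _ _ _ id_hom, of "inflate R n S" p])
      (auto simp: inf S_add S_smult)
  have lin: "linear_map R (M\<lparr>carrier := W\<rparr>) (inflate R n S) p"
    unfolding linear_map_def by (auto simp: inf S_add S_smult)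
  have p0: "p x = p \<zero>\<^bsub>M\<^esub> \<longleftrightarrow> x \<in> X" if "x \<in> W" for x
    using p_eq[OF that W'(2)] WM[OF that] by (simp add: RM.M.minus_eq RM.M.a_inv_zero)
  have "N = {\<zero>\<^bsub>S\<^esub>} \<or> N = carrier S" if N: "submodule N (R Quot n) S" for N
  proof -
    interpret LS: left_module "R Quot n" S by (rule LS)
    note N' = LS.submodD[OF N]
    have hR: "h r \<in> carrier (R Quot n)" if "r \<in> carrier R" for r using ring_hom_closed[OF h that] .
    \<comment> \<open>The preimage under \<open>p\<close> carries a submodule of \<open>S\<close> to
      one between \<open>X\<close> and \<open>W\<close>, where maximality of \<open>X\<close>
      decides.\<close>
    let ?Z = "{x \<in> W. p x \<in> N}"
    have Z: "submodule ?Z R M"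
      by (rule RM.submodI) (use W' N' hR in \<open>auto simp: S_simps S_add S_smult\<close>)
    have "X \<subseteq> ?Z"
    proof
      fix x assume x: "x \<in> X"
      then have "x \<in> W" using max_submodD(3)[OF XW] by blast
      then show "x \<in> ?Z" using p0[of x] x N'(2) by (simp add: S_simps)
    qed
    then consider "?Z = X" | "?Z = W" using max_submodD(4)[OF XW Z] by blast
    then show ?thesis
    proof cases
      case 1
      have "A = \<zero>\<^bsub>S\<^esub>" if A: "A \<in> N" for A
      proof -
        obtain x where x: "x \<in> W" "A = p x" using A N'(1) by (auto simp: S_simps)
        then have "x \<in> X" using A 1 by blast
        then show ?thesis using x p0 by (simp add: S_simps)
      qed
      then show ?thesis using N'(2) by blast
    next
      case 2
      then have "p ` W \<subseteq> N" by blast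
      then have "N = carrier S" using N'(1) unfolding S_simps by (rule equalityI[rotated])
      then show ?thesis by (rule disjI2)
    qed
  qed
  moreover have "carrier S \<noteq> {\<zero>\<^bsub>S\<^esub>}" using p0[OF w0(1)] w0 by (auto simp: S_simps)
  ultimately have "simple_module (R Quot n) S" using LS by (simp add: simple_module_def)
  then show ?thesis using that[of S p] LI lin p0 by (simp add: inf)
qed

section \<open>Spanning finite-dimensional modules by weight vectors\<close>

text \<open>\<open>V/W\<close> and \<open>W/X\<close> are realised by simple modules over
  \<open>R Quot m\<close> and \<open>R Quot n\<close>, so quasicommutativity applies to this pair.
  Splitting along a quotient map of \<open>W\<close> with kernel \<open>X\<close> yields
  \<open>V'\<close>.\<close>

lemma quasicommutative_split:
  assumes qc: "quasicommutative K R" and mn: "m \<in> cfs K R" "n \<in> cfs K R" "m \<noteq> n"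
    and WV: "max_submod W V" and XW: "max_submod X W"
    and mV: "\<And>r v. \<lbrakk>r \<in> m; v \<in> V\<rbrakk> \<Longrightarrow> r \<odot>\<^bsub>M\<^esub> v \<in> W"
    and nW: "\<And>r w. \<lbrakk>r \<in> n; w \<in> W\<rbrakk> \<Longrightarrow> r \<odot>\<^bsub>M\<^esub> w \<in> X"
  shows "\<exists>V'. submodule V' R M \<and> V' \<subseteq> V \<and> (\<forall>x\<in>V. \<exists>y\<in>V'. x \<ominus>\<^bsub>M\<^esub> y \<in> W) \<and> V' \<inter> W = X"
proof -
  obtain S :: "('r set, 'r set) module" and p where S: "simple_module (R Quot m) S"
    "left_module R (inflate R m S)" "linear_map R (M\<lparr>carrier := V\<rparr>) (inflate R m S) p"
    "carrier (inflate R m S) \<subseteq> p ` V" "\<And>x. x \<in> V \<Longrightarrow> p x = \<zero>\<^bsub>inflate R m S\<^esub> \<longleftrightarrow> x \<in> W"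
    using simple_quotient[OF WV cfs_ideal(1)[OF mn(1)] mV] by blast
  obtain T :: "('r set, 'r set) module" and q where T: "simple_module (R Quot n) T"
    "left_module R (inflate R n T)" "linear_map R (M\<lparr>carrier := W\<rparr>) (inflate R n T) q"
    "carrier (inflate R n T) \<subseteq> q ` W" "\<And>x. x \<in> W \<Longrightarrow> q x = \<zero>\<^bsub>inflate R n T\<^esub> \<longleftrightarrow> x \<in> X"
    using simple_quotient[OF XW cfs_ideal(1)[OF mn(2)] nW] by blast
  have ext: "trivial_group (Ext1 R (inflate R m S) (inflate R n T))"
    using qc mn S(1) T(1) unfolding quasicommutative_def by blast
  have WV': "W \<subseteq> V" and XW': "X \<subseteq> W" using max_submodD(3)[OF WV] max_submodD(3)[OF XW] by auto
  have "{x \<in> W. q x = \<zero>\<^bsub>inflate R n T\<^esub>} = X" using T(5) XW' by blast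
  then show ?thesis
    using RM.trivial_Ext1_split[OF S(2) T(2) ext max_submodD(2,1)[OF WV] WV' S(3,4,5) T(3,4)] by simp
qed

text \<open>An arbitrary \<open>Z\<close> replaces the sum of the weight spaces so that the
  induction hypothesis for \<open>W\<close> serves two purposes: with \<open>Z\<close> it places
  \<open>W\<close> inside \<open>Z\<close>, and with \<open>X\<close>, contrapositively, it finds a
  weight vector of \<open>W\<close> outside \<open>X\<close>.\<close>

lemma findim_weight_span:
  assumes qc: "quasicommutative K R" and "KV.findim V" "submodule V R M" "submodule Z R M"
    and "\<And>n. n \<in> cfs K R \<Longrightarrow> V \<inter> weight n \<subseteq> Z"
  shows "V \<subseteq> Z"
  using assms(2-)
proof (induction "KV.rank V" arbitrary: V Z rule: less_induct)
  case less
  note fin = \<open>KV.findim V\<close> and V = \<open>submodule V R M\<close> and Z = \<open>submodule Z R M\<close>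
  note V' = RM.submodD[OF V]
  show ?case
  proof (cases "V = {\<zero>\<^bsub>M\<^esub>}")
    case True
    then show ?thesis using RM.submodD(2)[OF Z] by simp
  next
    case False
    then have "{\<zero>\<^bsub>M\<^esub>} \<subset> V" using V'(2) by blast
    then obtain W where WV: "max_submod W V"
      using ex_max_submod[OF fin V RM.zero_submod] by blast
    note W = max_submodD(1)[OF WV]
    have WV': "W \<subset> V" by (rule max_submodD(3)[OF WV])
    define m where "m = {r \<in> carrier R. \<forall>v\<in>V. r \<odot>\<^bsub>M\<^esub> v \<in> W}"
    have m: "m \<in> cfs K R" unfolding m_def by (rule ann_quotient_cfs[OF WV fin])
    have mV: "r \<odot>\<^bsub>M\<^esub> v \<in> W" if "r \<in> m" "v \<in> V" for r v using that by (simp add: m_def)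
    have W_fin: "KV.findim W" "KV.rank W < KV.rank V"
      using KV.rank_mono[OF fin submod_subspace[OF W] WV'] by auto
    have W_span: "W \<subseteq> Y" if "submodule Y R M" "\<And>n. n \<in> cfs K R \<Longrightarrow> W \<inter> weight n \<subseteq> Y" for Y
      by (rule less.hyps[OF W_fin(2,1) W that])
    have W_Z: "W \<subseteq> Z"
    proof (rule W_span[OF Z])
      fix n assume "n \<in> cfs K R"
      then show "W \<inter> weight n \<subseteq> Z" using less.prems(4)[of n] WV' by blast
    qed
    show ?thesis
    proof (cases "W \<subseteq> weight m")
      case True
      then have "V \<subseteq> weight m"
        by (rule weight_extension[OF W_fin(1) cfs_ideal(1)[OF m] _ V'(1) mV])
      then show ?thesis using less.prems(4)[OF m] by blast
    next
      case False
      have Y: "submodule (W \<inter> weight m) R M"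
        by (rule RM.submod_Int[OF W weight_submod[OF cfs_ideal(1)[OF m]]])
      \<comment> \<open>Since \<open>X\<close> is chosen to contain all weight vectors of
        \<open>W\<close> for \<open>m\<close>, a weight vector outside \<open>X\<close> must belong
        to another ideal \<open>n\<close>.\<close>
      have "W \<inter> weight m \<subset> W" using False by blast
      then obtain X where XW: "max_submod X W" and X: "W \<inter> weight m \<subseteq> X"
        using ex_max_submod[OF W_fin(1) W Y] by blast
      have XW': "X \<subset> W" by (rule max_submodD(3)[OF XW])
      then have "\<not> W \<subseteq> X" by blast
      then obtain n where n: "n \<in> cfs K R" "\<not> W \<inter> weight n \<subseteq> X"
        using W_span[OF max_submodD(1)[OF XW]] by blast
      then obtain x where x: "x \<in> W" "x \<in> weight n" "x \<notin> X" by blast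
      have "m \<noteq> n" using n(2) X by blast
      moreover have nW: "r \<odot>\<^bsub>M\<^esub> w \<in> X" if "r \<in> n" "w \<in> W" for r w
        by (rule weight_quotient[OF XW cfs_ideal(1)[OF n(1)] x that])
      ultimately obtain V' where V': "submodule V' R M" "V' \<subseteq> V"
        "\<And>x. x \<in> V \<Longrightarrow> \<exists>y\<in>V'. x \<ominus>\<^bsub>M\<^esub> y \<in> W" "V' \<inter> W = X"
        using quasicommutative_split[OF qc m n(1) _ WV XW mV nW] by blast
      \<comment> \<open>\<open>V'\<close> meets \<open>W\<close> only in \<open>X\<close>, which is
        smaller than \<open>W\<close>; so \<open>V'\<close> is proper and the induction hypothesis
        covers it.\<close>
      have "V' \<noteq> V" using V'(4) WV' XW' by blast
      then have V'V: "V' \<subset> V" using V'(2) by blast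
      have "V' \<subseteq> Z"
      proof (rule less.hyps[OF _ _ V'(1) Z])
        show "KV.rank V' < KV.rank V" "KV.findim V'"
          using KV.rank_mono[OF fin submod_subspace[OF V'(1)] V'V] by auto
        fix n assume "n \<in> cfs K R"
        then show "V' \<inter> weight n \<subseteq> Z" using less.prems(4)[of n] V'(2) by blast
      qed
      show ?thesis
      proof
        fix v assume v: "v \<in> V"
        then obtain y where y: "y \<in> V'" "v \<ominus>\<^bsub>M\<^esub> y \<in> W" using V'(3) by blast
        have vy: "v \<in> carrier M" "y \<in> carrier M" using v y(1) V'(2) RM.submodD(1)[OF V] by auto
        have "(v \<ominus>\<^bsub>M\<^esub> y) \<oplus>\<^bsub>M\<^esub> y \<in> Z"
          using RM.submodD(3)[OF Z] y W_Z \<open>V' \<subseteq> Z\<close> by blast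
        moreover have "(v \<ominus>\<^bsub>M\<^esub> y) \<oplus>\<^bsub>M\<^esub> y = v"
          using vy by (simp add: RM.M.minus_eq RM.M.a_assoc RM.M.l_neg)
        ultimately show "v \<in> Z" by simp
      qed
    qed
  qed
qed

section \<open>Independence of weight spaces\<close>

text \<open>The element \<open>e\<close> is 1 modulo a power of \<open>i\<close> that kills
  \<open>h i\<close> and lies in the powers killing the other terms. Applied to the vanishing sum it
  leaves \<open>h i\<close> alone, which is therefore zero.\<close>

lemma weights_independent:
  assumes A: "finite A" "A \<subseteq> cfs K R" and h: "\<And>i. i \<in> A \<Longrightarrow> h i \<in> weight i"
    and zero: "finsum M h A = \<zero>\<^bsub>M\<^esub>" and i: "i \<in> A"
  shows "h i = \<zero>\<^bsub>M\<^esub>"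
proof -
  have "\<exists>k. \<forall>r\<in>ideal_pow R j k. r \<odot>\<^bsub>M\<^esub> h j = \<zero>\<^bsub>M\<^esub>" if "j \<in> A" for j
    using h[OF that] unfolding gen_weight_space_def by blast
  then obtain k where k: "\<And>j r. \<lbrakk>j \<in> A; r \<in> ideal_pow R j (k j)\<rbrakk> \<Longrightarrow> r \<odot>\<^bsub>M\<^esub> h j = \<zero>\<^bsub>M\<^esub>" by metis
  have hM: "h j \<in> carrier M" if "j \<in> A" for j using h[OF that] by (simp add: gen_weight_space_def)
  have idl: "ideal j R" "maximalideal j R" if "j \<in> A" for j using that A(2) cfs_ideal by blast+
  let ?J = "\<lambda>j. ideal_pow R j (k j)"
  have idp: "ideal (?J j) R" if "j \<in> A" for j by (rule KR.U.ideal_pow_ideal[OF idl(1)[OF that]])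
  \<comment> \<open>Comaximality of \<open>i\<close> and \<open>j\<close> is raised to powers one
    side at a time, with a change of sides in between.\<close>
  have co: "KR.U.comaximal (?J i) (?J j)" if j: "j \<in> A - {i}" for j
  proof -
    have jA: "j \<in> A" and ne: "i \<noteq> j" using j by auto
    have "KR.U.comaximal i (?J j)"
      by (rule KR.U.comaximal_pow[OF idl(1)[OF i] idl(1)[OF jA] KR.U.maximal_comaximal[OF idl(2)[OF i] idl(2)[OF jA] ne]])
    then have "KR.U.comaximal (?J j) i" by (rule KR.U.comaximal_sym[OF idp[OF jA]])
    then have "KR.U.comaximal (?J j) (?J i)" by (rule KR.U.comaximal_pow[OF idp[OF jA] idl(1)[OF i]])
    then show ?thesis by (rule KR.U.comaximal_sym[OF idp[OF i]])
  qed
  have "\<exists>e\<in>carrier R. \<one>\<^bsub>R\<^esub> \<ominus>\<^bsub>R\<^esub> e \<in> ?J i \<and> (\<forall>j\<in>A - {i}. e \<in> ?J j)"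
    by (rule KR.U.comaximal_Inter[OF idp[OF i]]) (use A(1) idp co in auto)
  then obtain e where e: "e \<in> carrier R" "\<one>\<^bsub>R\<^esub> \<ominus>\<^bsub>R\<^esub> e \<in> ?J i" "\<And>j. j \<in> A - {i} \<Longrightarrow> e \<in> ?J j"
    by blast
  have fin: "finite (A - {i})" "i \<notin> A - {i}" "A = insert i (A - {i})" using A(1) i by auto
  have eh: "(\<lambda>j. e \<odot>\<^bsub>M\<^esub> h j) \<in> A - {i} \<rightarrow> carrier M" using e(1) hM by auto
  have "\<zero>\<^bsub>M\<^esub> = e \<odot>\<^bsub>M\<^esub> finsum M h A" using e(1) zero by simp
  also have "\<dots> = (\<Oplus>\<^bsub>M\<^esub>j\<in>A. e \<odot>\<^bsub>M\<^esub> h j)" by (rule RM.finsum_smult) (use e(1) hM in auto)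
  also have "\<dots> = e \<odot>\<^bsub>M\<^esub> h i \<oplus>\<^bsub>M\<^esub> (\<Oplus>\<^bsub>M\<^esub>j\<in>A - {i}. e \<odot>\<^bsub>M\<^esub> h j)"
    by (subst fin(3)) (rule RM.M.finsum_insert[OF fin(1,2) eh], use e(1) hM i in auto)
  also have "(\<Oplus>\<^bsub>M\<^esub>j\<in>A - {i}. e \<odot>\<^bsub>M\<^esub> h j) = \<zero>\<^bsub>M\<^esub>"
    by (rule RM.M.add.finprod_one_eqI) (use k e(3) in blast)
  finally have e0: "e \<odot>\<^bsub>M\<^esub> h i = \<zero>\<^bsub>M\<^esub>" using e(1) hM[OF i] by simp
  have "h i \<ominus>\<^bsub>M\<^esub> e \<odot>\<^bsub>M\<^esub> h i = \<zero>\<^bsub>M\<^esub>"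
    using k[OF i e(2)] e(1) hM[OF i] by (simp add: RM.smult_l_diff)
  then show ?thesis using e0 hM[OF i] by (simp add: RM.M.minus_eq RM.M.a_inv_zero)
qed

section \<open>Finite dimension from the Noetherian condition\<close>

text \<open>By induction it suffices that n^k is finite dimensional modulo n^(k+1). If
  \<open>as\<close> generates n^k as a left ideal and \<open>fs\<close> spans \<open>R\<close>
  modulo n, the products f a span this layer, because n times an element of n^k lies in
  n^(k+1).\<close>

lemma ideal_pow_fin_codim:
  assumes noeth: "noetherian_module R (left_regular R)" and n: "n \<in> cfs K R"
  shows "KA.fin_codim (ideal_pow R n k) (carrier R)"
proof (induction k)
  case 0
  show ?case
    unfolding KA.fin_codim_def by (intro exI[of _ "[]"]) (auto simp: KR.M.minus_eq KR.M.a_inv_zero)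
next
  case (Suc k)
  have nI: "ideal n R" by (rule cfs_ideal(1)[OF n])
  let ?P = "ideal_pow R n k" and ?Q = "ideal_pow R n (Suc k)"
  have P: "ideal ?P R" and Q: "ideal ?Q R" by (rule KR.U.ideal_pow_ideal[OF nI])+
  have PR: "?P \<subseteq> carrier R" and QR: "?Q \<subseteq> carrier R"
    using KA.submodD(1)[OF ideal_subspace[OF P]] KA.submodD(1)[OF ideal_subspace[OF Q]] by auto
  obtain as where as: "set as \<subseteq> ?P" "?P \<subseteq> lspan R (left_regular R) as"
    using noeth RL.submod_fin_gen_iff[OF ideal_left_submod[OF P]] ideal_left_submod[OF P]
    unfolding noetherian_module_def by blast
  have asR: "set as \<subseteq> carrier R" using as(1) PR by blast
  have "fin_gen K (quot_module R n)" using n by (simp add: cfs_def)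
  then obtain fs where fs: "set fs \<subseteq> carrier R"
    "\<And>x. x \<in> carrier R \<Longrightarrow> \<exists>y\<in>lspan K R fs. x \<ominus>\<^bsub>R\<^esub> y \<in> n"
    unfolding KA.quot_fin_gen_iff[OF ideal_subspace[OF nI]] by blast
  let ?fa = "concat (map (\<lambda>a. map (\<lambda>f. f \<otimes>\<^bsub>R\<^esub> a) fs) as)"
  have faR: "set ?fa \<subseteq> carrier R" using fs(1) asR by auto
  let ?T = "{y \<oplus>\<^bsub>R\<^esub> z | y z. y \<in> lspan K R ?fa \<and> z \<in> ?Q}"
  have T: "submodule ?T K R" by (rule KA.submod_sum[OF KA.lspan_submod[OF faR] ideal_subspace[OF Q]])
  have LR: "lspan K R xs \<subseteq> carrier R" if "set xs \<subseteq> carrier R" for xs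
    by (rule KA.submodD(1)[OF KA.lspan_submod[OF that]])
  \<comment> \<open>The coefficient \<open>r\<close> is replaced by its approximation
    \<open>y\<close> in the span of \<open>fs\<close>; the error (r - y) a falls into the next
    power.\<close>
  have ra: "r \<otimes>\<^bsub>R\<^esub> a \<in> ?T" if r: "r \<in> carrier R" and a: "a \<in> set as" for r a
  proof -
    obtain y where y: "y \<in> lspan K R fs" "r \<ominus>\<^bsub>R\<^esub> y \<in> n" using fs(2)[OF r] by blast
    have aR: "a \<in> carrier R" and yR: "y \<in> carrier R" using a asR y(1) LR[OF fs(1)] by auto
    have "y \<otimes>\<^bsub>R\<^esub> a \<in> (\<lambda>f. f \<otimes>\<^bsub>R\<^esub> a) ` lspan K R fs" using y(1) by blast
    then have "y \<otimes>\<^bsub>R\<^esub> a \<in> lspan K R (map (\<lambda>f. f \<otimes>\<^bsub>R\<^esub> a) fs)"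
      using linear_map_lspan[OF KA.left_module_axioms KA.left_module_axioms mult_right_linear[OF aR] fs(1)]
      by simp
    moreover have "lspan K R (map (\<lambda>f. f \<otimes>\<^bsub>R\<^esub> a) fs) \<subseteq> lspan K R ?fa"
      by (rule KA.lspan_mono[OF _ faR]) (use a in auto)
    ultimately have "y \<otimes>\<^bsub>R\<^esub> a \<in> lspan K R ?fa" by blast
    moreover have "(r \<ominus>\<^bsub>R\<^esub> y) \<otimes>\<^bsub>R\<^esub> a \<in> ?Q"
      using KR.U.ideal_mult_pow[OF nI y(2)] a as(1) by blast
    ultimately have "y \<otimes>\<^bsub>R\<^esub> a \<oplus>\<^bsub>R\<^esub> (r \<ominus>\<^bsub>R\<^esub> y) \<otimes>\<^bsub>R\<^esub> a \<in> ?T" by blast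
    moreover have "y \<otimes>\<^bsub>R\<^esub> a \<oplus>\<^bsub>R\<^esub> (r \<ominus>\<^bsub>R\<^esub> y) \<otimes>\<^bsub>R\<^esub> a = r \<otimes>\<^bsub>R\<^esub> a"
    proof -
      have "y \<oplus>\<^bsub>R\<^esub> (r \<ominus>\<^bsub>R\<^esub> y) = r"
        using r yR by (simp add: KR.M.minus_eq KR.M.add.m_lcomm KR.M.r_neg)
      then show ?thesis using r yR aR KR.U.l_distr[of y "r \<ominus>\<^bsub>R\<^esub> y" a] by simp
    qed
    ultimately show ?thesis by (simp only:)
  qed
  have span: "lspan R (left_regular R) bs \<subseteq> ?T" if "set bs \<subseteq> set as" for bs
    using that
  proof (induction bs)
    case Nil
    then show ?case using KA.submodD(2)[OF T] by simp
  next
    case (Cons b bs)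
    then have bs: "lspan R (left_regular R) bs \<subseteq> ?T" and b: "b \<in> set as" by auto
    show ?case
    proof
      fix x assume "x \<in> lspan R (left_regular R) (b # bs)"
      then obtain r y where ry: "r \<in> carrier R" "y \<in> lspan R (left_regular R) bs" "x = r \<otimes>\<^bsub>R\<^esub> b \<oplus>\<^bsub>R\<^esub> y"
        by auto
      have "y \<in> ?T" using ry(2) bs by blast
      then show "x \<in> ?T" unfolding ry(3) by (rule KA.submodD(3)[OF T ra[OF ry(1) b]])
    qed
  qed
  have "KA.fin_codim ?Q ?P"
    unfolding KA.fin_codim_def
  proof (intro exI[of _ ?fa] conjI ballI faR)
    fix x assume "x \<in> ?P"
    then have "x \<in> ?T" using as(2) span[of as] by blast
    then obtain y z where yz: "y \<in> lspan K R ?fa" "z \<in> ?Q" "x = y \<oplus>\<^bsub>R\<^esub> z" by blast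
    have "y \<in> carrier R" "z \<in> carrier R" using yz LR[OF faR] QR by auto
    then have "x \<ominus>\<^bsub>R\<^esub> y = z"
      unfolding yz(3) KR.M.minus_eq by (subst KR.M.a_comm[of y z]) (auto simp: KR.M.a_assoc KR.M.r_neg)
    then show "\<exists>y\<in>lspan K R ?fa. x \<ominus>\<^bsub>R\<^esub> y \<in> ?Q" using yz by blast
  qed
  then show ?case using KA.fin_codim_trans[OF _ QR Suc.IH] by blast
qed

text \<open>The map \<open>r \<mapsto> r x\<close> factors through the quotient of \<open>R\<close>
  by a power of \<open>n\<close>, which is finite dimensional.\<close>

lemma weight_cyclic_findim:
  assumes noeth: "noetherian_module R (left_regular R)" and n: "n \<in> cfs K R" and x: "x \<in> weight n"
  shows "KV.findim {r \<odot>\<^bsub>M\<^esub> x | r. r \<in> carrier R}"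
proof -
  obtain k where k: "x \<in> carrier M" "\<And>r. r \<in> ideal_pow R n k \<Longrightarrow> r \<odot>\<^bsub>M\<^esub> x = \<zero>\<^bsub>M\<^esub>"
    using x unfolding gen_weight_space_def by blast
  obtain xs where xs: "set xs \<subseteq> carrier R"
    "\<And>r. r \<in> carrier R \<Longrightarrow> \<exists>y\<in>lspan K R xs. r \<ominus>\<^bsub>R\<^esub> y \<in> ideal_pow R n k"
    using ideal_pow_fin_codim[OF noeth n, of k] unfolding KA.fin_codim_def by blast
  let ?p = "\<lambda>r. r \<odot>\<^bsub>M\<^esub> x"
  have "?p r \<in> lspan K MK (map ?p xs)" if r: "r \<in> carrier R" for r
  proof -
    obtain y where y: "y \<in> lspan K R xs" "r \<ominus>\<^bsub>R\<^esub> y \<in> ideal_pow R n k" using xs(2)[OF r] by blast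
    have yR: "y \<in> carrier R" using y(1) KA.submodD(1)[OF KA.lspan_submod[OF xs(1)]] by blast
    have "r \<odot>\<^bsub>M\<^esub> x \<ominus>\<^bsub>M\<^esub> y \<odot>\<^bsub>M\<^esub> x = \<zero>\<^bsub>M\<^esub>" using k(2)[OF y(2)] r yR k(1) by (simp add: RM.smult_l_diff)
    then have "?p r = ?p y"
      by (rule RM.M.minus_eq_zeroD) (use r yR k(1) in auto)
    then show ?thesis
      using y(1) linear_map_lspan[OF KA.left_module_axioms KV.left_module_axioms act_linear[OF k(1)] xs(1)]
      by simp
  qed
  moreover have "set (map ?p xs) \<subseteq> {r \<odot>\<^bsub>M\<^esub> x | r. r \<in> carrier R}" using xs(1) by auto
  ultimately show ?thesis
    unfolding KV.findim_def
    by (intro conjI submod_subspace[OF RM.cyclic_submod[OF k(1)]] exI[of _ "map ?p xs"]) auto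
qed

lemma cyclic_fin_gen_iff:
  assumes "v \<in> carrier M"
  shows "fin_gen K (MK\<lparr>carrier := {r \<odot>\<^bsub>M\<^esub> v | r. r \<in> carrier R}\<rparr>) \<longleftrightarrow>
    KV.findim {r \<odot>\<^bsub>M\<^esub> v | r. r \<in> carrier R}"
  using submod_subspace[OF RM.cyclic_submod[OF assms]]
  by (simp add: KV.submod_fin_gen_iff KV.findim_def)

section \<open>Local finiteness and weight decomposition\<close>

text \<open>The vectors that generate finite-dimensional submodules form a submodule
  \<open>?Z\<close>. It contains each weight space, hence every finite sum of weight
  vectors.\<close>

lemma direct_sum_locally_finite:
  assumes noeth: "noetherian_module R (left_regular R)"
    and sum: "internal_direct_sum M (cfs K R) weight" and v: "v \<in> carrier M"
  shows "KV.findim {r \<odot>\<^bsub>M\<^esub> v | r. r \<in> carrier R}"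
proof -
  let ?Z = "{x \<in> carrier M. KV.findim {r \<odot>\<^bsub>M\<^esub> x | r. r \<in> carrier R}}"
  have Z: "submodule ?Z R M"
  proof (rule RM.submodI)
    have "{r \<odot>\<^bsub>M\<^esub> \<zero>\<^bsub>M\<^esub> | r. r \<in> carrier R} = {\<zero>\<^bsub>M\<^esub>}" by (auto intro: exI[of _ "\<zero>\<^bsub>R\<^esub>"])
    moreover have "KV.findim {\<zero>\<^bsub>M\<^esub>}"
      unfolding KV.findim_def using submod_subspace[OF RM.zero_submod] by (auto intro!: exI[of _ "[]"])
    ultimately show "\<zero>\<^bsub>M\<^esub> \<in> ?Z" by simp
  next
    fix x y assume xy: "x \<in> ?Z" "y \<in> ?Z"
    let ?X = "{r \<odot>\<^bsub>M\<^esub> x | r. r \<in> carrier R}" and ?Y = "{r \<odot>\<^bsub>M\<^esub> y | r. r \<in> carrier R}"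
    have "KV.findim {a \<oplus>\<^bsub>MK\<^esub> b | a b. a \<in> ?X \<and> b \<in> ?Y}" by (rule KV.findim_sum) (use xy in auto)
    moreover have "{r \<odot>\<^bsub>M\<^esub> (x \<oplus>\<^bsub>M\<^esub> y) | r. r \<in> carrier R} \<subseteq> {a \<oplus>\<^bsub>MK\<^esub> b | a b. a \<in> ?X \<and> b \<in> ?Y}"
    proof
      fix z assume "z \<in> {r \<odot>\<^bsub>M\<^esub> (x \<oplus>\<^bsub>M\<^esub> y) | r. r \<in> carrier R}"
      then obtain r where r: "r \<in> carrier R" "z = r \<odot>\<^bsub>M\<^esub> (x \<oplus>\<^bsub>M\<^esub> y)" by blast
      have "z = r \<odot>\<^bsub>M\<^esub> x \<oplus>\<^bsub>MK\<^esub> r \<odot>\<^bsub>M\<^esub> y" using r xy by (simp add: RM.smult_r_distr)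
      then show "z \<in> {a \<oplus>\<^bsub>MK\<^esub> b | a b. a \<in> ?X \<and> b \<in> ?Y}" using r(1) by blast
    qed
    moreover have xyM: "x \<oplus>\<^bsub>M\<^esub> y \<in> carrier M" using xy by auto
    ultimately show "x \<oplus>\<^bsub>M\<^esub> y \<in> ?Z"
      using KV.findim_subspace[OF _ submod_subspace[OF RM.cyclic_submod[OF xyM]]] by blast
  next
    fix r x assume r: "r \<in> carrier R" and x: "x \<in> ?Z"
    have rx: "r \<odot>\<^bsub>M\<^esub> x \<in> carrier M" using r x by auto
    have "{s \<odot>\<^bsub>M\<^esub> (r \<odot>\<^bsub>M\<^esub> x) | s. s \<in> carrier R} \<subseteq> {r \<odot>\<^bsub>M\<^esub> x | r. r \<in> carrier R}"
      using r x RM.smult_assoc1[symmetric, OF _ r, of _ x] KR.U.m_closed[OF _ r] by blast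
    then show "r \<odot>\<^bsub>M\<^esub> x \<in> ?Z"
      using KV.findim_subspace[OF _ submod_subspace[OF RM.cyclic_submod[OF rx]]] x rx by blast
  qed auto
  have wZ: "weight n \<subseteq> ?Z" if "n \<in> cfs K R" for n
    using weight_cyclic_findim[OF noeth that] by (auto simp: gen_weight_space_def)
  obtain f where f: "f \<in> (\<Pi>\<^sub>E i\<in>cfs K R. weight i)"
    "v = (\<Oplus>\<^bsub>M\<^esub>i\<in>{i \<in> cfs K R. f i \<noteq> \<zero>\<^bsub>M\<^esub>}. f i)"
    using sum v unfolding internal_direct_sum_def bij_betw_def by (auto simp: image_iff)
  have "f \<in> {i \<in> cfs K R. f i \<noteq> \<zero>\<^bsub>M\<^esub>} \<rightarrow> ?Z" using f(1) wZ by blast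
  then have "v \<in> ?Z" unfolding f(2) by (rule RM.submod_finsum[OF Z])
  then show ?thesis by simp
qed

text \<open>Injectivity of the summation map is independence applied to differences; surjectivity
  comes from the spanning result for the finite-dimensional module generated by a single
  vector.\<close>

lemma locally_finite_direct_sum:
  assumes qc: "quasicommutative K R"
    and fin: "\<And>v. v \<in> carrier M \<Longrightarrow> KV.findim {r \<odot>\<^bsub>M\<^esub> v | r. r \<in> carrier R}"
  shows "internal_direct_sum M (cfs K R) weight"
proof -
  let ?I = "cfs K R"
  let ?F = "{f \<in> \<Pi>\<^sub>E i\<in>?I. weight i. finite {i \<in> ?I. f i \<noteq> \<zero>\<^bsub>M\<^esub>}}"
  let ?s = "\<lambda>f. \<Oplus>\<^bsub>M\<^esub>i\<in>{i \<in> ?I. f i \<noteq> \<zero>\<^bsub>M\<^esub>}. f i"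
  have wM: "x \<in> carrier M" if "x \<in> weight i" for x i using that by (simp add: gen_weight_space_def)
  have w: "submodule (weight i) R M" if "i \<in> ?I" for i by (rule weight_submod[OF cfs_ideal(1)[OF that]])
  \<comment> \<open>\<open>internal_direct_sum\<close> sums over exact supports, which may differ
    for two families; here the sum is moved to any finite set of ideals containing the
    support.\<close>
  have s_eq: "?s f = finsum M f A"
    if "finite A" "A \<subseteq> ?I" "{i \<in> ?I. f i \<noteq> \<zero>\<^bsub>M\<^esub>} \<subseteq> A" "\<And>i. i \<in> A \<Longrightarrow> f i \<in> weight i" for f A
    by (rule RM.M.add.finprod_mono_neutral_cong_left) (use that wM in blast)+
  have "inj_on ?s ?F"
  proof (rule inj_onI)
    fix f g assume f: "f \<in> ?F" and g: "g \<in> ?F" and eq: "?s f = ?s g"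
    let ?A = "{i \<in> ?I. f i \<noteq> \<zero>\<^bsub>M\<^esub>} \<union> {i \<in> ?I. g i \<noteq> \<zero>\<^bsub>M\<^esub>}"
    have A: "finite ?A" "?A \<subseteq> ?I" using f g by auto
    have fg: "f i \<in> weight i" "g i \<in> weight i" if "i \<in> ?I" for i using f g that by auto
    have fgM: "f i \<in> carrier M" "g i \<in> carrier M" if "i \<in> ?I" for i
      using fg[OF that] wM by auto
    have "finsum M f ?A = finsum M g ?A"
    proof -
      have "finsum M f ?A = ?s f" by (rule s_eq[OF A, symmetric]) (use A(2) fg in auto)
      moreover have "?s g = finsum M g ?A" by (rule s_eq[OF A]) (use A(2) fg in auto)
      ultimately show ?thesis using eq by (simp only:)
    qed
    moreover have "(\<Oplus>\<^bsub>M\<^esub>i\<in>?A. f i \<ominus>\<^bsub>M\<^esub> g i) \<oplus>\<^bsub>M\<^esub> finsum M g ?A = finsum M f ?A"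
    proof -
      have "(\<Oplus>\<^bsub>M\<^esub>i\<in>?A. f i \<ominus>\<^bsub>M\<^esub> g i) \<oplus>\<^bsub>M\<^esub> finsum M g ?A = (\<Oplus>\<^bsub>M\<^esub>i\<in>?A. (f i \<ominus>\<^bsub>M\<^esub> g i) \<oplus>\<^bsub>M\<^esub> g i)"
        by (rule RM.M.finsum_addf[symmetric]) (use fgM in auto)
      also have "\<dots> = finsum M f ?A"
        by (rule RM.M.finsum_cong')
          (use fgM in \<open>auto simp: RM.M.minus_eq RM.M.a_assoc RM.M.l_neg\<close>)
      finally show ?thesis .
    qed
    ultimately have "(\<Oplus>\<^bsub>M\<^esub>i\<in>?A. f i \<ominus>\<^bsub>M\<^esub> g i) \<oplus>\<^bsub>M\<^esub> finsum M g ?A = finsum M g ?A" by simp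
    moreover have "(\<Oplus>\<^bsub>M\<^esub>i\<in>?A. f i \<ominus>\<^bsub>M\<^esub> g i) \<in> carrier M" "finsum M g ?A \<in> carrier M"
      using fgM by (auto intro!: RM.M.finsum_closed)
    ultimately have zero: "(\<Oplus>\<^bsub>M\<^esub>i\<in>?A. f i \<ominus>\<^bsub>M\<^esub> g i) = \<zero>\<^bsub>M\<^esub>" by simp
    have "f i = g i" if i: "i \<in> ?I" for i
    proof (cases "i \<in> ?A")
      case True
      have "f i \<ominus>\<^bsub>M\<^esub> g i = \<zero>\<^bsub>M\<^esub>"
        by (rule weights_independent[OF A _ zero True]) (use fg RM.submodD(6)[OF w] in auto)
      then show ?thesis by (rule RM.M.minus_eq_zeroD) (use fgM[OF i] in auto)
    next
      case False
      then show ?thesis using i by auto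
    qed
    then show "f = g" using f g by (auto intro: PiE_ext)
  qed
  moreover have "?s ` ?F = carrier M"
  proof
    show "?s ` ?F \<subseteq> carrier M" using wM by (auto intro!: RM.M.finsum_closed)
    show "carrier M \<subseteq> ?s ` ?F"
    proof
      fix v assume v: "v \<in> carrier M"
      let ?V = "{r \<odot>\<^bsub>M\<^esub> v | r. r \<in> carrier R}"
      let ?Z = "{finsum M h A | h A. finite A \<and> A \<subseteq> ?I \<and> (\<forall>i\<in>A. h i \<in> weight i)}"
      have "?V \<subseteq> ?Z"
      proof (rule findim_weight_span[OF qc fin[OF v] RM.cyclic_submod[OF v] RM.finite_sums_submod[OF w]])
        fix n assume n: "n \<in> ?I"
        show "?V \<inter> weight n \<subseteq> ?Z"
        proof
          fix x assume "x \<in> ?V \<inter> weight n"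
          then have x: "x \<in> weight n" by blast
          have "x = (\<Oplus>\<^bsub>M\<^esub>i\<in>{n}. x)" using wM[OF x] by simp
          then show "x \<in> ?Z" unfolding mem_Collect_eq
            by (intro exI[of _ "\<lambda>_. x"] exI[of _ "{n}"]) (use n x in simp)
        qed
      qed
      moreover have "v \<in> ?V" using v RM.smult_one[OF v, symmetric] by blast
      ultimately have "v \<in> ?Z" by blast
      then obtain h A where h: "finite A" "A \<subseteq> ?I" "\<And>i. i \<in> A \<Longrightarrow> h i \<in> weight i" "v = finsum M h A"
        by blast
      \<comment> \<open>The finite family is padded by zero to all of \<open>cfs K R\<close> and
        left undefined elsewhere, as membership in the extensional product demands.\<close>
      define f where "f = (\<lambda>i\<in>?I. if i \<in> A then h i else \<zero>\<^bsub>M\<^esub>)"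
      have fA: "{i \<in> ?I. f i \<noteq> \<zero>\<^bsub>M\<^esub>} \<subseteq> A" by (auto simp: f_def)
      have "f \<in> ?F"
        using h(3) RM.submodD(2)[OF w] finite_subset[OF fA h(1)] by (auto simp: f_def)
      moreover have "?s f = finsum M f A"
        by (rule s_eq[OF h(1,2) fA]) (use h(2,3) in \<open>auto simp: f_def\<close>)
      moreover have "finsum M f A = v"
        unfolding h(4) by (rule RM.M.finsum_cong') (use h wM in \<open>auto simp: f_def\<close>)
      ultimately show "v \<in> ?s ` ?F" by (metis (no_types, lifting) image_eqI)
    qed
  qed
  ultimately show ?thesis unfolding internal_direct_sum_def bij_betw_def by blast
qed

end

text \<open>All laws are inherited from \<open>U\<close> by restriction. A subring shares the unit
  of \<open>U\<close>, so \<open>M\<close> remains a unital module over it.\<close>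

lemma subalgebra_alg_module:
  assumes A: "assoc_algebra K U" and G: "is_subalgebra K U \<Gamma>" and M: "left_module U M"
  shows "alg_module K (U\<lparr>carrier := \<Gamma>\<rparr>) M"
proof -
  interpret A: assoc_algebra K U by (rule A)
  interpret M: left_module U M by (rule M)
  have sub: "subring \<Gamma> U" and sm: "\<And>a x. \<lbrakk>a \<in> carrier K; x \<in> \<Gamma>\<rbrakk> \<Longrightarrow> a \<odot>\<^bsub>U\<^esub> x \<in> \<Gamma>"
    using G by (auto simp: is_subalgebra_def)
  have GU: "\<And>x. x \<in> \<Gamma> \<Longrightarrow> x \<in> carrier U" using subringE(1)[OF sub] by blast
  have ring: "ring (U\<lparr>carrier := \<Gamma>\<rparr>)" by (rule A.U.subring_is_ring[OF sub])
  have ab: "abelian_group (U\<lparr>carrier := \<Gamma>\<rparr>)" using ring by (rule ring.is_abelian_group)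
  have "module K (U\<lparr>carrier := \<Gamma>\<rparr>)"
    by (rule moduleI[OF A.K.is_cring ab])
      (use sm GU in \<open>auto simp: A.smult_l_distr A.smult_r_distr A.smult_assoc1\<close>)
  moreover have "assoc_algebra_axioms K (U\<lparr>carrier := \<Gamma>\<rparr>)"
    by (rule assoc_algebra_axioms.intro) (use GU in \<open>auto simp: A.smult_mult_left A.smult_mult_right\<close>)
  ultimately have "assoc_algebra K (U\<lparr>carrier := \<Gamma>\<rparr>)"
    using A.K.field_axioms ring by (intro assoc_algebra.intro)
  moreover have "left_module (U\<lparr>carrier := \<Gamma>\<rparr>) M"
    by (intro left_module.intro left_module_axioms.intro ring M.M.abelian_group_axioms)
      (use GU in \<open>auto simp: M.smult_l_distr M.smult_r_distr M.smult_assoc1\<close>)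
  ultimately show ?thesis by (rule alg_module.intro)
qed

theorem proposition2p12:
  fixes K :: "('k, 'c) ring_scheme"
    and U :: "('k, 'u, 'd) module_scheme"
    and \<Gamma> :: "'u set"
    and M :: "('u, 'm, 'e) module_scheme"
  assumes "assoc_algebra K U"
    and "harish_chandra_subalgebra K U \<Gamma>"
    and "two_sided_noetherian (U\<lparr>carrier := \<Gamma>\<rparr>)"
    and "left_module U M"
    and "fin_gen U M"
  shows "harish_chandra_module K U \<Gamma> M \<longleftrightarrow> locally_finite_action K U \<Gamma> M"
proof -
  have G: "is_subalgebra K U \<Gamma>" and qc: "quasicommutative K (U\<lparr>carrier := \<Gamma>\<rparr>)"
    using assms(2) by (auto simp: harish_chandra_subalgebra_def)
  interpret alg_module K "U\<lparr>carrier := \<Gamma>\<rparr>" M by (rule subalgebra_alg_module[OF assms(1) G assms(4)])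
  have noeth: "noetherian_module (U\<lparr>carrier := \<Gamma>\<rparr>) (left_regular (U\<lparr>carrier := \<Gamma>\<rparr>))"
    using assms(3) by (simp add: two_sided_noetherian_def)
  \<comment> \<open>The field acts on \<open>M\<close> through multiples of the unit, and \<Gamma>
    has the same unit and scalar multiplication as \<open>U\<close>; both algebras therefore induce
    the same vector space structure on \<open>M\<close>.\<close>
  have "MK = underlying_space U M" by (simp add: underlying_space_def)
  then have "locally_finite_action K U \<Gamma> M \<longleftrightarrow>
      (\<forall>v\<in>carrier M. KV.findim {r \<odot>\<^bsub>M\<^esub> v | r. r \<in> carrier (U\<lparr>carrier := \<Gamma>\<rparr>)})"
    using cyclic_fin_gen_iff by (simp add: locally_finite_action_def)
  moreover have "harish_chandra_module K U \<Gamma> M \<longleftrightarrow>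
      internal_direct_sum M (cfs K (U\<lparr>carrier := \<Gamma>\<rparr>)) weight"
    using assms(4,5) by (simp add: harish_chandra_module_def)
  ultimately show ?thesis
    using direct_sum_locally_finite[OF noeth] locally_finite_direct_sum[OF qc] by blast
qed

end
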